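(* Let $n\geq2$. The group $G$ of those equivalence transformations of the class of equations $\Omega_F^n[y]=0$ which transform every equation $\Omega_F^n[y]=0$ with parameter function of the form $F=\alpha(x)\,y$ into an equation $\Omega_{Q_n}^n[w]=0$ with parameter function of the same form $Q_n=\delta(z)\,w$ consists exactly of the transformations $x=\rho(z,w)$, $y=\psi(z,w)$ with $$\rho=\frac{k_2z+k_1}{k_4z+k_3}\quad(k_4=0\text{ or }1),\qquad \psi=r_0\,\rho_z^{(n-1)/2}\,w,$$ where $k_1,k_2,k_3$ are constants with $k_2k_3-k_1k_4\neq0$ and $r_0$ is an arbitrary nonzero constant. The corresponding expression of the transformed parameter function of $F=\alpha(x)\,y$ is $$Q_n(z,w)=r_0\,\alpha(\rho)\,\rho_z^{(n+1)/2}\,w.$$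
   Context: For a scalar function $F=F(x,y)$, the operator $\Omega_F=\frac{d}{dx}+F(x,y)$ acts, for $y=y(x)$, by $\Omega_F[u]=\frac{du}{dx}+F(x,y(x))\,u$ (the coefficient $F$ always being evaluated at the original unknown $y$); $\Omega_F^n[y]$ denotes the $n$-fold iterate applied to $y$. $F$ is called the parameter function of the equation $\Omega_F^n[y]=0$. Similarly $\Omega_Q^n[w]$, with $w=w(z)$ and $Q=Q(z,w)$, uses $\Omega_Q=\frac{d}{dz}+Q(z,w)$. For fixed $n\ge2$, an equivalence transformation of the class of equations $\Omega_F^n[y]=0$ ($F$ arbitrary) is an invertible point transformation $x=\rho(z,w)$, $y=\psi(z,w)$ (with $\rho_z\psi_w-\rho_w\psi_z\neq0$) which transforms every equation $\Omega_F^n[y]=0$ of the class into an equation equivalent (up to a nonvanishing factor) to $\Omega_Q^n[w]=0$ for some function $Q=Q(z,w)$, called the transformed parameter function. All functions are assumed sufficiently smooth and considered locally; $\alpha$, $\delta$ are functions of the independent variable only. For even $n$, the fractional power $\rho_z^{(n-1)/2}$ denotes a fixed local smooth branch (constant factors being absorbed into $r_0$), and $\rho_z^{(n+1)/2}=\rho_z\cdot\rho_z^{(n-1)/2}$. *)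

theory Defs
  imports "HOL-Analysis.Analysis"
begin

(* C^k and C^infinity on an open set S: the derivatives are taken at full neighbourhood
   filters, so only the values of f on the open set S matter. *)
fun Ck_on :: "nat \<Rightarrow> 'a::euclidean_space set \<Rightarrow> ('a \<Rightarrow> 'b::real_normed_vector) \<Rightarrow> bool" where
  "Ck_on 0 S f \<longleftrightarrow> continuous_on S f"
| "Ck_on (Suc k) S f \<longleftrightarrow>
     (\<forall>x\<in>S. f differentiable (at x)) \<and> (\<forall>v. Ck_on k S (\<lambda>x. frechet_derivative f (at x) v))"

definition smooth_on :: "'a::euclidean_space set \<Rightarrow> ('a \<Rightarrow> 'b::real_normed_vector) \<Rightarrow> bool" where
  "smooth_on S f \<longleftrightarrow> (\<forall>k. Ck_on k S f)"

definition pd1 :: "(real \<times> real \<Rightarrow> real) \<Rightarrow> real \<times> real \<Rightarrow> real" where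
  "pd1 f p = deriv (\<lambda>t. f (t, snd p)) (fst p)"

definition pd2 :: "(real \<times> real \<Rightarrow> real) \<Rightarrow> real \<times> real \<Rightarrow> real" where
  "pd2 f p = deriv (\<lambda>t. f (fst p, t)) (snd p)"

(* The operator d/dx + F(x,y) along a fixed curve y = y(x), acting on u; its coefficient
   stays evaluated at y under iteration. Thus Omega_F^n[y] is (Omega F y ^^ n) y. *)
definition Omega :: "(real \<times> real \<Rightarrow> real) \<Rightarrow> (real \<Rightarrow> real) \<Rightarrow> (real \<Rightarrow> real) \<Rightarrow> real \<Rightarrow> real" where
  "Omega F y u = (\<lambda>x. deriv u x + F (x, y x) * u x)"

definition point_transformation ::
  "(real \<times> real) set \<Rightarrow> (real \<times> real \<Rightarrow> real) \<Rightarrow> (real \<times> real \<Rightarrow> real) \<Rightarrow> bool" where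
  "point_transformation D \<rho> \<psi> \<longleftrightarrow>
     smooth_on D \<rho> \<and> smooth_on D \<psi> \<and> inj_on (\<lambda>p. (\<rho> p, \<psi> p)) D \<and>
     (\<forall>p\<in>D. pd1 \<rho> p * pd2 \<psi> p - pd2 \<rho> p * pd1 \<psi> p \<noteq> 0)"

(* The curve w = w(z), z in the open interval I, lies in D and is mapped by
   x = rho(z,w), y = psi(z,w) onto the curve y = y(x). Curves on which the total
   derivative of rho vanishes somewhere are excluded, as their image need not be the
   graph of a smooth function of x. *)
definition corresponding_curves ::
  "(real \<times> real) set \<Rightarrow> (real \<times> real \<Rightarrow> real) \<Rightarrow> (real \<times> real \<Rightarrow> real) \<Rightarrow>
     real set \<Rightarrow> (real \<Rightarrow> real) \<Rightarrow> (real \<Rightarrow> real) \<Rightarrow> bool" where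
  "corresponding_curves D \<rho> \<psi> I w y \<longleftrightarrow>
     open I \<and> is_interval I \<and> smooth_on I w \<and> smooth_on ((\<lambda>z. \<rho> (z, w z)) ` I) y \<and>
     (\<forall>z\<in>I. (z, w z) \<in> D \<and> deriv (\<lambda>t. \<rho> (t, w t)) z \<noteq> 0 \<and> y (\<rho> (z, w z)) = \<psi> (z, w z))"

definition jet :: "nat \<Rightarrow> (real \<Rightarrow> real) \<Rightarrow> real \<Rightarrow> real list" where
  "jet n w z = map (\<lambda>k. (deriv ^^ k) w z) [0..<Suc n]"

(* Q is a transformed parameter function of F: in the new variables Omega_F^n[y] is
   Omega_Q^n[w] times a nonvanishing factor, a function mu(z, w, w', ..., w^(n)) on jet
   space. Regularity of mu is automatic where it matters: both expressions are polynomial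
   in the top derivative w^(n), of degree one with nonvanishing leading coefficient. *)
definition transformed_parameter ::
  "nat \<Rightarrow> (real \<times> real) set \<Rightarrow> (real \<times> real \<Rightarrow> real) \<Rightarrow> (real \<times> real \<Rightarrow> real) \<Rightarrow>
     (real \<times> real \<Rightarrow> real) \<Rightarrow> (real \<times> real \<Rightarrow> real) \<Rightarrow> bool" where
  "transformed_parameter n D \<rho> \<psi> F Q \<longleftrightarrow>
     smooth_on D Q \<and>
     (\<exists>\<mu> :: real \<Rightarrow> real list \<Rightarrow> real. (\<forall>z j. \<mu> z j \<noteq> 0) \<and>
        (\<forall>I w y. corresponding_curves D \<rho> \<psi> I w y \<longrightarrow>
           (\<forall>z\<in>I. (Omega F y ^^ n) y (\<rho> (z, w z)) = \<mu> z (jet n w z) * (Omega Q w ^^ n) w z)))"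

definition equivalence_transformation ::
  "nat \<Rightarrow> (real \<times> real) set \<Rightarrow> (real \<times> real \<Rightarrow> real) \<Rightarrow> (real \<times> real \<Rightarrow> real) \<Rightarrow> bool" where
  "equivalence_transformation n D \<rho> \<psi> \<longleftrightarrow>
     point_transformation D \<rho> \<psi> \<and>
     (\<forall>F. smooth_on ((\<lambda>p. (\<rho> p, \<psi> p)) ` D) F \<longrightarrow> (\<exists>Q. transformed_parameter n D \<rho> \<psi> F Q))"

(* The elements with domain D of the (local) group of equivalence transformations mapping
   every F = alpha(x) y to some Q = delta(z) w. *)
definition G :: "nat \<Rightarrow> (real \<times> real) set \<Rightarrow> ((real \<times> real \<Rightarrow> real) \<times> (real \<times> real \<Rightarrow> real)) set" where
  "G n D = {(\<rho>, \<psi>). equivalence_transformation n D \<rho> \<psi> \<and>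
     (\<forall>\<alpha>. smooth_on (\<rho> ` D) \<alpha> \<longrightarrow>
        (\<exists>\<delta>. smooth_on (fst ` D) \<delta> \<and>
           transformed_parameter n D \<rho> \<psi> (\<lambda>(x, y). \<alpha> x * y) (\<lambda>(z, w). \<delta> z * w)))}"

(* half_pow a m is a^(m/2) for a \<noteq> 0: the honest power for even m, and for odd m the real
   smooth branch, which on an interval where a has constant sign agrees with any other
   branch up to a constant factor. *)
definition half_pow :: "real \<Rightarrow> nat \<Rightarrow> real" where
  "half_pow a m = (if even m then a ^ (m div 2) else \<bar>a\<bar> powr (real m / 2))"

(* Here rho_z^((n-1)/2) is half_pow (pd1 rho p) (n - 1). *)
definition projective_form ::
  "nat \<Rightarrow> (real \<times> real) set \<Rightarrow> real \<Rightarrow> real \<Rightarrow> real \<Rightarrow> real \<Rightarrow> real \<Rightarrow>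
     (real \<times> real \<Rightarrow> real) \<Rightarrow> (real \<times> real \<Rightarrow> real) \<Rightarrow> bool" where
  "projective_form n D k1 k2 k3 k4 r0 \<rho> \<psi> \<longleftrightarrow>
     (k4 = 0 \<or> k4 = 1) \<and> k2 * k3 - k1 * k4 \<noteq> 0 \<and> r0 \<noteq> 0 \<and>
     (\<forall>(z, w)\<in>D. k4 * z + k3 \<noteq> 0 \<and>
        \<rho> (z, w) = (k2 * z + k1) / (k4 * z + k3) \<and>
        \<psi> (z, w) = r0 * half_pow (pd1 \<rho> (z, w)) (n - 1) * w)"

end

theory Submission
  imports Defs "HOL-Computational_Algebra.Field_as_Ring" "HOL-Computational_Algebra.Polynomial_Factorial"
begin

text \<open>Write $L_f u = u' + f u$, so that the operator of the equation is $L_f$ with $f(x) = F(x, y(x))$.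

\<^bold>\<open>Projective transformations belong to the group.\<close>
Let $s = k_4 z + k_3$ and $\Delta = k_2 k_3 - k_1 k_4$. Then $d/dx = (s^2/\Delta)\, d/dz$, and up to a
constant $\psi = w/s^{n-1}$. Since $s$ is affine, $L_q^n(s u) = s L_q^n u + n s' L_q^{n-1} u$ for every
coefficient $q$, and an induction gives the identity of Bol
$(s^2 L_q)^n (s^{1-n} u) = s^{n+1} L_q^n u$ (lemma weighted_first_order_iterate_affine). Hence every
$F$ is carried to $Q = \rho_z F(\rho, \psi)$.

\<^bold>\<open>The group contains nothing else.\<close>
Two kinds of parameters $\alpha(x) y$ carry the argument: $\alpha = 0$, and the pulse
$\alpha = (x - x_0)^{n-1}$, which first acts on the $n$-th iterate, where it adds $(n-1)!\, y(x_0)^2$.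
Comparing their images on curves through a point with slope $w' = s$ gives, with
$J = \rho_z \psi_w - \rho_w \psi_z$,
\[ (n-1)!\, \psi^2 (\rho_z + s \rho_w)^{n+1} = J \cdot (R_1(s) - R_0(s)), \]
where $R_i(s)$ is the iterated operator of the transformed equation on the straight line of slope $s$
(lemma parameter_pulse).

\<^item> Each application of $d/dz + Q$ raises the degree in $s$ by at most one, so the right-hand side has
  degree at most $n$ while the left-hand side has degree $n + 1$ unless $\psi \rho_w = 0$. As $\psi$
  cannot vanish on an open set, $\rho_w = 0$ (lemma G_rho_fibre_constant).
\<^item> Now let $\phi(z, \cdot)$ invert $\psi(z, \cdot)$. The affine functions $y$ solve the equation with
  $F = 0$, so the transformed equation holds along $w = \phi(z, y_0 + s(\rho(z) - \rho(z_0)))$. Its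
  coefficient of $s^n$ is $\rho_z^n \partial_y^n \phi$, which therefore vanishes: $a = \phi(z, \cdot)$ is a
  polynomial. For $s = 0$ the displayed identity becomes $C y^2 a' = a^2 \cdot (b \circ a)$ with a
  polynomial $b$, and counting degrees leaves only $a = g(z) y$ (lemma inverse_linear_in_fibre).
\<^item> The curves $w = \lambda g \rho^i$ with $i < n$ come, after a shift of $x$, from the
  solutions $y = \lambda x^i$ of $y^{(n)} = 0$. The
  part of the transformed equation that is linear in $\lambda$ is $(g \rho^i)^{(n)} = 0$. Hence $g$, $g \rho$ and
  $g \rho^{n-1}$ are polynomials of degree less than $n$; writing $\rho$ in lowest terms $A/B$ forces
  $\deg A, \deg B \le 1$ and $g = h B^{n-1}$ with a constant $h$ (lemma rational_function_with_power).

This determines the transformation near each point of $D$. A Moebius transformation is determined by its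
values on an interval, so the local forms agree on the connected set $D$ (lemma G_projective).

\<^bold>\<open>The transformed parameter is unique.\<close>
Two transformed parameters $Q$ and $\beta(z) w$ of one equation give iterated operators that agree on all
curves. Perturbing a constant curve by $(z - z_0)^{n-1}$ shows that $P = Q - \beta w$ satisfies
$n P + w P_w = 0$, so $P = c(z)/w^n$. On constant curves the iterated operators are then Laurent
polynomials in $w$; that of $Q$ contains the most singular term $c^n w^{1 - n^2}$, whereas that of $\beta w$
has no negative powers. So $c = 0$ (lemma transformed_parameter_unique).\<close>

section \<open>Smooth functions\<close>

lemma Ck_on_continuous: "Ck_on k S f \<Longrightarrow> continuous_on S f"
  by (cases k) (auto intro!: continuous_at_imp_continuous_on simp: differentiable_imp_continuous_within)

lemma Ck_on_subset: "Ck_on k S f \<Longrightarrow> T \<subseteq> S \<Longrightarrow> Ck_on k T f"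
  by (induction k arbitrary: f) (auto intro: continuous_on_subset)

lemma Ck_on_cong:
  assumes "open S" "\<And>x. x \<in> S \<Longrightarrow> f x = g x" "Ck_on k S f"
  shows "Ck_on k S g"
  using assms(2,3)
proof (induction k arbitrary: f g)
  case 0
  then show ?case using continuous_on_cong by (metis Ck_on.simps(1))
next
  case (Suc k)
  have "g differentiable at x" if "x \<in> S" for x
  proof -
    have "f differentiable at x" using Suc.prems that by simp
    then obtain f' where "(f has_derivative f') (at x)" by (auto simp: differentiable_def)
    then have "(g has_derivative f') (at x)"
      by (rule has_derivative_transform_within_open[OF _ assms(1) that]) (use Suc.prems(1) in auto)
    then show ?thesis by (auto simp: differentiable_def)
  qed
  moreover have "Ck_on k S (\<lambda>x. frechet_derivative g (at x) v)" for v
  proof (rule Suc.IH[of "\<lambda>x. frechet_derivative f (at x) v"])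
    show "frechet_derivative f (at x) v = frechet_derivative g (at x) v" if "x \<in> S" for x
      using frechet_derivative_transform_within_open[of f x S g] Suc.prems that assms(1) by auto
  qed (use Suc.prems in auto)
  ultimately show ?case by simp
qed

lemma Ck_on_SucD: "Ck_on (Suc k) S f \<Longrightarrow> x \<in> S \<Longrightarrow>
    (f has_derivative frechet_derivative f (at x)) (at x)"
  by (simp add: frechet_derivative_works)

text \<open>The recursion refers to the derivative picked by a choice operator. Any explicitly known derivative may be
used in its place, because Frechet derivatives at the points of an open set are unique.\<close>

lemma Ck_on_SucI:
  assumes "open S" "\<And>x. x \<in> S \<Longrightarrow> (f has_derivative f' x) (at x)"
    "\<And>v. Ck_on k S (\<lambda>x. f' x v)"
  shows "Ck_on (Suc k) S f"
proof -
  have "Ck_on k S (\<lambda>x. frechet_derivative f (at x) v)" for v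
    by (rule Ck_on_cong[OF assms(1) _ assms(3)[of v]])
      (use assms(2) frechet_derivative_at in metis)
  then show ?thesis using assms(2) by (auto simp: differentiable_def)
qed

lemma Ck_on_Suc_imp: "Ck_on (Suc k) S f \<Longrightarrow> Ck_on k S f"
proof (induction k arbitrary: f)
  case 0
  then show ?case using Ck_on_continuous by fastforce
qed auto

lemma Ck_on_const: "Ck_on k S (\<lambda>_. c)"
proof (induction k arbitrary: c)
  case (Suc k)
  then show ?case by simp
qed auto

lemma Ck_on_bounded_linear:
  assumes "open S" "bounded_linear T" "Ck_on k S f"
  shows "Ck_on k S (\<lambda>x. T (f x))"
  using assms(3)
proof (induction k arbitrary: f)
  case 0
  then show ?case using assms(2) by (auto intro: bounded_linear.continuous_on)
next
  case (Suc k)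
  show ?case
  proof (rule Ck_on_SucI[OF assms(1)])
    show "((\<lambda>x. T (f x)) has_derivative (\<lambda>v. T (frechet_derivative f (at x) v))) (at x)"
      if "x \<in> S" for x
      by (rule bounded_linear.has_derivative[OF assms(2) Ck_on_SucD[OF Suc.prems that]])
    show "Ck_on k S (\<lambda>x. T (frechet_derivative f (at x) v))" for v
      using Suc by simp
  qed
qed

lemma Ck_on_add:
  assumes "open S" "Ck_on k S f" "Ck_on k S g"
  shows "Ck_on k S (\<lambda>x. f x + g x)"
  using assms(2,3)
proof (induction k arbitrary: f g)
  case 0
  then show ?case by (auto intro: continuous_intros)
next
  case (Suc k)
  show ?case
  proof (rule Ck_on_SucI[OF assms(1)])
    show "((\<lambda>x. f x + g x) has_derivative
        (\<lambda>v. frechet_derivative f (at x) v + frechet_derivative g (at x) v)) (at x)"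
      if "x \<in> S" for x
      by (rule has_derivative_add[OF Ck_on_SucD[OF Suc.prems(1) that] Ck_on_SucD[OF Suc.prems(2) that]])
    show "Ck_on k S (\<lambda>x. frechet_derivative f (at x) v + frechet_derivative g (at x) v)" for v
      using Suc by simp
  qed
qed

lemma Ck_on_bounded_bilinear:
  assumes "open S" "bounded_bilinear p" "Ck_on k S f" "Ck_on k S g"
  shows "Ck_on k S (\<lambda>x. p (f x) (g x))"
  using assms(3,4)
proof (induction k arbitrary: f g)
  case 0
  then show ?case using assms(2) by (auto intro: bounded_bilinear.continuous_on)
next
  case (Suc k)
  show ?case
  proof (rule Ck_on_SucI[OF assms(1)])
    show "((\<lambda>x. p (f x) (g x)) has_derivative
        (\<lambda>v. p (f x) (frechet_derivative g (at x) v) + p (frechet_derivative f (at x) v) (g x))) (at x)"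
      if "x \<in> S" for x
      by (rule bounded_bilinear.FDERIV[OF assms(2) Ck_on_SucD[OF Suc.prems(1) that] Ck_on_SucD[OF Suc.prems(2) that]])
    show "Ck_on k S (\<lambda>x. p (f x) (frechet_derivative g (at x) v)
        + p (frechet_derivative f (at x) v) (g x))" for v
      using Suc by (intro Ck_on_add assms Suc.IH Ck_on_Suc_imp[OF Suc.prems(1)]
          Ck_on_Suc_imp[OF Suc.prems(2)]) auto
  qed
qed

lemma Ck_on_sum:
  assumes "open S" "\<And>i. i \<in> A \<Longrightarrow> Ck_on k S (f i)"
  shows "Ck_on k S (\<lambda>x. \<Sum>i\<in>A. f i x)"
  using assms(2)
  by (induction A rule: infinite_finite_induct) (auto intro: Ck_on_const Ck_on_add assms(1))

text \<open>Expanding the inner derivative in the standard basis turns the derivative of the composite into a finite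
sum of products of directional derivatives. Each factor is one order less smooth, so the induction closes.\<close>

lemma Ck_on_compose:
  fixes f :: "'a::euclidean_space \<Rightarrow> 'b::euclidean_space" and g :: "'b \<Rightarrow> 'c::real_normed_vector"
  assumes "open S" "f ` S \<subseteq> T" "Ck_on k S f" "Ck_on k T g"
  shows "Ck_on k S (\<lambda>x. g (f x))"
  using assms(3,4)
proof (induction k arbitrary: g)
  case 0
  then show ?case using assms(2) by (auto intro: continuous_on_compose2)
next
  case (Suc k)
  let ?f' = "\<lambda>x. frechet_derivative f (at x)" and ?g' = "\<lambda>y. frechet_derivative g (at y)"
  show ?case
  proof (rule Ck_on_SucI[OF assms(1)])
    fix x assume x: "x \<in> S"
    then have fx: "f x \<in> T" using assms(2) by auto
    have g': "(g has_derivative ?g' (f x)) (at (f x))"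
      by (rule Ck_on_SucD[OF Suc.prems(2) fx])
    have "((\<lambda>x. g (f x)) has_derivative (\<lambda>v. ?g' (f x) (?f' x v))) (at x)"
      by (rule has_derivative_compose[OF Ck_on_SucD[OF Suc.prems(1) x] g'])
    moreover have "?g' (f x) (?f' x v) = (\<Sum>b\<in>Basis. (?f' x v \<bullet> b) *\<^sub>R ?g' (f x) b)" for v
    proof -
      have l: "linear (?g' (f x))" using g' by (simp add: has_derivative_linear)
      have "?g' (f x) (\<Sum>b\<in>Basis. (?f' x v \<bullet> b) *\<^sub>R b) = (\<Sum>b\<in>Basis. (?f' x v \<bullet> b) *\<^sub>R ?g' (f x) b)"
        by (simp add: linear_sum[OF l] linear_scale[OF l])
      then show ?thesis by (simp add: euclidean_representation)
    qed
    ultimately show "((\<lambda>x. g (f x)) has_derivative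
        (\<lambda>v. \<Sum>b\<in>Basis. (?f' x v \<bullet> b) *\<^sub>R ?g' (f x) b)) (at x)" by simp
  next
    fix v
    have "Ck_on k S (\<lambda>x. ?f' x v \<bullet> b)" for b
      by (rule Ck_on_bounded_linear[OF assms(1) bounded_linear_inner_left]) (use Suc.prems in simp)
    moreover have "Ck_on k S (\<lambda>x. ?g' (f x) b)" for b
      by (rule Suc.IH[OF Ck_on_Suc_imp[OF Suc.prems(1)]]) (use Suc.prems(2) in simp)
    ultimately show "Ck_on k S (\<lambda>x. \<Sum>b\<in>Basis. (?f' x v \<bullet> b) *\<^sub>R ?g' (f x) b)"
      by (intro Ck_on_sum assms(1) Ck_on_bounded_bilinear[OF assms(1) bounded_bilinear_scaleR])
  qed
qed

lemma smooth_on_continuous: "smooth_on S f \<Longrightarrow> continuous_on S f"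
  unfolding smooth_on_def using Ck_on_continuous[of 0 S f] by simp

lemma smooth_on_subset: "smooth_on S f \<Longrightarrow> T \<subseteq> S \<Longrightarrow> smooth_on T f"
  unfolding smooth_on_def using Ck_on_subset[of _ S f T] by simp

lemma smooth_on_cong: "open S \<Longrightarrow> smooth_on S f \<Longrightarrow> (\<And>x. x \<in> S \<Longrightarrow> f x = g x) \<Longrightarrow> smooth_on S g"
  unfolding smooth_on_def using Ck_on_cong[of S f g] by simp

lemma smooth_on_differentiable: "smooth_on S f \<Longrightarrow> x \<in> S \<Longrightarrow>
    (f has_derivative frechet_derivative f (at x)) (at x)"
  unfolding smooth_on_def by (rule Ck_on_SucD[of 0], rule spec)

lemma smooth_on_frechet: "smooth_on S f \<Longrightarrow> smooth_on S (\<lambda>x. frechet_derivative f (at x) v)"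
  unfolding smooth_on_def
proof
  fix k assume "\<forall>k. Ck_on k S f"
  then have "Ck_on (Suc k) S f" by blast
  then show "Ck_on k S (\<lambda>x. frechet_derivative f (at x) v)" by simp
qed

lemma smooth_onI:
  assumes "open S" "\<And>x. x \<in> S \<Longrightarrow> (f has_derivative f' x) (at x)" "\<And>v. smooth_on S (\<lambda>x. f' x v)"
  shows "smooth_on S f"
  unfolding smooth_on_def
proof
  fix k
  have "Ck_on (Suc k) S f"
    by (rule Ck_on_SucI[OF assms(1,2)]) (use assms(3) smooth_on_def in auto)
  then show "Ck_on k S f" by (rule Ck_on_Suc_imp)
qed

lemma smooth_on_const: "smooth_on S (\<lambda>_. c)"
  by (simp add: smooth_on_def Ck_on_const)

lemma smooth_on_bounded_linear:
  "open S \<Longrightarrow> bounded_linear T \<Longrightarrow> smooth_on S f \<Longrightarrow> smooth_on S (\<lambda>x. T (f x))"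
  by (simp add: smooth_on_def Ck_on_bounded_linear)

lemma smooth_on_linear: "open S \<Longrightarrow> bounded_linear T \<Longrightarrow> smooth_on S T"
  by (rule smooth_onI[where f' = "\<lambda>_. T"])
    (auto intro: bounded_linear_imp_has_derivative smooth_on_const)

lemma smooth_on_id: "open S \<Longrightarrow> smooth_on S (\<lambda>x. x)"
  by (simp add: smooth_on_linear bounded_linear_ident)

lemma smooth_on_fst: "open S \<Longrightarrow> smooth_on S fst"
  by (simp add: smooth_on_linear bounded_linear_fst)

lemma smooth_on_snd: "open S \<Longrightarrow> smooth_on S snd"
  by (simp add: smooth_on_linear bounded_linear_snd)

lemma smooth_on_add:
  "open S \<Longrightarrow> smooth_on S f \<Longrightarrow> smooth_on S g \<Longrightarrow> smooth_on S (\<lambda>x. f x + g x)"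
  by (simp add: smooth_on_def Ck_on_add)

lemma smooth_on_minus:
  "open S \<Longrightarrow> smooth_on S f \<Longrightarrow> smooth_on S (\<lambda>x. - f x)"
  by (rule smooth_on_bounded_linear[OF _ bounded_linear_minus[OF bounded_linear_ident]])

lemma smooth_on_diff:
  "open S \<Longrightarrow> smooth_on S f \<Longrightarrow> smooth_on S g \<Longrightarrow> smooth_on S (\<lambda>x. f x - g x)"
  using smooth_on_add[of S f "\<lambda>x. - g x"] smooth_on_minus by fastforce

lemma smooth_on_mult:
  fixes f :: "'a::euclidean_space \<Rightarrow> real"
  shows "open S \<Longrightarrow> smooth_on S f \<Longrightarrow> smooth_on S g \<Longrightarrow> smooth_on S (\<lambda>x. f x * g x)"
  by (simp add: smooth_on_def Ck_on_bounded_bilinear bounded_bilinear_mult)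

lemma smooth_on_power:
  fixes f :: "'a::euclidean_space \<Rightarrow> real"
  shows "open S \<Longrightarrow> smooth_on S f \<Longrightarrow> smooth_on S (\<lambda>x. f x ^ n)"
  by (induction n) (auto intro: smooth_on_const smooth_on_mult)

lemma smooth_on_compose:
  fixes f :: "'a::euclidean_space \<Rightarrow> 'b::euclidean_space"
  shows "open S \<Longrightarrow> smooth_on S f \<Longrightarrow> smooth_on T g \<Longrightarrow> f ` S \<subseteq> T \<Longrightarrow> smooth_on S (\<lambda>x. g (f x))"
  unfolding smooth_on_def using Ck_on_compose[of S f T _ g] by simp

lemma smooth_on_Pair:
  fixes f :: "'a::euclidean_space \<Rightarrow> 'b::euclidean_space" and g :: "'a \<Rightarrow> 'c::euclidean_space"
  assumes "open S" "smooth_on S f" "smooth_on S g"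
  shows "smooth_on S (\<lambda>x. (f x, g x))"
proof -
  have "smooth_on S (\<lambda>x. (f x, 0) + (0, g x))"
    by (intro smooth_on_add assms smooth_on_bounded_linear[OF _ _ assms(2), of "\<lambda>u. (u, 0)"]
        smooth_on_bounded_linear[OF _ _ assms(3), of "\<lambda>u. (0, u)"] bounded_linear_Pair
        bounded_linear_ident bounded_linear_zero)
  then show ?thesis by simp
qed

text \<open>The derivative of the reciprocal is a product of reciprocals, to which the induction hypothesis applies.\<close>

lemma Ck_on_inverse: "Ck_on k {x. x \<noteq> (0::real)} inverse"
proof (induction k)
  case 0
  then show ?case by (auto intro!: continuous_intros)
next
  case (Suc k)
  have o: "open {x. x \<noteq> (0::real)}" by (auto intro: open_Collect_neq continuous_intros)
  show ?case
  proof (rule Ck_on_SucI[OF o])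
    show "(inverse has_derivative (\<lambda>v. - (inverse x * v * inverse x))) (at x)"
      if "x \<in> {x. x \<noteq> (0::real)}" for x
      by (rule has_derivative_inverse') (use that in auto)
    have "Ck_on k {x. x \<noteq> 0} (\<lambda>x. inverse x * inverse (x::real))"
      by (rule Ck_on_bounded_bilinear[OF o bounded_bilinear_mult Suc Suc])
    then show "Ck_on k {x. x \<noteq> 0} (\<lambda>x. - (inverse x * v * inverse (x::real)))" for v
      using Ck_on_bounded_linear[OF o bounded_linear_mult_right[of "-v"]]
      by (simp add: mult.assoc mult.left_commute)
  qed
qed

lemma smooth_on_divide:
  fixes f :: "'a::euclidean_space \<Rightarrow> real"
  assumes "open S" "smooth_on S f" "smooth_on S g" "\<And>x. x \<in> S \<Longrightarrow> g x \<noteq> 0"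
  shows "smooth_on S (\<lambda>x. f x / g x)"
proof -
  have "smooth_on S (\<lambda>x. inverse (g x))"
    by (rule smooth_on_compose[OF assms(1,3), of "{x. x \<noteq> 0}"])
      (use assms(4) Ck_on_inverse in \<open>auto simp: smooth_on_def\<close>)
  then show ?thesis using smooth_on_mult[OF assms(1,2)] by (simp add: divide_inverse)
qed

lemma smooth_on_real_derivative:
  fixes f :: "real \<Rightarrow> real"
  assumes "smooth_on S f" "x \<in> S"
  shows "(f has_real_derivative deriv f x) (at x)"
  using smooth_on_differentiable[OF assms]
  by (metis DERIV_deriv_iff_real_differentiable differentiable_def)

lemma smooth_on_deriv:
  fixes f :: "real \<Rightarrow> real"
  assumes "open S" "smooth_on S f"
  shows "smooth_on S (deriv f)"
proof (rule smooth_on_cong[OF assms(1) smooth_on_frechet[OF assms(2), of 1]])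
  fix x assume "x \<in> S"
  then have "(f has_derivative (*) (deriv f x)) (at x)"
    using smooth_on_real_derivative[OF assms(2)] by (simp add: has_field_derivative_def)
  then show "frechet_derivative f (at x) 1 = deriv f x"
    using frechet_derivative_at by (metis mult.right_neutral)
qed

lemma smooth_on_deriv_iterate:
  fixes f :: "real \<Rightarrow> real"
  assumes "open S" "smooth_on S f"
  shows "smooth_on S ((deriv ^^ k) f)"
  by (induction k) (auto intro: assms smooth_on_deriv)

lemma pd_frechet:
  assumes "(f has_derivative f') (at p)"
  shows "pd1 f p = f' (1, 0)" "pd2 f p = f' (0, 1)"
proof -
  obtain a b where p: "p = (a, b)" by (cases p)
  have 1: "((\<lambda>t. (t, b)) has_derivative (\<lambda>h. (h, 0))) (at a)"
    and 2: "((\<lambda>t. (a, t)) has_derivative (\<lambda>h. (0, h))) (at b)"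
    by (auto intro!: derivative_eq_intros)
  have l: "linear f'" using assms by (rule has_derivative_linear)
  have "((\<lambda>t. f (t, b)) has_derivative (\<lambda>h. f' (h, 0))) (at a)"
    using has_derivative_compose[OF 1, of f f'] assms p by simp
  moreover have "(\<lambda>h. f' (h, 0)) = (*) (f' (1, 0))"
  proof
    fix h
    have "f' (h *\<^sub>R (1, 0)) = h *\<^sub>R f' (1, 0)" by (rule linear_scale[OF l])
    then show "f' (h, 0) = f' (1, 0) * h" by simp
  qed
  ultimately show "pd1 f p = f' (1, 0)"
    unfolding pd1_def p fst_conv snd_conv by (intro DERIV_imp_deriv) (simp only: has_field_derivative_def)
  have "((\<lambda>t. f (a, t)) has_derivative (\<lambda>h. f' (0, h))) (at b)"
    using has_derivative_compose[OF 2, of f f'] assms p by simp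
  moreover have "(\<lambda>h. f' (0, h)) = (*) (f' (0, 1))"
  proof
    fix h
    have "f' (h *\<^sub>R (0, 1)) = h *\<^sub>R f' (0, 1)" by (rule linear_scale[OF l])
    then show "f' (0, h) = f' (0, 1) * h" by simp
  qed
  ultimately show "pd2 f p = f' (0, 1)"
    unfolding pd2_def p fst_conv snd_conv by (intro DERIV_imp_deriv) (simp only: has_field_derivative_def)
qed

lemma smooth_on_has_derivative_pd:
  assumes "smooth_on S f" "p \<in> S"
  shows "(f has_derivative (\<lambda>v. pd1 f p * fst v + pd2 f p * snd v)) (at p)"
proof -
  let ?f' = "frechet_derivative f (at p)"
  have d: "(f has_derivative ?f') (at p)" by (rule smooth_on_differentiable[OF assms])
  then have l: "linear ?f'" by (rule has_derivative_linear)
  have "?f' v = pd1 f p * fst v + pd2 f p * snd v" for v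
  proof -
    have "?f' v = ?f' (fst v *\<^sub>R (1, 0) + snd v *\<^sub>R (0, 1))" by simp
    also have "\<dots> = fst v *\<^sub>R ?f' (1, 0) + snd v *\<^sub>R ?f' (0, 1)"
      by (simp only: linear_add[OF l] linear_scale[OF l])
    finally show ?thesis using pd_frechet[OF d] by simp
  qed
  then have "?f' = (\<lambda>v. pd1 f p * fst v + pd2 f p * snd v)" by blast
  then show ?thesis using d by simp
qed

lemma smooth_on_pd:
  assumes "open S" "smooth_on S f"
  shows "smooth_on S (pd1 f)" "smooth_on S (pd2 f)"
proof -
  show "smooth_on S (pd1 f)"
    by (rule smooth_on_cong[OF assms(1) smooth_on_frechet[OF assms(2), of "(1, 0)"]])
      (simp add: pd_frechet(1)[OF smooth_on_differentiable[OF assms(2)]])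
  show "smooth_on S (pd2 f)"
    by (rule smooth_on_cong[OF assms(1) smooth_on_frechet[OF assms(2), of "(0, 1)"]])
      (simp add: pd_frechet(2)[OF smooth_on_differentiable[OF assms(2)]])
qed

lemma has_derivative_along_curve:
  assumes "smooth_on S f" "(z, w z) \<in> S" "(w has_real_derivative w') (at z)"
  shows "((\<lambda>t. f (t, w t)) has_real_derivative pd1 f (z, w z) + pd2 f (z, w z) * w') (at z)"
proof -
  have "((\<lambda>t. (t, w t)) has_derivative (\<lambda>h. (h, w' * h))) (at z)"
    using assms(3) by (auto intro!: derivative_eq_intros simp: has_field_derivative_def)
  from has_derivative_compose[OF this smooth_on_has_derivative_pd[OF assms(1,2)]]
  have "((\<lambda>t. f (t, w t)) has_derivative
      (\<lambda>h. pd1 f (z, w z) * h + pd2 f (z, w z) * (w' * h))) (at z)" by simp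
  moreover have "(\<lambda>h. pd1 f (z, w z) * h + pd2 f (z, w z) * (w' * h)) =
      (*) (pd1 f (z, w z) + pd2 f (z, w z) * w')"
    by (auto simp: algebra_simps)
  ultimately show ?thesis unfolding has_field_derivative_def by simp
qed

lemma has_derivative_slices:
  assumes "smooth_on S f" "(z, w) \<in> S"
  shows "((\<lambda>t. f (t, w)) has_real_derivative pd1 f (z, w)) (at z)"
    "((\<lambda>t. f (z, t)) has_real_derivative pd2 f (z, w)) (at w)"
proof -
  show "((\<lambda>t. f (t, w)) has_real_derivative pd1 f (z, w)) (at z)"
    using has_derivative_along_curve[of S f z "\<lambda>_. w" 0] assms by simp
  have "((\<lambda>t. (z, t)) has_derivative (\<lambda>h. (0, h))) (at w)"
    by (auto intro!: derivative_eq_intros)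
  from has_derivative_compose[OF this smooth_on_has_derivative_pd[OF assms]]
  show "((\<lambda>t. f (z, t)) has_real_derivative pd2 f (z, w)) (at w)"
    by (simp add: has_field_derivative_def)
qed

lemmas smooth_intros = smooth_on_const smooth_on_id smooth_on_add smooth_on_diff smooth_on_minus
  smooth_on_mult smooth_on_power smooth_on_deriv smooth_on_deriv_iterate smooth_on_pd
  smooth_on_fst smooth_on_snd

section \<open>Iterated derivatives and orders of vanishing\<close>

lemma deriv_iterate_cong:
  fixes f g :: "real \<Rightarrow> real"
  assumes "open S" "\<And>x. x \<in> S \<Longrightarrow> f x = g x" "x \<in> S"
  shows "(deriv ^^ k) f x = (deriv ^^ k) g x"
  using assms(3)
proof (induction k arbitrary: x)
  case 0
  then show ?case using assms(2) by simp
next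
  case (Suc k)
  have "eventually (\<lambda>t. (deriv ^^ k) f t = (deriv ^^ k) g t) (nhds x)"
    using Suc assms(1) eventually_nhds by blast
  then show ?case by (simp add: deriv_cong_ev)
qed

lemma deriv_iterate_Suc: "(deriv ^^ Suc k) f = (deriv ^^ k) (deriv f)"
  by (simp add: funpow_swap1)

lemma deriv_iterate_add:
  fixes f g :: "real \<Rightarrow> real"
  assumes "open S" "smooth_on S f" "smooth_on S g" "x \<in> S"
  shows "(deriv ^^ k) (\<lambda>x. f x + g x) x = (deriv ^^ k) f x + (deriv ^^ k) g x"
  using assms(4)
proof (induction k arbitrary: x)
  case (Suc k)
  have "(deriv ^^ Suc k) (\<lambda>x. f x + g x) x = deriv (\<lambda>x. (deriv ^^ k) f x + (deriv ^^ k) g x) x"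
    using deriv_iterate_cong[OF assms(1) Suc.IH Suc.prems, of _ 1] by simp
  also have "\<dots> = (deriv ^^ Suc k) f x + (deriv ^^ Suc k) g x"
    unfolding funpow.simps comp_def
    by (intro DERIV_imp_deriv DERIV_add smooth_on_real_derivative[OF _ Suc.prems]
        smooth_on_deriv_iterate assms)
  finally show ?case .
qed simp

lemma deriv_iterate_cmult:
  fixes f :: "real \<Rightarrow> real"
  assumes "open S" "smooth_on S f" "x \<in> S"
  shows "(deriv ^^ k) (\<lambda>x. c * f x) x = c * (deriv ^^ k) f x"
  using assms(3)
proof (induction k arbitrary: x)
  case (Suc k)
  have "(deriv ^^ Suc k) (\<lambda>x. c * f x) x = deriv (\<lambda>x. c * (deriv ^^ k) f x) x"
    using deriv_iterate_cong[OF assms(1) Suc.IH Suc.prems, of _ 1] by simp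
  also have "\<dots> = c * (deriv ^^ Suc k) f x"
    unfolding funpow.simps comp_def
    by (intro DERIV_imp_deriv DERIV_cmult smooth_on_real_derivative[OF _ Suc.prems]
        smooth_on_deriv_iterate assms)
  finally show ?case .
qed simp

lemma deriv_mult_smooth:
  fixes f g :: "real \<Rightarrow> real"
  assumes "smooth_on S f" "smooth_on S g" "x \<in> S"
  shows "deriv (\<lambda>x. f x * g x) x = deriv f x * g x + f x * deriv g x"
  using DERIV_imp_deriv[OF DERIV_mult[OF smooth_on_real_derivative[OF assms(1,3)]
        smooth_on_real_derivative[OF assms(2,3)]]] by (simp add: algebra_simps)

text \<open>The order of vanishing at a point, in terms of derivatives. Being closed under multiplication by smooth
factors, it replaces Taylor expansions in the comparisons below.\<close>

definition flat :: "nat \<Rightarrow> (real \<Rightarrow> real) \<Rightarrow> real \<Rightarrow> bool" where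
  "flat m f x0 \<longleftrightarrow> (\<forall>i<m. (deriv ^^ i) f x0 = 0)"

lemma flat_Suc: "flat (Suc m) f x0 \<longleftrightarrow> f x0 = 0 \<and> flat m (deriv f) x0"
  unfolding flat_def by (auto simp: less_Suc_eq_0_disj funpow_swap1)

lemma flat_Suc': "flat (Suc m) f x0 \<longleftrightarrow> flat m f x0 \<and> (deriv ^^ m) f x0 = 0"
  unfolding flat_def by (auto simp: less_Suc_eq)

lemma flat_add:
  assumes "open S" "x0 \<in> S" "smooth_on S f" "smooth_on S g" "flat m f x0" "flat m g x0"
  shows "flat m (\<lambda>x. f x + g x) x0"
  using assms deriv_iterate_add[OF assms(1,3,4,2)] unfolding flat_def by simp

lemma flat_mono: "flat m f x0 \<Longrightarrow> k \<le> m \<Longrightarrow> flat k f x0"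
  by (simp add: flat_def)

lemma flat_cong:
  assumes "open S" "x0 \<in> S" "\<And>x. x \<in> S \<Longrightarrow> f x = g x"
  shows "flat m f x0 = flat m g x0"
  using deriv_iterate_cong[OF assms(1,3,2)] unfolding flat_def by simp

text \<open>Among the Leibniz terms of order at most m only the one that differentiates the flat factor m times survives.\<close>

lemma flat_mult:
  assumes "open S" "x0 \<in> S" "smooth_on S f" "smooth_on S g" "flat m f x0"
  shows "flat m (\<lambda>x. f x * g x) x0 \<and>
    (deriv ^^ m) (\<lambda>x. f x * g x) x0 = (deriv ^^ m) f x0 * g x0"
  using assms(3-5)
proof (induction m arbitrary: f g)
  case 0
  then show ?case by (simp add: flat_def)
next
  case (Suc m)
  note S = assms(1) and x0 = assms(2)
  have sm: "smooth_on S (deriv f)" "smooth_on S (deriv g)"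
    using Suc.prems by (auto intro: smooth_on_deriv S)
  have eq: "deriv (\<lambda>x. f x * g x) x = deriv f x * g x + f x * deriv g x" if "x \<in> S" for x
    by (rule deriv_mult_smooth[OF Suc.prems(1,2) that])
  have f: "f x0 = 0" "flat m (deriv f) x0" "flat m f x0" "(deriv ^^ m) f x0 = 0"
    using Suc.prems(3) flat_Suc flat_Suc' by auto
  note 1 = Suc.IH[OF sm(1) Suc.prems(2) f(2)] and 2 = Suc.IH[OF Suc.prems(1) sm(2) f(3)]
  have s: "smooth_on S (\<lambda>x. deriv f x * g x)" "smooth_on S (\<lambda>x. f x * deriv g x)"
    by (auto intro: smooth_on_mult S sm Suc.prems)
  have c: "flat m (deriv (\<lambda>x. f x * g x)) x0 = flat m (\<lambda>x. deriv f x * g x + f x * deriv g x) x0"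
    by (rule flat_cong[OF S x0]) (rule eq)
  have e: "(deriv ^^ m) (deriv (\<lambda>x. f x * g x)) x0 = (deriv ^^ m) (\<lambda>x. deriv f x * g x + f x * deriv g x) x0"
    by (rule deriv_iterate_cong[OF S _ x0]) (rule eq)
  have "flat m (deriv (\<lambda>x. f x * g x)) x0"
    unfolding c by (rule flat_add[OF S x0 s]) (use 1 2 in auto)
  moreover have "(deriv ^^ m) (deriv (\<lambda>x. f x * g x)) x0 = (deriv ^^ m) (deriv f) x0 * g x0"
    unfolding e deriv_iterate_add[OF S s x0] using 1 2 f(4) by simp
  ultimately show ?case unfolding flat_Suc deriv_iterate_Suc using f(1) by simp
qed

lemma DERIV_shifted_power:
  "((\<lambda>x. (x - x0) ^ Suc n) has_real_derivative real (Suc n) * (x - x0) ^ n) (at x)"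
proof -
  have "((\<lambda>x. x - x0) has_real_derivative 1) (at x)" by (auto intro!: derivative_eq_intros)
  from DERIV_power_Suc[OF this, of n] show ?thesis by simp
qed

lemma deriv_iterate_power:
  "(deriv ^^ n) (\<lambda>x. (x - x0) ^ n) x0 = fact n \<and> flat n (\<lambda>x. (x - x0) ^ n) (x0::real)"
proof (induction n)
  case 0
  then show ?case by (simp add: flat_def)
next
  case (Suc n)
  have d: "deriv (\<lambda>x. (x - x0) ^ Suc n) = (\<lambda>x. real (Suc n) * (x - x0) ^ n)"
    by (rule ext, rule DERIV_imp_deriv, rule DERIV_shifted_power)
  have s: "smooth_on UNIV (\<lambda>x. (x - x0) ^ n)" by (intro smooth_intros open_UNIV)
  have c: "(deriv ^^ k) (\<lambda>x. real (Suc n) * (x - x0) ^ n) x0 = real (Suc n) * (deriv ^^ k) (\<lambda>x. (x - x0) ^ n) x0" for k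
    by (rule deriv_iterate_cmult[OF open_UNIV s UNIV_I])
  show ?case
    using Suc unfolding deriv_iterate_Suc flat_Suc d unfolding flat_def c by simp
qed

lemma deriv_iterate_power_mult:
  assumes "open S" "x0 \<in> S" "smooth_on S g"
  shows "flat n (\<lambda>x. (x - x0) ^ n * g x) x0"
    "(deriv ^^ n) (\<lambda>x. (x - x0) ^ n * g x) x0 = fact n * g x0"
proof -
  have "smooth_on S (\<lambda>x. (x - x0) ^ n)" by (intro smooth_intros assms)
  from flat_mult[OF assms(1,2) this assms(3)] deriv_iterate_power
  show "flat n (\<lambda>x. (x - x0) ^ n * g x) x0"
    "(deriv ^^ n) (\<lambda>x. (x - x0) ^ n * g x) x0 = fact n * g x0" by auto
qed

text \<open>The leading Taylor coefficient as a limit, by repeated use of l'Hospital's rule.\<close>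

lemma flat_limit:
  assumes "open S" "x0 \<in> S" "smooth_on S g" "flat m g x0"
  shows "((\<lambda>x. g x / (x - x0) ^ m) \<longlongrightarrow> (deriv ^^ m) g x0 / fact m) (at x0)"
  using assms(3,4)
proof (induction m arbitrary: g)
  case 0
  have "isCont g x0" using smooth_on_real_derivative[OF 0(1) assms(2)] DERIV_isCont by blast
  then show ?case by (simp add: isCont_def)
next
  case (Suc m)
  have g: "g x0 = 0" "flat m (deriv g) x0" using Suc.prems flat_Suc by auto
  have "((\<lambda>x. deriv g x / (x - x0) ^ m) \<longlongrightarrow> (deriv ^^ m) (deriv g) x0 / fact m) (at x0)"
    by (rule Suc.IH) (use assms g Suc.prems smooth_on_deriv in auto)
  then have "((\<lambda>x. 1 / real (Suc m) * (deriv g x / (x - x0) ^ m)) \<longlongrightarrow> 1 / real (Suc m) * ((deriv ^^ m) (deriv g) x0 / fact m)) (at x0)"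
    by (intro tendsto_mult tendsto_const)
  then have lim: "((\<lambda>x. deriv g x / (real (Suc m) * (x - x0) ^ m)) \<longlongrightarrow> (deriv ^^ Suc m) g x0 / fact (Suc m)) (at x0)"
    unfolding deriv_iterate_Suc fact_Suc times_divide_times_eq mult_1 .
  have "isCont g x0" using smooth_on_real_derivative[OF Suc.prems(1) assms(2)] DERIV_isCont by blast
  then have 0: "(g \<longlongrightarrow> 0) (at x0)" using g(1) by (simp add: isCont_def)
  have "((\<lambda>x. (x - x0) ^ Suc m) \<longlongrightarrow> (x0 - x0) ^ Suc m) (at x0)"
    by (intro tendsto_intros)
  then have 1: "((\<lambda>x. (x - x0) ^ Suc m) \<longlongrightarrow> 0) (at x0)" by simp
  have ev: "\<forall>\<^sub>F x in at x0. x \<in> S \<and> x \<noteq> x0"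
    using eventually_at_in_open[OF assms(1,2)] by simp
  show ?case
  proof (rule lhopital[OF 0 1 _ _ _ _ lim])
    show "\<forall>\<^sub>F x in at x0. (x - x0) ^ Suc m \<noteq> 0"
      using ev by (rule eventually_mono) auto
    show "\<forall>\<^sub>F x in at x0. real (Suc m) * (x - x0) ^ m \<noteq> 0"
      using ev by (rule eventually_mono) auto
    show "\<forall>\<^sub>F x in at x0. (g has_real_derivative deriv g x) (at x)"
      using ev by (rule eventually_mono) (use smooth_on_real_derivative[OF Suc.prems(1)] in auto)
    show "\<forall>\<^sub>F x in at x0. ((\<lambda>x. (x - x0) ^ Suc m) has_real_derivative real (Suc m) * (x - x0) ^ m) (at x)"
      using DERIV_shifted_power by simp
  qed
qed

text \<open>Converse of the preceding lemma: the limit of the quotient forces the lower derivatives to vanish one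
after the other. This is how contact of two curves is read off after a change of the independent variable,
where the derivatives themselves would require the formula of Faa di Bruno.\<close>

lemma flat_of_limit:
  assumes "open S" "x0 \<in> S" "smooth_on S g"
    and lim: "((\<lambda>x. g x / (x - x0) ^ n) \<longlongrightarrow> c) (at x0)"
  shows "flat n g x0" "(deriv ^^ n) g x0 = fact n * c"
proof -
  have "m \<le> n \<Longrightarrow> flat m g x0" for m
  proof (induction m)
    case 0
    then show ?case by (simp add: flat_def)
  next
    case (Suc m)
    then have fl: "flat m g x0" by simp
    have "((\<lambda>x. g x / (x - x0) ^ n * (x - x0) ^ (n - m)) \<longlongrightarrow> c * (x0 - x0) ^ (n - m)) (at x0)"
      by (intro tendsto_intros lim)
    also have "c * (x0 - x0) ^ (n - m) = 0" using Suc.prems by simp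
    finally have lim0: "((\<lambda>x. g x / (x - x0) ^ n * (x - x0) ^ (n - m)) \<longlongrightarrow> 0) (at x0)" .
    have ev: "\<forall>\<^sub>F x in at x0. g x / (x - x0) ^ n * (x - x0) ^ (n - m) = g x / (x - x0) ^ m"
    proof -
      have "(x - x0) ^ n = (x - x0) ^ m * (x - x0) ^ (n - m)" for x
        using Suc.prems by (simp flip: power_add)
      then have "g x / (x - x0) ^ n * (x - x0) ^ (n - m) = g x / (x - x0) ^ m" if "x \<noteq> x0" for x
        using that by simp
      then show ?thesis unfolding eventually_at_filter by (intro always_eventually) blast
    qed
    have "((\<lambda>x. g x / (x - x0) ^ m) \<longlongrightarrow> 0) (at x0)"
      by (rule Lim_transform_eventually[OF lim0 ev])
    from tendsto_unique[OF trivial_limit_at this flat_limit[OF assms(1-3) fl]]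
    have "0 = (deriv ^^ m) g x0 / fact m" .
    then have "(deriv ^^ m) g x0 = 0" by simp
    then show ?case using fl flat_Suc' by blast
  qed
  then show fl: "flat n g x0" by simp
  from tendsto_unique[OF trivial_limit_at lim flat_limit[OF assms(1-3) fl]]
  have "c = (deriv ^^ n) g x0 / fact n" .
  then show "(deriv ^^ n) g x0 = fact n * c" by simp
qed

lemma pderiv_surj:
  fixes q :: "real poly"
  assumes "\<And>i. i \<ge> n \<Longrightarrow> coeff q i = 0"
  obtains p where "pderiv p = q" "\<And>i. i \<ge> Suc n \<Longrightarrow> coeff p i = 0"
proof
  let ?p = "\<Sum>i<n. monom (coeff q i / real (Suc i)) (Suc i)"
  show "pderiv ?p = q"
  proof (rule poly_eqI)
    fix i
    have "coeff ?p (Suc i) = (\<Sum>j<n. if j = i then coeff q j / real (Suc j) else 0)"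
      by (simp add: coeff_sum coeff_monom)
    also have "\<dots> = coeff q i / real (Suc i)" using assms[of i] by (cases "i < n") auto
    finally show "coeff (pderiv ?p) i = coeff q i" by (simp add: coeff_pderiv)
  qed
  show "coeff ?p i = 0" if "i \<ge> Suc n" for i
    using that by (auto simp: coeff_sum coeff_monom intro!: sum.neutral)
qed

lemma deriv_iterate_zero_imp_poly:
  fixes f :: "real \<Rightarrow> real"
  assumes "open I" "is_interval I" "smooth_on I f" "\<And>x. x \<in> I \<Longrightarrow> (deriv ^^ n) f x = 0"
  obtains p where "\<And>i. i \<ge> n \<Longrightarrow> coeff p i = 0" "\<And>x. x \<in> I \<Longrightarrow> f x = poly p x"
  using assms(3,4)
proof (induction n arbitrary: f thesis)
  case 0
  from 0(1)[of 0] 0(3) show ?case by simp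
next
  case (Suc n)
  obtain q where q: "\<And>i. i \<ge> n \<Longrightarrow> coeff q i = 0" "\<And>x. x \<in> I \<Longrightarrow> deriv f x = poly q x"
    using Suc.IH[of "deriv f"] Suc.prems(2,3) smooth_on_deriv[OF assms(1)]
    unfolding deriv_iterate_Suc by blast
  obtain p where p: "pderiv p = q" "\<And>i. i \<ge> Suc n \<Longrightarrow> coeff p i = 0"
    using pderiv_surj q(1) by blast
  have "((\<lambda>x. f x - poly p x) has_derivative (\<lambda>h. 0)) (at x within I)" if "x \<in> I" for x
  proof -
    have "((\<lambda>x. f x - poly p x) has_real_derivative deriv f x - poly (pderiv p) x) (at x)"
      by (intro DERIV_diff poly_DERIV smooth_on_real_derivative[OF Suc.prems(2) that])
    then have "((\<lambda>x. f x - poly p x) has_real_derivative 0) (at x)"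
      using p(1) q(2)[OF that] by simp
    then show ?thesis
      by (simp add: has_field_derivative_def has_derivative_at_withinI lambda_zero)
  qed
  then obtain c where c: "\<And>x. x \<in> I \<Longrightarrow> f x - poly p x = c"
    using has_derivative_zero_constant[of I "\<lambda>x. f x - poly p x"] assms(2) is_interval_convex by blast
  show ?case
  proof (rule Suc.prems(1)[of "p + [:c:]"])
    show "f x = poly (p + [:c:]) x" if "x \<in> I" for x using c[OF that] by simp
    show "coeff (p + [:c:]) i = 0" if "i \<ge> Suc n" for i
      using p(2)[OF that] that by (cases i) auto
  qed
qed

section \<open>First order operators\<close>

definition first_order :: "(real \<Rightarrow> real) \<Rightarrow> (real \<Rightarrow> real) \<Rightarrow> real \<Rightarrow> real" where
  "first_order f u = (\<lambda>x. deriv u x + f x * u x)"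

lemma Omega_eq_first_order: "Omega F y = first_order (\<lambda>x. F (x, y x))"
  by (simp add: fun_eq_iff Omega_def first_order_def)

lemma smooth_on_first_order_iterate:
  assumes "open S" "smooth_on S f" "smooth_on S u"
  shows "smooth_on S ((first_order f ^^ k) u)"
  by (induction k) (auto simp: first_order_def intro!: smooth_intros assms)

lemma first_order_iterate_cong:
  assumes "open S" "\<And>x. x \<in> S \<Longrightarrow> f x = g x" "\<And>x. x \<in> S \<Longrightarrow> u x = v x" "x \<in> S"
  shows "(first_order f ^^ k) u x = (first_order g ^^ k) v x"
  using assms(4)
proof (induction k arbitrary: x)
  case 0
  then show ?case using assms(3) by simp
next
  case (Suc k)
  then show ?case
    using deriv_iterate_cong[OF assms(1) Suc.IH Suc.prems, of _ 1] assms(2)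
    by (simp add: first_order_def)
qed

text \<open>First variation of the iterated operator. If function and coefficient are both changed to order n - 1, then
products of two changes are too flat to be seen at the point, and three contributions remain: the change of
the function differentiated n times; its (n-1)-st derivative, which meets the coefficient at each of the n
factors; and the change of the coefficient, which reaches order zero only from the first factor. The
induction follows how the order of vanishing drops by one with each factor.\<close>

lemma first_order_iterate_perturb:
  assumes "n \<ge> 2" "open S" "x0 \<in> S"
    and sm: "smooth_on S a" "smooth_on S b" "smooth_on S f" "smooth_on S g"
    and ba: "flat (n - 1) (\<lambda>x. b x - a x) x0" and gf: "flat (n - 1) (\<lambda>x. g x - f x) x0"
  shows "(first_order g ^^ n) b x0 - (first_order f ^^ n) a x0 =
    (deriv ^^ n) (\<lambda>x. b x - a x) x0 + real n * f x0 * (deriv ^^ (n - 1)) (\<lambda>x. b x - a x) x0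
      + a x0 * (deriv ^^ (n - 1)) (\<lambda>x. g x - f x) x0"
proof -
  note S = assms(2) and x0 = assms(3)
  define d where "d j = (\<lambda>x. (first_order g ^^ j) b x - (first_order f ^^ j) a x)" for j
  define u where "u j = (first_order g ^^ j) b" for j
  define A where "A = (deriv ^^ (n - 1)) (\<lambda>x. b x - a x) x0"
  define B where "B = (deriv ^^ n) (\<lambda>x. b x - a x) x0"
  define C where "C = (deriv ^^ (n - 1)) (\<lambda>x. g x - f x) x0"
  have smd: "smooth_on S (d j)" "smooth_on S (u j)" for j
    unfolding d_def u_def by (intro smooth_on_diff S smooth_on_first_order_iterate sm)+
  have sgf: "smooth_on S (\<lambda>x. g x - f x)" by (intro smooth_on_diff S sm)
  have dSuc: "d (Suc j) x = deriv (d j) x + (d j x * f x + (g x - f x) * u j x)" if "x \<in> S" for j x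
  proof -
    have "deriv (d j) x = deriv ((first_order g ^^ j) b) x - deriv ((first_order f ^^ j) a) x"
      unfolding d_def using that sm S
      by (intro DERIV_imp_deriv DERIV_diff smooth_on_real_derivative smooth_on_first_order_iterate)
    then show ?thesis
      unfolding d_def u_def by (simp add: first_order_def algebra_simps)
  qed
  have DSuc: "(deriv ^^ i) (d (Suc j)) x0 = (deriv ^^ Suc i) (d j) x0
      + (deriv ^^ i) (\<lambda>x. d j x * f x) x0 + (deriv ^^ i) (\<lambda>x. (g x - f x) * u j x) x0" for i j
  proof -
    have "(deriv ^^ i) (d (Suc j)) x0 =
        (deriv ^^ i) (\<lambda>x. deriv (d j) x + (d j x * f x + (g x - f x) * u j x)) x0"
      by (rule deriv_iterate_cong[OF S dSuc x0])
    also have "\<dots> = (deriv ^^ i) (deriv (d j)) x0 + (deriv ^^ i) (\<lambda>x. d j x * f x + (g x - f x) * u j x) x0"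
      by (rule deriv_iterate_add[OF S _ _ x0]) (intro smooth_intros S smd sm sgf)+
    also have "(deriv ^^ i) (\<lambda>x. d j x * f x + (g x - f x) * u j x) x0 =
       (deriv ^^ i) (\<lambda>x. d j x * f x) x0 + (deriv ^^ i) (\<lambda>x. (g x - f x) * u j x) x0"
      by (rule deriv_iterate_add[OF S _ _ x0]) (intro smooth_intros S smd sm sgf)+
    finally show ?thesis unfolding deriv_iterate_Suc by simp
  qed
  have gfu: "flat (n - 1) (\<lambda>x. (g x - f x) * u j x) x0 \<and>
      (deriv ^^ (n - 1)) (\<lambda>x. (g x - f x) * u j x) x0 = C * u j x0" for j
    unfolding C_def by (rule flat_mult[OF S x0 sgf smd(2) gf])
  have ab: "b x0 = a x0" using ba assms(1) unfolding flat_def by (auto dest: spec[of _ 0])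
  have main: "j \<le> n - 1 \<Longrightarrow> flat (n - 1 - j) (d j) x0 \<and> (deriv ^^ (n - 1 - j)) (d j) x0 = A \<and>
      (deriv ^^ (n - j)) (d j) x0 = B + real j * f x0 * A + (if j = 0 then 0 else a x0 * C)" for j
  proof (induction j)
    case 0
    then show ?case using ba by (simp add: d_def A_def B_def)
  next
    case (Suc j)
    define m where "m = n - 1 - Suc j"
    have m: "n - 1 - j = Suc m" "n - j = Suc (Suc m)" "n - Suc j = Suc m"
      using Suc.prems unfolding m_def by auto
    have ih: "flat (Suc m) (d j) x0" "(deriv ^^ Suc m) (d j) x0 = A"
      "(deriv ^^ Suc (Suc m)) (d j) x0 = B + real j * f x0 * A + (if j = 0 then 0 else a x0 * C)"
      using Suc m by auto
    have df: "flat (Suc m) (\<lambda>x. d j x * f x) x0"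
      "(deriv ^^ Suc m) (\<lambda>x. d j x * f x) x0 = A * f x0"
      using flat_mult[OF S x0 smd(1) sm(3) ih(1)] ih(2) by auto
    have mn: "m < n - 1" using Suc.prems m_def by auto
    have z: "(deriv ^^ i) (\<lambda>x. d j x * f x) x0 = 0" if "i \<le> m" for i
      using df(1) that unfolding flat_def by simp
    have z2: "(deriv ^^ i) (\<lambda>x. (g x - f x) * u j x) x0 = 0" if "i < n - 1" for i
      using gfu[of j] that unfolding flat_def by simp
    have "(deriv ^^ i) (d (Suc j)) x0 = 0" if "i < m" for i
      using DSuc[of i j] z[of i] z2[of i] that mn ih(1)[unfolded flat_def, rule_format, of "Suc i"]
      by simp
    then have 1: "flat m (d (Suc j)) x0" unfolding flat_def by blast
    have 2: "(deriv ^^ m) (d (Suc j)) x0 = A"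
      unfolding DSuc ih(2) using z[of m] z2[of m] mn by simp
    have "(deriv ^^ Suc m) (\<lambda>x. (g x - f x) * u j x) x0 = (if j = 0 then a x0 * C else 0)"
    proof (cases "j = 0")
      case True
      then have "Suc m = n - 1" using m by simp
      then show ?thesis using gfu[of j] True ab by (simp add: u_def)
    next
      case False
      then have "Suc m < n - 1" using m by simp
      then show ?thesis using z2[of "Suc m"] False by simp
    qed
    then have 3: "(deriv ^^ Suc m) (d (Suc j)) x0 = B + real (Suc j) * f x0 * A + a x0 * C"
      unfolding DSuc[of "Suc m" j] ih(3) df(2) by (simp add: algebra_simps)
    show ?case using 1 2 3 m m_def by simp
  qed
  define k where "k = n - 1"
  have n: "n = Suc k" "k \<ge> 1" using assms(1) by (auto simp: k_def)
  have k: "d k x0 = A" "deriv (d k) x0 = B + real k * f x0 * A + a x0 * C"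
    using main[of k] n by auto
  have "(g x0 - f x0) = 0" using gf assms(1) unfolding flat_def by (auto dest: spec[of _ 0])
  then have "d n x0 = B + real n * f x0 * A + a x0 * C"
    using dSuc[OF x0, of k] k n by (simp add: algebra_simps)
  then show ?thesis unfolding d_def A_def B_def C_def .
qed

lemma smooth_on_along_curve:
  fixes Q :: "real \<times> real \<Rightarrow> real"
  assumes "open S" "smooth_on T Q" "smooth_on S a" "\<And>x. x \<in> S \<Longrightarrow> (x, a x) \<in> T"
  shows "smooth_on S (\<lambda>x. Q (x, a x))"
  by (rule smooth_on_compose[OF assms(1) smooth_on_Pair[OF assms(1) smooth_on_id[OF assms(1)] assms(3)] assms(2)])
    (use assms(4) in auto)

lemma deriv_along_curve:
  assumes "smooth_on T Q" "smooth_on S a" "x \<in> S" "(x, a x) \<in> T"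
  shows "deriv (\<lambda>x. Q (x, a x)) x = pd1 Q (x, a x) + pd2 Q (x, a x) * deriv a x"
  by (intro DERIV_imp_deriv has_derivative_along_curve[where w = a, OF assms(1,4)]
      smooth_on_real_derivative[OF assms(2,3)])

lemma deriv_along_curve_diff:
  assumes "open S" "open T" "smooth_on T Q" "smooth_on S a" "smooth_on S b"
    "\<And>x. x \<in> S \<Longrightarrow> (x, a x) \<in> T" "\<And>x. x \<in> S \<Longrightarrow> (x, b x) \<in> T" "x \<in> S"
  shows "deriv (\<lambda>x. Q (x, b x) - Q (x, a x)) x = (pd1 Q (x, b x) - pd1 Q (x, a x)) +
    (deriv (\<lambda>x. b x - a x) x * pd2 Q (x, b x) + (pd2 Q (x, b x) - pd2 Q (x, a x)) * deriv a x)"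
proof -
  note s = smooth_on_real_derivative[OF _ assms(8)]
  have 1: "deriv (\<lambda>x. Q (x, b x) - Q (x, a x)) x = deriv (\<lambda>x. Q (x, b x)) x - deriv (\<lambda>x. Q (x, a x)) x"
    by (intro DERIV_imp_deriv DERIV_diff s smooth_on_along_curve[OF assms(1,3)] assms)
  have 2: "deriv (\<lambda>x. b x - a x) x = deriv b x - deriv a x"
    by (intro DERIV_imp_deriv DERIV_diff s assms)
  show ?thesis
    unfolding 1 2 deriv_along_curve[OF assms(3,4,8) assms(6)[OF assms(8)]]
      deriv_along_curve[OF assms(3,5,8) assms(7)[OF assms(8)]]
    by (simp add: algebra_simps)
qed

text \<open>Evaluating a smooth Q along two curves with contact of order n. Differentiating the difference once gives
differences of the same kind for the partial derivatives of Q, so the induction has to range over all Q.\<close>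

lemma flat_along_curve_diff:
  assumes "open S" "open T" "x0 \<in> S" "smooth_on T Q" "smooth_on S a" "smooth_on S b"
    "\<And>x. x \<in> S \<Longrightarrow> (x, a x) \<in> T" "\<And>x. x \<in> S \<Longrightarrow> (x, b x) \<in> T"
    "flat n (\<lambda>x. b x - a x) x0"
  shows "flat n (\<lambda>x. Q (x, b x) - Q (x, a x)) x0"
    "n \<ge> 1 \<Longrightarrow> (deriv ^^ n) (\<lambda>x. Q (x, b x) - Q (x, a x)) x0 =
      pd2 Q (x0, a x0) * (deriv ^^ n) (\<lambda>x. b x - a x) x0"
proof -
  note S = assms(1) and x0 = assms(3)
  note cs = smooth_on_along_curve[OF S _ assms(5,7)] smooth_on_along_curve[OF S _ assms(6,8)]
  have step: "flat (Suc n) (\<lambda>x. Q (x, b x) - Q (x, a x)) x0 \<and>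
     (deriv ^^ Suc n) (\<lambda>x. Q (x, b x) - Q (x, a x)) x0 =
        (deriv ^^ n) (\<lambda>x. pd1 Q (x, b x) - pd1 Q (x, a x)) x0 +
        pd2 Q (x0, b x0) * (deriv ^^ Suc n) (\<lambda>x. b x - a x) x0 +
        (deriv ^^ n) (\<lambda>x. pd2 Q (x, b x) - pd2 Q (x, a x)) x0 * deriv a x0"
    if Q: "smooth_on T Q" and ba: "flat (Suc n) (\<lambda>x. b x - a x) x0"
      and f1: "flat n (\<lambda>x. pd1 Q (x, b x) - pd1 Q (x, a x)) x0"
      and f2: "flat n (\<lambda>x. pd2 Q (x, b x) - pd2 Q (x, a x)) x0" for n Q
  proof -
    note pd = smooth_on_pd[OF assms(2) Q]
    have sba: "smooth_on S (\<lambda>x. b x - a x)" by (intro smooth_on_diff S assms)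
    note eq = deriv_along_curve_diff[OF S assms(2) Q assms(5-8)]
    have s1: "smooth_on S (\<lambda>x. pd1 Q (x, b x) - pd1 Q (x, a x))"
      "smooth_on S (\<lambda>x. pd2 Q (x, b x) - pd2 Q (x, a x))"
      "smooth_on S (deriv (\<lambda>x. b x - a x))" "smooth_on S (\<lambda>x. pd2 Q (x, b x))" "smooth_on S (deriv a)"
      by (intro smooth_on_diff smooth_on_deriv S cs pd sba assms; simp)+
    have ba': "flat n (deriv (\<lambda>x. b x - a x)) x0" "b x0 = a x0" using ba flat_Suc by auto
    note m1 = flat_mult[OF S x0 s1(3,4) ba'(1)] and m2 = flat_mult[OF S x0 s1(2,5) f2]
    have s2: "smooth_on S (\<lambda>x. deriv (\<lambda>x. b x - a x) x * pd2 Q (x, b x))"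
      "smooth_on S (\<lambda>x. (pd2 Q (x, b x) - pd2 Q (x, a x)) * deriv a x)"
      by (intro smooth_on_mult S s1)+
    note s3 = smooth_on_add[OF S s2]
    let ?e = "\<lambda>x. (pd1 Q (x, b x) - pd1 Q (x, a x)) +
      (deriv (\<lambda>x. b x - a x) x * pd2 Q (x, b x) + (pd2 Q (x, b x) - pd2 Q (x, a x)) * deriv a x)"
    have c: "flat n (deriv (\<lambda>x. Q (x, b x) - Q (x, a x))) x0 = flat n ?e x0"
      by (rule flat_cong[OF S x0]) (rule eq)
    have e: "(deriv ^^ n) (deriv (\<lambda>x. Q (x, b x) - Q (x, a x))) x0 = (deriv ^^ n) ?e x0"
      by (rule deriv_iterate_cong[OF S _ x0]) (rule eq)
    have "flat n (deriv (\<lambda>x. Q (x, b x) - Q (x, a x))) x0"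
      unfolding c by (rule flat_add[OF S x0 s1(1) s3 f1 flat_add[OF S x0 s2]]) (use m1 m2 in auto)
    moreover have "(deriv ^^ n) (deriv (\<lambda>x. Q (x, b x) - Q (x, a x))) x0 =
       (deriv ^^ n) (\<lambda>x. pd1 Q (x, b x) - pd1 Q (x, a x)) x0 +
        (pd2 Q (x0, b x0) * (deriv ^^ n) (deriv (\<lambda>x. b x - a x)) x0 +
        (deriv ^^ n) (\<lambda>x. pd2 Q (x, b x) - pd2 Q (x, a x)) x0 * deriv a x0)"
      unfolding e deriv_iterate_add[OF S s1(1) s3 x0] deriv_iterate_add[OF S s2 x0]
      using m1 m2 by simp
    ultimately show ?thesis unfolding deriv_iterate_Suc flat_Suc using ba' by simp
  qed
  have fl: "flat n (\<lambda>x. Q (x, b x) - Q (x, a x)) x0"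
    if "smooth_on T Q" "flat n (\<lambda>x. b x - a x) x0" for n Q
    using that
  proof (induction n arbitrary: Q)
    case 0
    then show ?case by (simp add: flat_def)
  next
    case (Suc n)
    have "flat n (\<lambda>x. b x - a x) x0" using Suc.prems(2) flat_Suc' by blast
    then show ?case using step[OF Suc.prems] Suc.IH smooth_on_pd[OF assms(2) Suc.prems(1)] by blast
  qed
  show "flat n (\<lambda>x. Q (x, b x) - Q (x, a x)) x0" by (rule fl[OF assms(4,9)])
  assume "n \<ge> 1"
  then obtain m where m: "n = Suc m" by (cases n) auto
  note pd = smooth_on_pd[OF assms(2,4)]
  have fl': "flat (Suc m) (\<lambda>x. pd1 Q (x, b x) - pd1 Q (x, a x)) x0"
    "flat (Suc m) (\<lambda>x. pd2 Q (x, b x) - pd2 Q (x, a x)) x0"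
    using fl pd assms(9) m by blast+
  moreover have "b x0 = a x0" using assms(9) m flat_Suc by simp
  ultimately show "(deriv ^^ n) (\<lambda>x. Q (x, b x) - Q (x, a x)) x0 =
      pd2 Q (x0, a x0) * (deriv ^^ n) (\<lambda>x. b x - a x) x0"
    using step[OF assms(4), of m] assms(9) unfolding m flat_Suc' by simp
qed

section \<open>Polynomial dependence on a parameter of the curve\<close>

text \<open>The coefficient rule for differentiating a polynomial in s whose argument moves with speed proportional to
s: one part keeps the degree, the other raises it by one.\<close>

lemma sum_shift_add:
  "(\<Sum>i\<le>Suc m. ((if i \<le> m then a i else 0) + (if i = 0 then 0 else b (i - 1))) * (s::real) ^ i) =
    (\<Sum>i\<le>m. a i * s ^ i) + s * (\<Sum>i\<le>m. b i * s ^ i)"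
proof -
  have 1: "(\<Sum>i\<le>Suc m. (if i \<le> m then a i else 0) * s ^ i) = (\<Sum>i\<le>m. a i * s ^ i)"
    by (simp add: sum.atMost_Suc)
  have 2: "(\<Sum>i\<le>Suc m. (if i = 0 then 0 else b (i - 1)) * s ^ i) = (\<Sum>i\<le>m. b i * s ^ Suc i)"
    unfolding sum.atMost_Suc_shift by simp
  have "(\<Sum>i\<le>Suc m. ((if i \<le> m then a i else 0) + (if i = 0 then 0 else b (i - 1))) * s ^ i) =
    (\<Sum>i\<le>Suc m. (if i \<le> m then a i else 0) * s ^ i) +
    (\<Sum>i\<le>Suc m. (if i = 0 then 0 else b (i - 1)) * s ^ i)"
    unfolding distrib_right sum.distrib by simp
  also have "\<dots> = (\<Sum>i\<le>m. a i * s ^ i) + (\<Sum>i\<le>m. b i * s ^ Suc i)"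
    unfolding 1 2 by simp
  also have "(\<Sum>i\<le>m. b i * s ^ Suc i) = s * (\<Sum>i\<le>m. b i * s ^ i)"
    unfolding sum_distrib_left by (intro sum.cong) auto
  finally show ?thesis .
qed

lemma smooth_on_pd2_iterate: "open U \<Longrightarrow> smooth_on U f \<Longrightarrow> smooth_on U ((pd2 ^^ m) f)"
  by (induction m) (auto intro: smooth_on_pd)

lemma pd2_iterate_slice: "(pd2 ^^ m) f (z, y) = (deriv ^^ m) (\<lambda>t. f (z, t)) y"
proof (induction m arbitrary: y)
  case (Suc m)
  have "(\<lambda>t. (pd2 ^^ m) f (z, t)) = (deriv ^^ m) (\<lambda>t. f (z, t))" using Suc by (intro ext)
  moreover have "pd2 g (z, y) = deriv (\<lambda>t. g (z, t)) y" for g by (simp add: pd2_def)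
  ultimately show ?case by simp
qed simp

text \<open>Along the curve w = \<phi>(z, e + s \<kappa>(z)) every application of the operator sends a polynomial in s with
coefficients depending on (z, y) to such a polynomial of degree one higher. The factor s enters only through
the derivative of the argument e + s \<kappa>(z), and not through the term with Q. Hence the top coefficient is
obtained by applying \<kappa>' \<partial>/\<partial>y repeatedly to \<phi>, whatever Q is.\<close>

lemma slope_expansion:
  assumes "open I" "open U" "fst ` U \<subseteq> I" "smooth_on I \<kappa>" "smooth_on U \<phi>" "smooth_on V Q"
    "\<And>p. p \<in> U \<Longrightarrow> (fst p, \<phi> p) \<in> V"
  shows "\<exists>c. (\<forall>i. smooth_on U (c i)) \<and>
    (\<forall>p\<in>U. c m p = deriv \<kappa> (fst p) ^ m * (pd2 ^^ m) \<phi> p) \<and>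
    (\<forall>e s z. (z, e + s * \<kappa> z) \<in> U \<longrightarrow>
      (first_order (\<lambda>z. Q (z, \<phi> (z, e + s * \<kappa> z))) ^^ m) (\<lambda>z. \<phi> (z, e + s * \<kappa> z)) z =
      (\<Sum>i\<le>m. c i (z, e + s * \<kappa> z) * s ^ i))"
proof (induction m)
  case 0
  show ?case by (rule exI[of _ "\<lambda>_. \<phi>"]) (simp add: assms(5))
next
  case (Suc m)
  then obtain c where c_all: "(\<forall>i. smooth_on U (c i)) \<and>
    (\<forall>p\<in>U. c m p = deriv \<kappa> (fst p) ^ m * (pd2 ^^ m) \<phi> p) \<and>
    (\<forall>e s z. (z, e + s * \<kappa> z) \<in> U \<longrightarrow>
      (first_order (\<lambda>z. Q (z, \<phi> (z, e + s * \<kappa> z))) ^^ m) (\<lambda>z. \<phi> (z, e + s * \<kappa> z)) z =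
      (\<Sum>i\<le>m. c i (z, e + s * \<kappa> z) * s ^ i))" by (rule exE)
  note c = c_all[THEN conjunct1, rule_format]
    and top = c_all[THEN conjunct2, THEN conjunct1, rule_format]
    and ex = c_all[THEN conjunct2, THEN conjunct2, rule_format]
  define q where "q p = Q (fst p, \<phi> p)" for p
  define k where "k p = deriv \<kappa> (fst p)" for p :: "real \<times> real"
  have q: "smooth_on U q"
    unfolding q_def
    by (rule smooth_on_compose[OF assms(2) smooth_on_Pair[OF assms(2) smooth_on_fst[OF assms(2)] assms(5)] assms(6)])
      (use assms(7) in auto)
  have k: "smooth_on U k"
    unfolding k_def
    by (rule smooth_on_compose[OF assms(2) smooth_on_fst[OF assms(2)] smooth_on_deriv[OF assms(1,4)] assms(3)])
  define c' where "c' i p = (if i \<le> m then pd1 (c i) p + q p * c i p else 0) +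
    (if i = 0 then 0 else k p * pd2 (c (i - 1)) p)" for i p
  have 1: "smooth_on U (c' i)" for i
  proof -
    have "smooth_on U (\<lambda>p. if i \<le> m then pd1 (c i) p + q p * c i p else 0)"
      by (cases "i \<le> m"; simp; intro smooth_on_const smooth_on_add smooth_on_mult smooth_on_pd q c assms(2))
    moreover have "smooth_on U (\<lambda>p. if i = 0 then 0 else k p * pd2 (c (i - 1)) p)"
      by (cases "i = 0"; simp; intro smooth_on_const smooth_on_mult smooth_on_pd k c assms(2))
    ultimately show ?thesis unfolding c'_def by (rule smooth_on_add[OF assms(2)])
  qed
  have 2: "c' (Suc m) p = deriv \<kappa> (fst p) ^ Suc m * (pd2 ^^ Suc m) \<phi> p" if p: "p \<in> U" for p
  proof -
    obtain z y where zy: "p = (z, y)" by (cases p)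
    have "open ((\<lambda>t. (z, t)) -` U)"
      by (rule open_vimage[OF assms(2)]) (intro continuous_intros)
    then have "eventually (\<lambda>t. t \<in> (\<lambda>t. (z, t)) -` U) (nhds y)"
      using p zy by (intro eventually_nhds_in_open) auto
    then have "eventually (\<lambda>t. c m (z, t) = deriv \<kappa> z ^ m * (pd2 ^^ m) \<phi> (z, t)) (nhds y)"
      by (rule eventually_mono) (use top in auto)
    then have "pd2 (c m) p = deriv (\<lambda>t. deriv \<kappa> z ^ m * (pd2 ^^ m) \<phi> (z, t)) y"
      unfolding pd2_def zy by (simp add: deriv_cong_ev)
    also have "\<dots> = deriv \<kappa> z ^ m * pd2 ((pd2 ^^ m) \<phi>) (z, y)"
      using has_derivative_slices(2)[OF smooth_on_pd2_iterate[OF assms(2,5)]] p zy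
      by (intro DERIV_imp_deriv DERIV_cmult) auto
    finally show ?thesis by (simp add: c'_def k_def zy)
  qed
  have 3: "(first_order (\<lambda>z. Q (z, \<phi> (z, e + s * \<kappa> z))) ^^ Suc m) (\<lambda>z. \<phi> (z, e + s * \<kappa> z)) z =
      (\<Sum>i\<le>Suc m. c' i (z, e + s * \<kappa> z) * s ^ i)" if z: "(z, e + s * \<kappa> z) \<in> U" for e s z
  proof -
    let ?Y = "\<lambda>z. e + s * \<kappa> z"
    let ?u = "(first_order (\<lambda>z. Q (z, \<phi> (z, ?Y z))) ^^ m) (\<lambda>z. \<phi> (z, ?Y z))"
    have zI: "z \<in> I" using z assms(3) by force
    have Y: "smooth_on I ?Y" by (intro smooth_intros assms)
    have "open (I \<inter> (\<lambda>t. (t, ?Y t)) -` U)"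
      by (rule continuous_open_preimage[OF _ assms(1,2)])
        (intro continuous_on_Pair continuous_on_id smooth_on_continuous[OF Y])
    then have "eventually (\<lambda>t. t \<in> I \<inter> (\<lambda>t. (t, ?Y t)) -` U) (nhds z)"
      using z zI by (intro eventually_nhds_in_open) auto
    then have ev: "eventually (\<lambda>t. ?u t = (\<Sum>i\<le>m. c i (t, ?Y t) * s ^ i)) (nhds z)"
      by (rule eventually_mono) (use ex in auto)
    have dY: "(?Y has_real_derivative s * deriv \<kappa> z) (at z)"
      using DERIV_add[OF DERIV_const DERIV_cmult[OF smooth_on_real_derivative[OF assms(4) zI]]] by simp
    have dc: "((\<lambda>t. c i (t, ?Y t)) has_real_derivative
        pd1 (c i) (z, ?Y z) + pd2 (c i) (z, ?Y z) * (s * deriv \<kappa> z)) (at z)" for i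
      by (rule has_derivative_along_curve[where w = ?Y, OF c z dY])
    have "deriv ?u z = deriv (\<lambda>t. \<Sum>i\<le>m. c i (t, ?Y t) * s ^ i) z"
      by (rule deriv_cong_ev[OF ev refl])
    also have "\<dots> = (\<Sum>i\<le>m. (pd1 (c i) (z, ?Y z) + pd2 (c i) (z, ?Y z) * (s * deriv \<kappa> z)) * s ^ i)"
      by (intro DERIV_imp_deriv DERIV_sum DERIV_cmult_right dc)
    finally have d: "deriv ?u z = (\<Sum>i\<le>m. (pd1 (c i) (z, ?Y z) + pd2 (c i) (z, ?Y z) * (s * deriv \<kappa> z)) * s ^ i)" .
    have "(first_order (\<lambda>z. Q (z, \<phi> (z, ?Y z))) ^^ Suc m) (\<lambda>z. \<phi> (z, ?Y z)) z =
       deriv ?u z + q (z, ?Y z) * ?u z"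
      by (simp add: first_order_def q_def)
    also have "\<dots> = (\<Sum>i\<le>m. (pd1 (c i) (z, ?Y z) + q (z, ?Y z) * c i (z, ?Y z)) * s ^ i) +
        s * (\<Sum>i\<le>m. (k (z, ?Y z) * pd2 (c i) (z, ?Y z)) * s ^ i)"
      unfolding d ex[OF z] k_def sum_distrib_left sum.distrib[symmetric]
      by (intro sum.cong) (simp_all add: algebra_simps)
    also have "\<dots> = (\<Sum>i\<le>Suc m. c' i (z, ?Y z) * s ^ i)"
      unfolding c'_def by (rule sum_shift_add[symmetric])
    finally show ?thesis .
  qed
  show ?case
    by (rule exI[of _ c'], intro conjI allI ballI impI) (rule 1, erule 2, erule 3)
qed

text \<open>For the parameter \<delta>(z) w, homogeneity separates the equation along w = l v: the coefficient of the
first power of l is the n-th derivative of v, and the higher powers come from the nonlinear terms.\<close>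

lemma scale_expansion:
  assumes "open I" "smooth_on I \<delta>" "smooth_on I v"
  shows "\<exists>e. (\<forall>i. smooth_on I (e i)) \<and> (\<forall>z\<in>I. e 0 z = (deriv ^^ m) v z) \<and>
    (\<forall>z\<in>I. \<forall>l. (first_order (\<lambda>z. \<delta> z * (l * v z)) ^^ m) (\<lambda>z. l * v z) z =
      l * (\<Sum>i\<le>m. e i z * l ^ i))"
proof (induction m)
  case 0
  show ?case by (rule exI[of _ "\<lambda>_. v"]) (simp add: assms(3))
next
  case (Suc m)
  then obtain e where e_all: "(\<forall>i. smooth_on I (e i)) \<and> (\<forall>z\<in>I. e 0 z = (deriv ^^ m) v z) \<and>
    (\<forall>z\<in>I. \<forall>l. (first_order (\<lambda>z. \<delta> z * (l * v z)) ^^ m) (\<lambda>z. l * v z) z =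
      l * (\<Sum>i\<le>m. e i z * l ^ i))" by (rule exE)
  note e = e_all[THEN conjunct1, rule_format]
    and e0 = e_all[THEN conjunct2, THEN conjunct1, rule_format]
    and ex = e_all[THEN conjunct2, THEN conjunct2, rule_format]
  define e' where "e' i z = (if i \<le> m then deriv (e i) z else 0) +
    (if i = 0 then 0 else \<delta> z * v z * e (i - 1) z)" for i z
  have 1: "smooth_on I (e' i)" for i
  proof -
    have "smooth_on I (\<lambda>z. if i \<le> m then deriv (e i) z else 0)"
      by (cases "i \<le> m"; simp; intro smooth_on_const smooth_on_deriv e assms)
    moreover have "smooth_on I (\<lambda>z. if i = 0 then 0 else \<delta> z * v z * e (i - 1) z)"
      by (cases "i = 0"; simp; intro smooth_on_const smooth_on_mult e assms)
    ultimately show ?thesis unfolding e'_def by (rule smooth_on_add[OF assms(1)])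
  qed
  have 2: "e' 0 z = (deriv ^^ Suc m) v z" if "z \<in> I" for z
    using deriv_iterate_cong[OF assms(1) e0 that, of _ 1] by (simp add: e'_def)
  have 3: "(first_order (\<lambda>z. \<delta> z * (l * v z)) ^^ Suc m) (\<lambda>z. l * v z) z =
      l * (\<Sum>i\<le>Suc m. e' i z * l ^ i)" if z: "z \<in> I" for z l
  proof -
    let ?u = "(first_order (\<lambda>z. \<delta> z * (l * v z)) ^^ m) (\<lambda>z. l * v z)"
    have "deriv ?u z = deriv (\<lambda>z. l * (\<Sum>i\<le>m. e i z * l ^ i)) z"
      using deriv_iterate_cong[OF assms(1) ex z, of _ 1] by simp
    also have "\<dots> = l * (\<Sum>i\<le>m. deriv (e i) z * l ^ i)"
      by (intro DERIV_imp_deriv DERIV_cmult DERIV_sum DERIV_cmult_right smooth_on_real_derivative[OF e z])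
    finally have d: "deriv ?u z = l * (\<Sum>i\<le>m. deriv (e i) z * l ^ i)" .
    have "(first_order (\<lambda>z. \<delta> z * (l * v z)) ^^ Suc m) (\<lambda>z. l * v z) z =
      deriv ?u z + \<delta> z * (l * v z) * ?u z" by (simp add: first_order_def)
    also have "\<dots> = l * ((\<Sum>i\<le>m. deriv (e i) z * l ^ i) + l * (\<Sum>i\<le>m. (\<delta> z * v z * e i z) * l ^ i))"
      unfolding d ex[OF z] by (simp add: algebra_simps sum_distrib_left)
    also have "\<dots> = l * (\<Sum>i\<le>Suc m. e' i z * l ^ i)"
      unfolding e'_def
      by (simp only: sum_shift_add[where a = "\<lambda>i. deriv (e i) z" and b = "\<lambda>i. \<delta> z * v z * e i z"])
    finally show ?thesis .
  qed
  show ?case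
    by (rule exI[of _ e'], intro conjI allI ballI impI) (rule 1, erule 2, erule 3)
qed

section \<open>Fibrewise inversion and corresponding curves\<close>

text \<open>The inverse function theorem for (z, w) \<mapsto> (z, \<psi>(z, w)). The first derivatives of the inverse are rational
expressions in the inverse itself and the partial derivatives of \<psi>, so smoothness bootstraps from
continuity.\<close>

lemma fibrewise_inverse:
  assumes "open D" "smooth_on D \<psi>" "(z0, w0) \<in> D" "pd2 \<psi> (z0, w0) \<noteq> 0"
  obtains \<phi> U V where "open U" "(z0, w0) \<in> U" "U \<subseteq> D" "open V" "smooth_on V \<phi>"
    "\<And>z w. (z, w) \<in> U \<Longrightarrow> (z, \<psi> (z, w)) \<in> V \<and> \<phi> (z, \<psi> (z, w)) = w"
    "\<And>z y. (z, y) \<in> V \<Longrightarrow> (z, \<phi> (z, y)) \<in> U \<and> \<psi> (z, \<phi> (z, y)) = y"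
    "\<And>z y. (z, y) \<in> V \<Longrightarrow> pd2 \<psi> (z, \<phi> (z, y)) \<noteq> 0 \<and>
      ((\<lambda>t. \<phi> (z, t)) has_real_derivative 1 / pd2 \<psi> (z, \<phi> (z, y))) (at y)"
proof -
  \<comment> \<open>On this set the Jacobian matrix of (z, w) to (z, \<psi>) is invertible.\<close>
  define D' where "D' = D \<inter> pd2 \<psi> -` (- {0})"
  have D'1: "open D'"
    unfolding D'_def
    by (rule continuous_open_preimage[OF smooth_on_continuous[OF smooth_on_pd(2)[OF assms(1,2)]] assms(1)]) auto
  have D': "open D'" "D' \<subseteq> D" "(z0, w0) \<in> D'"
    using D'1 assms(3,4) by (auto simp: D'_def)
  have s: "smooth_on D' \<psi>" by (rule smooth_on_subset[OF assms(2) D'(2)])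
  have nz: "pd2 \<psi> p \<noteq> 0" if "p \<in> D'" for p using that by (auto simp: D'_def)
  define f where "f p = (fst p, \<psi> p)" for p :: "real \<times> real"
  define f0 where "f0 p v = (fst v, pd1 \<psi> p * fst v + pd2 \<psi> p * snd v)" for p v :: "real \<times> real"
  define g0 where "g0 p v = (fst v, (snd v - pd1 \<psi> p * fst v) * (1 / pd2 \<psi> p))" for p v :: "real \<times> real"
  have bl: "bounded_linear (f0 p)" for p
    unfolding f0_def
    by (intro bounded_linear_Pair bounded_linear_add bounded_linear_fst bounded_linear_const_mult bounded_linear_snd)
  have bl2: "bounded_linear (g0 p)" for p
    unfolding g0_def
    by (intro bounded_linear_Pair bounded_linear_sub bounded_linear_mult_const bounded_linear_fst bounded_linear_const_mult bounded_linear_snd)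
  have fg: "g0 p (f0 p v) = v" "f0 p (g0 p v) = v" if "p \<in> D'" for p v
    using nz[OF that] by (auto simp: f0_def g0_def)
  have ap: "blinfun_apply (Blinfun (f0 p)) = f0 p" for p
    by (rule bounded_linear_Blinfun_apply[OF bl])
  have ap2: "blinfun_apply (Blinfun (g0 p)) = g0 p" for p
    by (rule bounded_linear_Blinfun_apply[OF bl2])
  have derf: "(f has_derivative blinfun_apply (Blinfun (f0 p))) (at p)" if "p \<in> D'" for p
    unfolding ap unfolding f_def f0_def
    by (intro has_derivative_Pair has_derivative_fst has_derivative_ident smooth_on_has_derivative_pd[OF s that])
  have cont: "continuous_on D' (\<lambda>p. Blinfun (f0 p))"
    by (rule continuous_on_blinfun_componentwise, unfold ap f0_def)
      (intro continuous_intros smooth_on_continuous[OF smooth_on_pd(1)[OF D'(1) s]]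
        smooth_on_continuous[OF smooth_on_pd(2)[OF D'(1) s]])
  have inv: "Blinfun (g0 (z0,w0)) o\<^sub>L Blinfun (f0 (z0,w0)) = id_blinfun"
    by (rule blinfun_eqI) (simp add: ap ap2 fg[OF D'(3)])
  obtain U V g g' where U: "open U" "U \<subseteq> D'" "(z0, w0) \<in> U" and V: "open V" "f (z0, w0) \<in> V"
    and hom: "homeomorphism U V f g"
    and dg: "\<And>y. y \<in> V \<Longrightarrow> (g has_derivative (g' y)) (at y)"
      "\<And>y. y \<in> V \<Longrightarrow> g' y = inv (blinfun_apply (Blinfun (f0 (g y))))"
    using inverse_function_theorem[OF D'(1) derf cont D'(3) inv] by metis
  have gU: "g y \<in> U" "f (g y) = y" if "y \<in> V" for y
    using hom that by (auto simp: homeomorphism_def)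
  have fU: "f x \<in> V" "g (f x) = x" if "x \<in> U" for x
    using hom that by (auto simp: homeomorphism_def)
  define \<phi> where "\<phi> y = snd (g y)" for y
  have g: "g y = (fst y, \<phi> y)" if "y \<in> V" for y
    using gU(2)[OF that] unfolding f_def \<phi>_def by (metis fst_conv prod.collapse)
  have d\<phi>: "(\<phi> has_derivative (\<lambda>v. (snd v - pd1 \<psi> (fst y, \<phi> y) * fst v) * (1 / pd2 \<psi> (fst y, \<phi> y)))) (at y)"
    if y: "y \<in> V" for y
  proof -
    have gy: "g y \<in> D'" using gU(1)[OF y] U by auto
    have "inv (f0 (g y)) = g0 (g y)"
      by (rule inv_equality) (use fg[OF gy] in auto)
    then have "(g has_derivative g0 (g y)) (at y)"
      using dg[OF y] unfolding ap by simp
    then have "((\<lambda>y. snd (g y)) has_derivative (\<lambda>v. snd (g0 (g y) v))) (at y)"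
      by (rule has_derivative_snd)
    then show ?thesis unfolding g0_def g[OF y] \<phi>_def[symmetric] snd_conv .
  qed
  have "Ck_on k V \<phi>" for k
  proof (induction k)
    case 0
    have "continuous_on V \<phi>"
      by (rule continuous_at_imp_continuous_on) (use d\<phi> has_derivative_continuous in blast)
    then show ?case by simp
  next
    case (Suc k)
    have P: "Ck_on k V (\<lambda>y. (fst y, \<phi> y))"
    proof -
      have "smooth_on V (\<lambda>y. (fst y, 0::real))"
        by (rule smooth_on_linear[OF V(1)])
          (intro bounded_linear_Pair bounded_linear_fst bounded_linear_zero)
      then have "Ck_on k V (\<lambda>y. (fst y, 0::real))" by (simp add: smooth_on_def)
      moreover have "Ck_on k V (\<lambda>y. (0::real, \<phi> y))"
        by (rule Ck_on_bounded_linear[OF V(1) _ Suc])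
          (intro bounded_linear_Pair bounded_linear_ident bounded_linear_zero)
      ultimately have "Ck_on k V (\<lambda>y. (fst y, 0) + (0, \<phi> y))" by (rule Ck_on_add[OF V(1)])
      then show ?thesis by simp
    qed
    have "smooth_on D' (\<lambda>p. 1 / pd2 \<psi> p)"
      by (intro smooth_on_divide smooth_on_const smooth_on_pd D'(1) s nz)
    then have i: "Ck_on k D' (\<lambda>p. 1 / pd2 \<psi> p)" "Ck_on k D' (pd1 \<psi>)"
      using smooth_on_pd[OF D'(1) s] by (auto simp: smooth_on_def)
    have im: "(\<lambda>y. (fst y, \<phi> y)) ` V \<subseteq> D'" using g gU(1) U by force
    note c = Ck_on_compose[OF V(1) im P i(1)] Ck_on_compose[OF V(1) im P i(2)]
    show ?case
    proof (rule Ck_on_SucI[OF V(1) d\<phi>])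
      fix v :: "real \<times> real"
      have "Ck_on k V (\<lambda>y. snd v + - (pd1 \<psi> (fst y, \<phi> y) * fst v))"
        by (intro Ck_on_add V(1) Ck_on_const Ck_on_bounded_linear[OF V(1) _ c(2), of "\<lambda>u. - (u * fst v)"]
            bounded_linear_minus bounded_linear_mult_const bounded_linear_ident)
      then show "Ck_on k V (\<lambda>y. (snd v - pd1 \<psi> (fst y, \<phi> y) * fst v) * (1 / pd2 \<psi> (fst y, \<phi> y)))"
        using Ck_on_bounded_bilinear[OF V(1) bounded_bilinear_mult _ c(1)] by simp
    qed
  qed
  then have "smooth_on V \<phi>" by (simp add: smooth_on_def)
  show ?thesis
  proof (rule that[OF U(1,3) _ V(1) \<open>smooth_on V \<phi>\<close>])
    show "U \<subseteq> D" using U D' by auto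
    show "(z, \<psi> (z, w)) \<in> V \<and> \<phi> (z, \<psi> (z, w)) = w" if "(z, w) \<in> U" for z w
      using fU[OF that] by (auto simp: f_def \<phi>_def)
    show "(z, \<phi> (z, y)) \<in> U \<and> \<psi> (z, \<phi> (z, y)) = y" if "(z, y) \<in> V" for z y
      using gU[OF that] g[OF that] by (auto simp: f_def)
    show "pd2 \<psi> (z, \<phi> (z, y)) \<noteq> 0 \<and>
      ((\<lambda>t. \<phi> (z, t)) has_real_derivative 1 / pd2 \<psi> (z, \<phi> (z, y))) (at y)" if zy: "(z, y) \<in> V" for z y
    proof
      show "pd2 \<psi> (z, \<phi> (z, y)) \<noteq> 0" using gU[OF zy] g[OF zy] nz U by auto
      have "pd2 \<phi> (z, y) = 1 / pd2 \<psi> (z, \<phi> (z, y))"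
        using pd_frechet(2)[OF d\<phi>[OF zy]] by simp
      then show "((\<lambda>t. \<phi> (z, t)) has_real_derivative 1 / pd2 \<psi> (z, \<phi> (z, y))) (at y)"
        using has_derivative_slices(2)[OF \<open>smooth_on V \<phi>\<close> zy] by simp
    qed
  qed
qed

text \<open>A curve w transversal to the fibres of \<rho> has a corresponding curve y, after shrinking the interval: the
change of variable z \<mapsto> \<rho>(z, w(z)) has a smooth local inverse \<zeta>. The function \<zeta> is kept in the conclusion
because comparing two such curves requires the parametrisation by x.\<close>

lemma exists_corresponding_curve:
  assumes "open D" "smooth_on D \<rho>" "smooth_on D \<psi>" "open J" "z0 \<in> J" "smooth_on J w"
    "(z0, w z0) \<in> D" "pd1 \<rho> (z0, w z0) + pd2 \<rho> (z0, w z0) * deriv w z0 \<noteq> 0"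
  obtains I K y \<zeta> where "corresponding_curves D \<rho> \<psi> I w y" "z0 \<in> I" "I \<subseteq> J"
    "open K" "\<rho> (z0, w z0) \<in> K" "smooth_on K y" "smooth_on K \<zeta>"
    "\<And>z. z \<in> I \<Longrightarrow> \<rho> (z, w z) \<in> K \<and> \<zeta> (\<rho> (z, w z)) = z"
    "\<And>x. x \<in> K \<Longrightarrow> \<zeta> x \<in> I \<and> \<rho> (\<zeta> x, w (\<zeta> x)) = x"
proof -
  define J' where "J' = J \<inter> (\<lambda>z. (z, w z)) -` D"
  define g where "g z = \<rho> (z, w z)" for z
  define h where "h p = g (snd p)" for p :: "real \<times> real"
  have J': "open J'"
    unfolding J'_def
    by (rule continuous_open_preimage[OF _ assms(4,1)])
      (intro continuous_on_Pair continuous_on_id smooth_on_continuous[OF assms(6)])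
  have z0: "z0 \<in> J'" using assms(5,7) by (auto simp: J'_def)
  have JJ: "J' \<subseteq> J" by (auto simp: J'_def)
  have sw: "smooth_on J' w" by (rule smooth_on_subset[OF assms(6) JJ])
  have inD: "(z, w z) \<in> D" if "z \<in> J'" for z using that by (auto simp: J'_def)
  have g: "smooth_on J' g"
    unfolding g_def by (rule smooth_on_along_curve[OF J' assms(2) sw inD])
  have g': "deriv g z = pd1 \<rho> (z, w z) + pd2 \<rho> (z, w z) * deriv w z" if "z \<in> J'" for z
    unfolding g_def by (rule deriv_along_curve[OF assms(2) sw that inD[OF that]])
  \<comment> \<open>A function of one variable is inverted as a function of a pair with a dummy first component.\<close>
  define D2 where "D2 = (UNIV :: real set) \<times> J'"
  have D2: "open D2" unfolding D2_def by (intro open_Times open_UNIV J')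
  have h: "smooth_on D2 h"
    unfolding h_def by (rule smooth_on_compose[OF D2 smooth_on_snd[OF D2] g]) (auto simp: D2_def)
  have h2: "pd2 h (0, z) = deriv g z" for z by (simp add: pd2_def h_def)
  obtain \<phi> U V where U: "open U" "(0, z0) \<in> U" "U \<subseteq> D2" and V: "open V" "smooth_on V \<phi>"
    and UV: "\<And>z w. (z, w) \<in> U \<Longrightarrow> (z, h (z, w)) \<in> V \<and> \<phi> (z, h (z, w)) = w"
    and VU: "\<And>z y. (z, y) \<in> V \<Longrightarrow> (z, \<phi> (z, y)) \<in> U \<and> h (z, \<phi> (z, y)) = y"
    by (rule fibrewise_inverse[OF D2 h, of 0 z0])
      (use z0 assms(8) h2 g'[OF z0] in \<open>auto simp: D2_def\<close>)
  define \<zeta> where "\<zeta> x = \<phi> (0, x)" for x :: real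
  define K0 where "K0 = (\<lambda>x. (0::real, x)) -` V"
  have K0: "open K0"
    unfolding K0_def by (rule open_vimage[OF V(1)]) (intro continuous_intros)
  have \<zeta>: "smooth_on K0 \<zeta>"
    unfolding \<zeta>_def
    by (rule smooth_on_compose[OF K0 smooth_on_Pair[OF K0 smooth_on_const smooth_on_id[OF K0]] V(2)])
      (auto simp: K0_def)
  define N where "N = (J' \<inter> (\<lambda>z. (0::real, z)) -` U) \<inter> (J' \<inter> deriv g -` (- {0}))"
  have "open (J' \<inter> deriv g -` (- {0}))"
    by (rule continuous_open_preimage[OF smooth_on_continuous[OF smooth_on_deriv[OF J' g]] J']) auto
  moreover have "open ((\<lambda>z. (0::real, z)) -` U)"
    by (rule open_vimage[OF U(1)]) (intro continuous_intros)
  ultimately have "open N" unfolding N_def using J' by auto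
  moreover have "z0 \<in> N" using z0 U(2) g'[OF z0] assms(8) by (auto simp: N_def)
  ultimately obtain r where r: "r > 0" "ball z0 r \<subseteq> N" using open_contains_ball by blast
  define I where "I = ball z0 r"
  have IN: "I \<subseteq> N" "z0 \<in> I" "open I" "is_interval I" using r by (auto simp: I_def is_interval_ball_real)
  have IJ: "I \<subseteq> J'" using IN by (auto simp: N_def)
  define K where "K = K0 \<inter> \<zeta> -` I"
  have K: "open K"
    unfolding K_def by (rule continuous_open_preimage[OF smooth_on_continuous[OF \<zeta>] K0 IN(3)])
  have sK: "smooth_on K \<zeta>" by (rule smooth_on_subset[OF \<zeta>]) (auto simp: K_def)
  have 1: "\<rho> (z, w z) \<in> K \<and> \<zeta> (\<rho> (z, w z)) = z" if z: "z \<in> I" for z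
  proof -
    have "(0, z) \<in> U" using z IN by (auto simp: N_def)
    then show ?thesis using UV[of 0 z] z by (auto simp: K_def K0_def \<zeta>_def h_def g_def)
  qed
  have 2: "\<zeta> x \<in> I \<and> \<rho> (\<zeta> x, w (\<zeta> x)) = x" if "x \<in> K" for x
    using that VU[of 0 x] by (auto simp: K_def K0_def \<zeta>_def h_def g_def)
  define y where "y x = \<psi> (\<zeta> x, w (\<zeta> x))" for x
  have im: "\<zeta> ` K \<subseteq> J'" using 2 IJ by auto
  have y: "smooth_on K y"
    unfolding y_def
    by (rule smooth_on_compose[OF K smooth_on_Pair[OF K sK smooth_on_compose[OF K sK sw im]] assms(3)])
      (use im inD in auto)
  have cc: "corresponding_curves D \<rho> \<psi> I w y"
    unfolding corresponding_curves_def
  proof (intro conjI ballI)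
    show "smooth_on I w" by (rule smooth_on_subset[OF sw IJ])
    show "smooth_on ((\<lambda>z. \<rho> (z, w z)) ` I) y"
      by (rule smooth_on_subset[OF y]) (use 1 in auto)
    fix z assume z: "z \<in> I"
    show "(z, w z) \<in> D" using z IJ inD by auto
    show "deriv (\<lambda>t. \<rho> (t, w t)) z \<noteq> 0"
      using z IN by (auto simp: N_def g_def[abs_def])
    show "y (\<rho> (z, w z)) = \<psi> (z, w z)" using 1[OF z] by (simp add: y_def)
  qed (use IN in auto)
  show ?thesis
    by (rule that[OF cc IN(2) _ K _ y sK 1 2]) (use IJ JJ 1[OF IN(2)] in auto)
qed

lemma Omega_iterate_perturb_top:
  assumes "n \<ge> 2" "open S" "open T" "x0 \<in> S" "smooth_on T Q" "smooth_on S a" "smooth_on S b"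
    "\<And>x. x \<in> S \<Longrightarrow> (x, a x) \<in> T" "\<And>x. x \<in> S \<Longrightarrow> (x, b x) \<in> T"
    "flat n (\<lambda>x. b x - a x) x0"
  shows "(Omega Q b ^^ n) b x0 = (Omega Q a ^^ n) a x0 + (deriv ^^ n) (\<lambda>x. b x - a x) x0"
proof -
  have fl: "flat n (\<lambda>x. Q (x, b x) - Q (x, a x)) x0"
    by (rule flat_along_curve_diff(1)[OF assms(2-10)])
  have n: "n - 1 < n" "n - 1 \<le> n" using assms(1) by auto
  have z: "(deriv ^^ (n - 1)) (\<lambda>x. b x - a x) x0 = 0"
    "(deriv ^^ (n - 1)) (\<lambda>x. Q (x, b x) - Q (x, a x)) x0 = 0"
    using fl assms(10) n(1) unfolding flat_def by blast+
  show ?thesis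
    using first_order_iterate_perturb[OF assms(1,2,4,6,7)
        smooth_on_along_curve[OF assms(2,5,6,8)] smooth_on_along_curve[OF assms(2,5,7,9)]
        flat_mono[OF assms(10) n(2)] flat_mono[OF fl n(2)]] z
    unfolding Omega_eq_first_order by simp
qed

text \<open>The equation is solved for its top derivative: adding v (z - z0)^n to a curve leaves all lower derivatives at
z0 unchanged. In particular the iterated operator can be made to vanish at z0 with any prescribed jet of
order n - 1.\<close>

lemma Omega_iterate_add_power:
  fixes v :: real
  assumes "n \<ge> 2" "open T" "smooth_on T Q" "smooth_on UNIV l" "(z0, l z0) \<in> T"
  defines "w \<equiv> \<lambda>z. l z + v * (z - z0) ^ n"
  shows "(Omega Q w ^^ n) w z0 = (Omega Q l ^^ n) l z0 + fact n * v"
proof -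
  have sp: "smooth_on UNIV (\<lambda>z. (z - z0) ^ n)" by (intro smooth_intros open_UNIV)
  have sw: "smooth_on UNIV w"
    unfolding w_def by (intro smooth_on_add smooth_on_mult smooth_on_const assms open_UNIV sp)
  define S where "S = (\<lambda>z. (z, l z)) -` T \<inter> (\<lambda>z. (z, w z)) -` T"
  have "continuous_on UNIV l" "continuous_on UNIV w"
    using assms(4) sw smooth_on_continuous by blast+
  then have S: "open S"
    unfolding S_def by (intro open_Int open_vimage assms continuous_on_Pair continuous_on_id)
  have wl: "(\<lambda>z. w z - l z) = (\<lambda>z. v * (z - z0) ^ n)" by (auto simp: w_def)
  have D: "(deriv ^^ k) (\<lambda>z. v * (z - z0) ^ n) z0 = v * (deriv ^^ k) (\<lambda>z. (z - z0) ^ n) z0" for k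
    by (rule deriv_iterate_cmult[OF open_UNIV sp UNIV_I])
  have "w z0 = l z0" using assms(1) by (simp add: w_def)
  then have z0: "z0 \<in> S" using assms(5) by (simp add: S_def)
  have "flat n (\<lambda>z. w z - l z) z0"
    using deriv_iterate_power[of n z0] unfolding wl flat_def D by simp
  from Omega_iterate_perturb_top[OF assms(1) S assms(2) z0 assms(3) smooth_on_subset[OF assms(4)]
      smooth_on_subset[OF sw] _ _ this]
  have "(Omega Q w ^^ n) w z0 = (Omega Q l ^^ n) l z0 + (deriv ^^ n) (\<lambda>z. w z - l z) z0"
    by (auto simp: S_def)
  then show ?thesis using deriv_iterate_power[of n z0] unfolding wl D by (simp add: mult.commute)
qed

text \<open>How the top derivative transforms. For two curves w0 and w1 = w0 + v (z - z0)^n, the function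
\<Theta> = \<psi> - y0 \<circ> \<rho> vanishes along w0, and along w1 it is the difference y1 - y0 seen at the point \<rho>(z, w1).
Hence this difference is of the order of \<Theta>_w v (z - z0)^n, with \<Theta>_w = J/d for d the derivative of
\<rho>(z, w0(z)) and J the Jacobian; changing from z - z0 to x - x0 contributes the remaining factors 1/d.\<close>

lemma corresponding_curves_contact:
  assumes n: "n \<ge> 2" and D: "open D" "smooth_on D \<rho>" "smooth_on D \<psi>"
    and w0: "smooth_on UNIV w0" and w1: "w1 = (\<lambda>z. w0 z + v * (z - z0) ^ n)"
    and p0: "p0 = (z0, w0 z0)" and s: "s = deriv w0 z0"
    and nz: "pd1 \<rho> p0 + pd2 \<rho> p0 * s \<noteq> 0"
    and c0: "corresponding_curves D \<rho> \<psi> I0 w0 y0" "z0 \<in> I0" "open K0" "\<rho> p0 \<in> K0" "smooth_on K0 y0"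
    and c1: "corresponding_curves D \<rho> \<psi> I1 w1 y1" "z0 \<in> I1" "open K1" "\<rho> p0 \<in> K1" "smooth_on K1 y1"
    and \<zeta>: "smooth_on K1 \<zeta>" "\<And>z. z \<in> I1 \<Longrightarrow> \<rho> (z, w1 z) \<in> K1 \<and> \<zeta> (\<rho> (z, w1 z)) = z"
      "\<And>x. x \<in> K1 \<Longrightarrow> \<zeta> x \<in> I1 \<and> \<rho> (\<zeta> x, w1 (\<zeta> x)) = x"
  shows "flat n (\<lambda>x. y1 x - y0 x) (\<rho> p0)"
    "(deriv ^^ n) (\<lambda>x. y1 x - y0 x) (\<rho> p0) =
      fact n * (v * (pd1 \<rho> p0 * pd2 \<psi> p0 - pd2 \<rho> p0 * pd1 \<psi> p0) / (pd1 \<rho> p0 + pd2 \<rho> p0 * s) ^ Suc n)"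
proof -
  define x0 where "x0 = \<rho> p0"
  define d where "d = pd1 \<rho> p0 + pd2 \<rho> p0 * s"
  have sp: "smooth_on UNIV (\<lambda>z. (z - z0) ^ n)" by (intro smooth_intros open_UNIV)
  have svp: "smooth_on UNIV (\<lambda>z. v * (z - z0) ^ n)"
    by (intro smooth_on_mult smooth_on_const open_UNIV sp)
  have sw1: "smooth_on UNIV w1"
    unfolding w1 by (intro smooth_on_add w0 open_UNIV svp)
  have w10: "w1 z0 = w0 z0" using n by (simp add: w1)
  have Dp: "(deriv ^^ k) (\<lambda>z. v * (z - z0) ^ n) z0 = v * (deriv ^^ k) (\<lambda>z. (z - z0) ^ n) z0" for k
    by (rule deriv_iterate_cmult[OF open_UNIV sp UNIV_I])
  have wl: "(\<lambda>z. w1 z - w0 z) = (\<lambda>z. v * (z - z0) ^ n)" by (auto simp: w1)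
  have flw: "flat n (\<lambda>z. w1 z - w0 z) z0" "(deriv ^^ n) (\<lambda>z. w1 z - w0 z) z0 = v * fact n"
    using deriv_iterate_power[of n z0] unfolding wl flat_def Dp by simp_all
  have dw1: "(w1 has_real_derivative s) (at z0)"
  proof -
    have "deriv (\<lambda>z. v * (z - z0) ^ n) z0 = 0"
      using flw(1) n unfolding flat_def wl by (auto dest: spec[of _ 1])
    then have "((\<lambda>z. v * (z - z0) ^ n) has_real_derivative 0) (at z0)"
      using smooth_on_real_derivative[OF svp, of z0] by simp
    from DERIV_add[OF smooth_on_real_derivative[OF w0 UNIV_I] this] show ?thesis by (simp add: w1 s)
  qed
  have dw0: "(w0 has_real_derivative s) (at z0)" using smooth_on_real_derivative[OF w0 UNIV_I] s by simp
  have p0D: "p0 \<in> D" using c0(1,2) p0 by (auto simp: corresponding_curves_def)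
  have cc0: "(z, w0 z) \<in> D" "y0 (\<rho> (z, w0 z)) = \<psi> (z, w0 z)" if "z \<in> I0" for z
    using c0(1) that by (auto simp: corresponding_curves_def)
  have cc1: "(z, w1 z) \<in> D" "y1 (\<rho> (z, w1 z)) = \<psi> (z, w1 z)" if "z \<in> I1" for z
    using c1(1) that by (auto simp: corresponding_curves_def)
  have oI: "open I0" "open I1" using c0(1) c1(1) by (auto simp: corresponding_curves_def)
  have dr0: "((\<lambda>t. \<rho> (t, w0 t)) has_real_derivative d) (at z0)"
    using has_derivative_along_curve[where w = w0, OF D(2) _ dw0] p0D p0 by (simp add: d_def)
  have dr1: "((\<lambda>t. \<rho> (t, w1 t)) has_real_derivative d) (at z0)"
    using has_derivative_along_curve[where w = w1, OF D(2) _ dw1] p0D p0 by (simp add: d_def w10)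
  have dp0: "((\<lambda>t. \<psi> (t, w0 t)) has_real_derivative pd1 \<psi> p0 + pd2 \<psi> p0 * s) (at z0)"
    using has_derivative_along_curve[where w = w0, OF D(3) _ dw0] p0D p0 by simp
  have dy0: "(y0 has_real_derivative deriv y0 x0) (at x0)"
    using smooth_on_real_derivative[OF c0(5,4)] by (simp add: x0_def)
  have y0': "deriv y0 x0 * d = pd1 \<psi> p0 + pd2 \<psi> p0 * s"
  proof (rule DERIV_unique[OF _ dp0])
    have "((\<lambda>t. y0 (\<rho> (t, w0 t))) has_real_derivative deriv y0 x0 * d) (at z0)"
      by (rule DERIV_chain2[OF _ dr0]) (use dy0 p0 x0_def in simp)
    then show "((\<lambda>t. \<psi> (t, w0 t)) has_real_derivative deriv y0 x0 * d) (at z0)"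
      by (rule has_field_derivative_transform_within_open[OF _ oI(1) c0(2)]) (rule cc0)
  qed
  define D0 where "D0 = D \<inter> \<rho> -` K0"
  have D0: "open D0"
    unfolding D0_def by (rule continuous_open_preimage[OF smooth_on_continuous[OF D(2)] D(1) c0(3)])
  \<comment> \<open>Vanishes along the curve w0 and measures y1 - y0 along w1.\<close>
  define \<Theta> where "\<Theta> p = \<psi> p - y0 (\<rho> p)" for p
  have \<rho>0: "smooth_on D0 \<rho>" "smooth_on D0 \<psi>"
    using smooth_on_subset D unfolding D0_def by blast+
  have \<Theta>: "smooth_on D0 \<Theta>"
    unfolding \<Theta>_def
    by (intro smooth_on_diff D0 \<rho>0 smooth_on_compose[OF D0 _ c0(5)]) (auto simp: D0_def)
  have p0D0: "p0 \<in> D0" using p0D c0(4) by (simp add: D0_def)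
  have \<Theta>2: "pd2 \<Theta> p0 = pd2 \<psi> p0 - deriv y0 x0 * pd2 \<rho> p0"
  proof -
    have 1: "((\<lambda>t. \<psi> (z0, t)) has_real_derivative pd2 \<psi> p0) (at (w0 z0))"
      "((\<lambda>t. \<rho> (z0, t)) has_real_derivative pd2 \<rho> p0) (at (w0 z0))"
      using has_derivative_slices(2)[OF D(2)] has_derivative_slices(2)[OF D(3)] p0D p0 by auto
    have "((\<lambda>t. y0 (\<rho> (z0, t))) has_real_derivative deriv y0 x0 * pd2 \<rho> p0) (at (w0 z0))"
      by (rule DERIV_chain2[OF _ 1(2)]) (use dy0 p0 x0_def in simp)
    from DERIV_imp_deriv[OF DERIV_diff[OF 1(1) this]]
    show ?thesis by (simp add: pd2_def \<Theta>_def p0)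
  qed
  define N where "N = (I0 \<inter> I1) \<inter> ((\<lambda>z. (z, w0 z)) -` D0 \<inter> (\<lambda>z. (z, w1 z)) -` D0)"
  have "continuous_on UNIV w0" "continuous_on UNIV w1"
    using w0 sw1 smooth_on_continuous by blast+
  then have N: "open N"
    unfolding N_def by (intro open_Int open_vimage D0 oI continuous_on_Pair continuous_on_id)
  have z0N: "z0 \<in> N" using c0(2) c1(2) p0D0 p0 w10 by (simp add: N_def)
  define T where "T z = \<Theta> (z, w1 z) - \<Theta> (z, w0 z)" for z
  have sN: "smooth_on N w0" "smooth_on N w1" using w0 sw1 smooth_on_subset by blast+
  have inN: "(z, w0 z) \<in> D0" "(z, w1 z) \<in> D0" if "z \<in> N" for z using that by (auto simp: N_def)
  have sT: "smooth_on N T"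
    unfolding T_def
    by (intro smooth_on_diff N smooth_on_along_curve[OF N \<Theta> sN(1) inN(1)]
        smooth_on_along_curve[OF N \<Theta> sN(2) inN(2)])
  have flT: "flat n T z0" "(deriv ^^ n) T z0 = pd2 \<Theta> p0 * (v * fact n)"
    using flat_along_curve_diff[OF N D0 z0N \<Theta> sN inN flw(1)] flw(2) n p0
    unfolding T_def[abs_def] by auto
  have limT: "((\<lambda>z. T z / (z - z0) ^ n) \<longlongrightarrow> pd2 \<Theta> p0 * v) (at z0)"
    using flat_limit[OF N z0N sT flT(1)] unfolding flT(2) by simp
  have x0K: "x0 \<in> K1" "x0 \<in> K0" using c1(4) c0(4) by (auto simp: x0_def)
  have \<zeta>0: "\<zeta> x0 = z0" using \<zeta>(2)[OF c1(2)] by (simp add: w10 p0 x0_def)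
  have d\<zeta>: "(\<zeta> has_real_derivative deriv \<zeta> x0) (at x0)"
    by (rule smooth_on_real_derivative[OF \<zeta>(1) x0K(1)])
  have \<zeta>': "deriv \<zeta> x0 * d = 1"
  proof (rule DERIV_unique[OF _ DERIV_ident])
    have "((\<lambda>t. \<zeta> (\<rho> (t, w1 t))) has_real_derivative deriv \<zeta> x0 * d) (at z0)"
      by (rule DERIV_chain2[OF _ dr1]) (use d\<zeta> p0 x0_def w10 in simp)
    then show "((\<lambda>t. t) has_real_derivative deriv \<zeta> x0 * d) (at z0)"
      by (rule has_field_derivative_transform_within_open[OF _ oI(2) c1(2)]) (use \<zeta>(2) in auto)
  qed
  have cont: "(\<zeta> \<longlongrightarrow> z0) (at x0)" using DERIV_isCont[OF d\<zeta>] \<zeta>0 by (simp add: isCont_def)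
  have evK: "\<forall>\<^sub>F x in at x0. x \<in> K0 \<inter> K1 - {x0}"
    by (rule eventually_at_in_open[OF open_Int[OF c0(3) c1(3)]]) (use x0K in simp)
  have "\<forall>\<^sub>F x in at x0. \<zeta> x \<noteq> z0"
    using evK by (rule eventually_mono) (use \<zeta>(3) w10 p0 x0_def in force)
  then have flim: "filterlim \<zeta> (at z0) (at x0)" using cont by (simp add: filterlim_at)
  have "((\<lambda>x. T (\<zeta> x) / (\<zeta> x - z0) ^ n) \<longlongrightarrow> pd2 \<Theta> p0 * v) (at x0)"
    by (rule filterlim_compose[OF limT flim])
  moreover have "((\<lambda>x. (\<zeta> x - z0) / (x - x0)) \<longlongrightarrow> deriv \<zeta> x0) (at x0)"
    using d\<zeta> unfolding has_field_derivative_iff \<zeta>0 .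
  ultimately have lim: "((\<lambda>x. T (\<zeta> x) / (\<zeta> x - z0) ^ n * ((\<zeta> x - z0) / (x - x0)) ^ n) \<longlongrightarrow>
      pd2 \<Theta> p0 * v * deriv \<zeta> x0 ^ n) (at x0)"
    by (intro tendsto_mult tendsto_power)
  have evN: "\<forall>\<^sub>F x in at x0. \<zeta> x \<in> N" using cont N z0N by (rule topological_tendstoD)
  have ev: "\<forall>\<^sub>F x in at x0. T (\<zeta> x) / (\<zeta> x - z0) ^ n * ((\<zeta> x - z0) / (x - x0)) ^ n =
      (y1 x - y0 x) / (x - x0) ^ n"
    using eventually_conj[OF evK evN]
  proof (rule eventually_mono)
    fix x assume x: "x \<in> K0 \<inter> K1 - {x0} \<and> \<zeta> x \<in> N"
    then have I: "\<zeta> x \<in> I0" "\<zeta> x \<in> I1" by (auto simp: N_def)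
    have "\<rho> (\<zeta> x, w1 (\<zeta> x)) = x" using \<zeta>(3) x by auto
    then have "T (\<zeta> x) = y1 x - y0 x"
      using cc0[OF I(1)] cc1[OF I(2)] by (simp add: T_def \<Theta>_def)
    moreover have "\<zeta> x \<noteq> z0" using \<zeta>(3)[of x] x w10 p0 x0_def by force
    ultimately show "T (\<zeta> x) / (\<zeta> x - z0) ^ n * ((\<zeta> x - z0) / (x - x0)) ^ n =
      (y1 x - y0 x) / (x - x0) ^ n" by (simp add: power_divide)
  qed
  have sy: "smooth_on (K0 \<inter> K1) (\<lambda>x. y1 x - y0 x)"
    using smooth_on_subset[OF c0(5), of "K0 \<inter> K1"] smooth_on_subset[OF c1(5), of "K0 \<inter> K1"]
    by (intro smooth_on_diff open_Int c0 c1) auto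
  have x0K': "x0 \<in> K0 \<inter> K1" using x0K by simp
  note res = flat_of_limit[OF open_Int[OF c0(3) c1(3)] x0K' sy Lim_transform_eventually[OF lim ev]]
  show "flat n (\<lambda>x. y1 x - y0 x) (\<rho> p0)" using res(1) by (simp add: x0_def)
  have d0: "d \<noteq> 0" using nz by (simp add: d_def)
  have e1: "deriv \<zeta> x0 = 1 / d" using \<zeta>' d0 by (simp add: field_simps)
  have e2: "deriv y0 x0 = (pd1 \<psi> p0 + pd2 \<psi> p0 * s) / d" using y0' d0 by (simp add: field_simps)
  have "pd2 \<Theta> p0 = (pd1 \<rho> p0 * pd2 \<psi> p0 - pd2 \<rho> p0 * pd1 \<psi> p0) / d"
    unfolding \<Theta>2 e2 using d0 by (simp add: divide_simps) (simp add: d_def algebra_simps)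
  then have "pd2 \<Theta> p0 * v * deriv \<zeta> x0 ^ n =
      v * (pd1 \<rho> p0 * pd2 \<psi> p0 - pd2 \<rho> p0 * pd1 \<psi> p0) / d ^ Suc n"
    unfolding e1 by (simp add: power_divide)
  then show "(deriv ^^ n) (\<lambda>x. y1 x - y0 x) (\<rho> p0) =
      fact n * (v * (pd1 \<rho> p0 * pd2 \<psi> p0 - pd2 \<rho> p0 * pd1 \<psi> p0) / (pd1 \<rho> p0 + pd2 \<rho> p0 * s) ^ Suc n)"
    using res(2) by (simp add: x0_def d_def)
qed

lemma transformed_parameter_zero_iff:
  assumes "transformed_parameter n D \<rho> \<psi> F Q" "corresponding_curves D \<rho> \<psi> I w y" "z \<in> I"
  shows "(Omega F y ^^ n) y (\<rho> (z, w z)) = 0 \<longleftrightarrow> (Omega Q w ^^ n) w z = 0"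
proof -
  obtain \<mu> where \<mu>: "\<forall>z j. \<mu> z j \<noteq> (0::real)"
    "\<forall>I w y. corresponding_curves D \<rho> \<psi> I w y \<longrightarrow>
      (\<forall>z\<in>I. (Omega F y ^^ n) y (\<rho> (z, w z)) = \<mu> z (jet n w z) * (Omega Q w ^^ n) w z)"
    using assms(1) unfolding transformed_parameter_def by (elim conjE exE)
  have "(Omega F y ^^ n) y (\<rho> (z, w z)) = \<mu> z (jet n w z) * (Omega Q w ^^ n) w z"
    using \<mu>(2)[rule_format, OF assms(2,3)] .
  then show ?thesis using \<mu>(1) by simp
qed

lemma transformed_parameter_smooth:
  "transformed_parameter n D \<rho> \<psi> F Q \<Longrightarrow> smooth_on D Q"
  by (simp add: transformed_parameter_def)

text \<open>The central identity. On curves of prescribed (n-1)-jet, choose the top derivative such that the equations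
with \<alpha> = 0 and with \<alpha> = (x - x0)^(n-1) hold at the point. In the variables (z, w) the two choices differ
by the difference of the iterated operators on the common line l; in the variables (x, y) they differ by
the contribution (n-1)! y^2 of the pulse. The contact formula relates the two differences.\<close>

lemma parameter_pulse:
  fixes s :: real
  assumes n: "n \<ge> 2" and D: "open D" "smooth_on D \<rho>" "smooth_on D \<psi>"
    and p0: "p0 \<in> D" "p0 = (z0, w0)"
    and nz: "pd1 \<rho> p0 + pd2 \<rho> p0 * s \<noteq> 0"
    and Q0: "transformed_parameter n D \<rho> \<psi> (\<lambda>(x, y). 0 * y) Q0"
    and Q1: "transformed_parameter n D \<rho> \<psi> (\<lambda>(x, y). (x - \<rho> p0) ^ (n - 1) * y) Q1"
  defines "l \<equiv> \<lambda>z. w0 + s * (z - z0)"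
  shows "fact (n - 1) * \<psi> p0 ^ 2 * (pd1 \<rho> p0 + pd2 \<rho> p0 * s) ^ Suc n =
    (pd1 \<rho> p0 * pd2 \<psi> p0 - pd2 \<rho> p0 * pd1 \<psi> p0) * ((Omega Q1 l ^^ n) l z0 - (Omega Q0 l ^^ n) l z0)"
proof -
  define d where "d = pd1 \<rho> p0 + pd2 \<rho> p0 * s"
  define R0 where "R0 = (Omega Q0 l ^^ n) l z0"
  define R1 where "R1 = (Omega Q1 l ^^ n) l z0"
  define wv where "wv v = (\<lambda>z. l z + v * (z - z0) ^ n)" for v
  \<comment> \<open>The top derivatives for which the transformed equations hold at z0.\<close>
  define v0 where "v0 = - R0 / fact n"
  define v1 where "v1 = - R1 / fact n"
  have l: "smooth_on UNIV l" unfolding l_def by (intro smooth_intros open_UNIV)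
  have l0: "l z0 = w0" by (simp add: l_def)
  have lD: "(z0, l z0) \<in> D" using p0 l0 by simp
  have dl: "(l has_real_derivative s) (at z0)"
    unfolding l_def by (auto intro!: derivative_eq_intros)
  have swv: "smooth_on UNIV (wv v)" for v
    unfolding wv_def by (intro smooth_on_add l smooth_on_mult smooth_on_const smooth_on_power smooth_on_diff smooth_on_id open_UNIV)
  have wv0: "wv v z0 = w0" for v using n by (simp add: wv_def l0)
  have dwv: "deriv (wv v) z0 = s" for v
  proof -
    obtain m where m: "n = Suc m" "m \<noteq> 0" using n by (cases n) auto
    have "((\<lambda>z. v * (z - z0) ^ n) has_real_derivative v * (real (Suc m) * (z0 - z0) ^ m)) (at z0)"
      unfolding m(1) by (rule DERIV_cmult[OF DERIV_shifted_power])
    moreover have "v * (real (Suc m) * (z0 - z0) ^ m) = 0" using m(2) by simp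
    ultimately have "((\<lambda>z. v * (z - z0) ^ n) has_real_derivative 0) (at z0)" by (simp only:)
    from DERIV_imp_deriv[OF DERIV_add[OF dl this]] show ?thesis by (simp add: wv_def)
  qed
  have z: "(Omega Q0 (wv v0) ^^ n) (wv v0) z0 = 0" "(Omega Q1 (wv v1) ^^ n) (wv v1) z0 = 0"
    using Omega_iterate_add_power[OF n D(1) transformed_parameter_smooth[OF Q0] l lD, of v0]
      Omega_iterate_add_power[OF n D(1) transformed_parameter_smooth[OF Q1] l lD, of v1]
    by (simp_all add: wv_def v0_def v1_def R0_def R1_def)
  have wD: "(z0, wv v z0) \<in> D" for v using p0 wv0 by simp
  have nzv: "pd1 \<rho> (z0, wv v z0) + pd2 \<rho> (z0, wv v z0) * deriv (wv v) z0 \<noteq> 0" for v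
    using nz p0(2) wv0 dwv by simp
  obtain I0 K0 y0 \<zeta>0 where c0: "corresponding_curves D \<rho> \<psi> I0 (wv v0) y0" "z0 \<in> I0"
    "open K0" "\<rho> (z0, wv v0 z0) \<in> K0" "smooth_on K0 y0"
    by (rule exists_corresponding_curve[OF D open_UNIV UNIV_I swv wD nzv, of v0]) (rule that)
  obtain I1 K1 y1 \<zeta>1 where c1: "corresponding_curves D \<rho> \<psi> I1 (wv v1) y1" "z0 \<in> I1"
    "open K1" "\<rho> (z0, wv v1 z0) \<in> K1" "smooth_on K1 y1" and
    \<zeta>1: "smooth_on K1 \<zeta>1" "\<And>z. z \<in> I1 \<Longrightarrow> \<rho> (z, wv v1 z) \<in> K1 \<and> \<zeta>1 (\<rho> (z, wv v1 z)) = z"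
      "\<And>x. x \<in> K1 \<Longrightarrow> \<zeta>1 x \<in> I1 \<and> \<rho> (\<zeta>1 x, wv v1 (\<zeta>1 x)) = x"
    by (rule exists_corresponding_curve[OF D open_UNIV UNIV_I swv wD nzv, of v1]) (rule that)
  have \<rho>0: "\<rho> (z0, wv v z0) = \<rho> p0" "\<psi> (z0, wv v z0) = \<psi> p0" for v using p0 wv0 by auto
  have y: "y0 (\<rho> p0) = \<psi> p0" "y1 (\<rho> p0) = \<psi> p0"
    using c0(1,2) c1(1,2) \<rho>0 unfolding corresponding_curves_def by metis+
  have zy: "(Omega (\<lambda>(x, y). 0 * y) y0 ^^ n) y0 (\<rho> p0) = 0"
    "(Omega (\<lambda>(x, y). (x - \<rho> p0) ^ (n - 1) * y) y1 ^^ n) y1 (\<rho> p0) = 0"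
    using transformed_parameter_zero_iff[OF Q0 c0(1,2)] transformed_parameter_zero_iff[OF Q1 c1(1,2)] z \<rho>0
    by simp_all
  have w1: "wv v1 = (\<lambda>z. wv v0 z + (v1 - v0) * (z - z0) ^ n)"
    by (auto simp: wv_def algebra_simps)
  have pp: "p0 = (z0, wv v0 z0)" using p0 wv0 by simp
  have contact: "flat n (\<lambda>x. y1 x - y0 x) (\<rho> p0)"
    "(deriv ^^ n) (\<lambda>x. y1 x - y0 x) (\<rho> p0) =
      fact n * ((v1 - v0) * (pd1 \<rho> p0 * pd2 \<psi> p0 - pd2 \<rho> p0 * pd1 \<psi> p0) / (pd1 \<rho> p0 + pd2 \<rho> p0 * s) ^ Suc n)"
    using corresponding_curves_contact[OF n D swv[of v0] w1 pp dwv[symmetric] nz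
        c0(1,2,3) _ c0(5) c1(1,2,3) _ c1(5) \<zeta>1] c0(4) c1(4) \<rho>0 by auto
  define K where "K = K0 \<inter> K1"
  have K: "open K" "\<rho> p0 \<in> K" "smooth_on K y0" "smooth_on K y1"
    using c0 c1 \<rho>0 smooth_on_subset[of K0 y0 K] smooth_on_subset[of K1 y1 K] unfolding K_def by auto
  have sg: "smooth_on K (\<lambda>x. (x - \<rho> p0) ^ (n - 1) * y1 x)"
    by (intro smooth_on_mult smooth_on_power smooth_on_diff smooth_on_id smooth_on_const K)
  have fg: "flat (n - 1) (\<lambda>x. (x - \<rho> p0) ^ (n - 1) * y1 x - 0) (\<rho> p0)"
    "(deriv ^^ (n - 1)) (\<lambda>x. (x - \<rho> p0) ^ (n - 1) * y1 x - 0) (\<rho> p0) = fact (n - 1) * \<psi> p0"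
    using deriv_iterate_power_mult[OF K(1,2,4), of "n - 1"] y by simp_all
  have "(first_order (\<lambda>x. (x - \<rho> p0) ^ (n - 1) * y1 x) ^^ n) y1 (\<rho> p0) -
      (first_order (\<lambda>x. 0) ^^ n) y0 (\<rho> p0) =
    (deriv ^^ n) (\<lambda>x. y1 x - y0 x) (\<rho> p0) +
    real n * 0 * (deriv ^^ (n - 1)) (\<lambda>x. y1 x - y0 x) (\<rho> p0) + y0 (\<rho> p0) * (fact (n - 1) * \<psi> p0)"
    using first_order_iterate_perturb[OF n K(1,2,3,4) smooth_on_const[of _ 0] sg
        flat_mono[OF contact(1)] fg(1)] fg(2) by simp
  then have "0 = (deriv ^^ n) (\<lambda>x. y1 x - y0 x) (\<rho> p0) + fact (n - 1) * \<psi> p0 ^ 2"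
    using zy y unfolding Omega_eq_first_order by (simp add: power2_eq_square mult.left_commute)
  then have "fact (n - 1) * \<psi> p0 ^ 2 = (fact n * (v0 - v1)) *
     (pd1 \<rho> p0 * pd2 \<psi> p0 - pd2 \<rho> p0 * pd1 \<psi> p0) / d ^ Suc n"
    unfolding contact(2) d_def by (simp add: algebra_simps diff_divide_distrib)
  also have "fact n * (v0 - v1) = R1 - R0"
    by (simp add: v0_def v1_def field_simps)
  finally have "fact (n - 1) * \<psi> p0 ^ 2 * d ^ Suc n =
     (R1 - R0) * (pd1 \<rho> p0 * pd2 \<psi> p0 - pd2 \<rho> p0 * pd1 \<psi> p0)"
    using nz unfolding d_def[symmetric] by simp
  then show ?thesis by (simp add: R0_def R1_def d_def mult.commute)
qed

section \<open>Projective transformations are equivalence transformations\<close>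

lemma first_order_Suc:
  "(first_order f ^^ Suc k) u x = deriv ((first_order f ^^ k) u) x + f x * (first_order f ^^ k) u x"
  by (subst funpow.simps(2)) (simp only: comp_def first_order_def[of f "(first_order f ^^ k) u"])

lemma first_order_iterate_cmult:
  assumes "open S" "smooth_on S f" "smooth_on S u" "x \<in> S"
  shows "(first_order f ^^ k) (\<lambda>x. C * u x) x = C * (first_order f ^^ k) u x"
  using assms(4)
proof (induction k arbitrary: x)
  case (Suc k)
  have "deriv ((first_order f ^^ k) (\<lambda>x. C * u x)) x = deriv (\<lambda>x. C * (first_order f ^^ k) u x) x"
    using deriv_iterate_cong[OF assms(1) Suc.IH Suc.prems, of _ 1] by simp
  also have "\<dots> = C * deriv ((first_order f ^^ k) u) x"
    by (intro DERIV_imp_deriv DERIV_cmult smooth_on_real_derivative[OF _ Suc.prems]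
        smooth_on_first_order_iterate assms)
  finally show ?case
    unfolding first_order_Suc Suc.IH[OF Suc.prems] by (simp add: algebra_simps)
qed simp

text \<open>The Leibniz rule stops after the second term because the second derivative of an affine factor is zero.\<close>

lemma first_order_iterate_affine_mult:
  assumes "open S" "smooth_on S f" "smooth_on S v" "x \<in> S"
  shows "(first_order f ^^ Suc m) (\<lambda>x. (a * x + b) * v x) x =
    (a * x + b) * (first_order f ^^ Suc m) v x + real (Suc m) * a * (first_order f ^^ m) v x"
  using assms(4)
proof (induction m arbitrary: x)
  case 0
  have "((\<lambda>x. a * x + b) has_real_derivative a) (at x)" by (auto intro!: derivative_eq_intros)
  from DERIV_imp_deriv[OF DERIV_mult[OF this smooth_on_real_derivative[OF assms(3) 0]]]
  show ?case by (simp add: first_order_def algebra_simps)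
next
  case (Suc m)
  let ?L = "\<lambda>k. first_order f ^^ k"
  note d = smooth_on_real_derivative[OF smooth_on_first_order_iterate[OF assms(1-3)] Suc.prems]
  have af: "((\<lambda>x. a * x + b) has_real_derivative a) (at x)" by (auto intro!: derivative_eq_intros)
  have "deriv (?L (Suc m) (\<lambda>x. (a * x + b) * v x)) x =
    deriv (\<lambda>x. (a * x + b) * ?L (Suc m) v x + real (Suc m) * a * ?L m v x) x"
    using deriv_iterate_cong[OF assms(1) Suc.IH Suc.prems, of _ 1] by simp
  also have "\<dots> = a * ?L (Suc m) v x + deriv (?L (Suc m) v) x * (a * x + b) +
      real (Suc m) * a * deriv (?L m v) x"
    by (intro DERIV_imp_deriv DERIV_add DERIV_mult DERIV_cmult af d)
  finally have *: "deriv (?L (Suc m) (\<lambda>x. (a * x + b) * v x)) x =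
      a * ?L (Suc m) v x + deriv (?L (Suc m) v) x * (a * x + b) + real (Suc m) * a * deriv (?L m v) x" .
  have "?L (Suc (Suc m)) (\<lambda>x. (a * x + b) * v x) x =
     deriv (?L (Suc m) (\<lambda>x. (a * x + b) * v x)) x + f x * ?L (Suc m) (\<lambda>x. (a * x + b) * v x) x"
    by (simp add: first_order_def)
  also have "\<dots> = (a * x + b) * (deriv (?L (Suc m) v) x + f x * ?L (Suc m) v x) +
      a * ?L (Suc m) v x + real (Suc m) * a * (deriv (?L m v) x + f x * ?L m v x)"
    unfolding * Suc.IH[OF Suc.prems] by (simp only: algebra_simps)
  also have "deriv (?L (Suc m) v) x + f x * ?L (Suc m) v x = ?L (Suc (Suc m)) v x"
    by (simp add: first_order_def)
  also have "deriv (?L m v) x + f x * ?L m v x = ?L (Suc m) v x"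
    by (simp add: first_order_def)
  finally show ?case by (simp only: of_nat_Suc algebra_simps)
qed

text \<open>The operator d/dx + F written in the variable z has this form, with the weight c = 1/\<rho>_z.\<close>

definition weighted_first_order :: "(real \<Rightarrow> real) \<Rightarrow> (real \<Rightarrow> real) \<Rightarrow> (real \<Rightarrow> real) \<Rightarrow> real \<Rightarrow> real" where
  "weighted_first_order c f u = (\<lambda>x. c x * first_order f u x)"

lemma weighted_first_order_iterate_cong:
  assumes "open S" "\<And>x. x \<in> S \<Longrightarrow> f x = g x" "\<And>x. x \<in> S \<Longrightarrow> u x = v x" "x \<in> S"
  shows "(weighted_first_order c f ^^ k) u x = (weighted_first_order c g ^^ k) v x"
  using assms(4)
proof (induction k arbitrary: x)
  case 0
  then show ?case using assms(3) by simp
next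
  case (Suc k)
  then show ?case
    using deriv_iterate_cong[OF assms(1) Suc.IH Suc.prems, of _ 1] assms(2)
    by (simp add: weighted_first_order_def first_order_def)
qed

text \<open>Bol's lemma with L_f in place of d/dz. Write s = a x + b. Passing from m to m + 1, the power of s is
differentiated once, and the resulting first-order term is exactly the one produced by moving a factor s
through the iterated operator in first_order_iterate_affine_mult.\<close>

lemma weighted_first_order_iterate_affine:
  assumes "open S" "smooth_on S f" "smooth_on S u" "\<And>x. x \<in> S \<Longrightarrow> a * x + b \<noteq> 0" "x \<in> S"
  shows "(weighted_first_order (\<lambda>x. (a * x + b) ^ 2 / d) f ^^ Suc m) (\<lambda>x. u x / (a * x + b) ^ m) x =
    (a * x + b) ^ (m + 2) / d ^ Suc m * (first_order f ^^ Suc m) u x"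
  using assms(3,5)
proof (induction m arbitrary: u x)
  case 0
  then show ?case by (simp add: weighted_first_order_def power2_eq_square)
next
  case (Suc m)
  let ?L = "\<lambda>k. first_order f ^^ k"
  let ?N = "weighted_first_order (\<lambda>x. (a * x + b) ^ 2 / d) f"
  let ?s = "\<lambda>x. a * x + b"
  define v where "v x = u x / ?s x" for x
  have v: "smooth_on S v"
    unfolding v_def by (intro smooth_on_divide smooth_intros assms Suc.prems(1); assumption)
  have uv: "u x = ?s x * v x" if "x \<in> S" for x using assms(4)[OF that] by (simp add: v_def)
  have ih: "(?N ^^ Suc m) (\<lambda>x. u x / ?s x ^ Suc m) x =
      (1 / d ^ Suc m) * (?s x ^ Suc (Suc m) * ?L (Suc m) v x)" if x: "x \<in> S" for x
  proof -
    have "(?N ^^ Suc m) (\<lambda>x. u x / ?s x ^ Suc m) x = (?N ^^ Suc m) (\<lambda>x. v x / ?s x ^ m) x"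
      by (rule weighted_first_order_iterate_cong[OF assms(1) refl _ x]) (simp add: v_def)
    then show ?thesis using Suc.IH[OF v x] by simp
  qed
  note x = Suc.prems(2)
  have af: "(?s has_real_derivative a) (at x)" by (auto intro!: derivative_eq_intros)
  have ds: "((\<lambda>x. ?s x ^ Suc (Suc m)) has_real_derivative (1 + real (Suc m)) * (a * ?s x ^ Suc m)) (at x)"
    by (rule DERIV_power_Suc[OF af])
  note dL = smooth_on_real_derivative[OF smooth_on_first_order_iterate[OF assms(1,2) v] x]
  have "deriv ((?N ^^ Suc m) (\<lambda>x. u x / ?s x ^ Suc m)) x =
     deriv (\<lambda>x. (1 / d ^ Suc m) * (?s x ^ Suc (Suc m) * ?L (Suc m) v x)) x"
    using deriv_iterate_cong[OF assms(1) ih x, of _ 1] by simp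
  also have "\<dots> = (1 / d ^ Suc m) * ((1 + real (Suc m)) * (a * ?s x ^ Suc m) * ?L (Suc m) v x +
      deriv (?L (Suc m) v) x * ?s x ^ Suc (Suc m))"
    by (intro DERIV_imp_deriv DERIV_cmult DERIV_mult ds dL)
  finally have D: "deriv ((?N ^^ Suc m) (\<lambda>x. u x / ?s x ^ Suc m)) x =
    (1 / d ^ Suc m) * ((1 + real (Suc m)) * (a * ?s x ^ Suc m) * ?L (Suc m) v x +
      deriv (?L (Suc m) v) x * ?s x ^ Suc (Suc m))" .
  have "(?N ^^ Suc (Suc m)) (\<lambda>x. u x / ?s x ^ Suc m) x =
      (?s x ^ 2 / d) * (deriv ((?N ^^ Suc m) (\<lambda>x. u x / ?s x ^ Suc m)) x +
        f x * (?N ^^ Suc m) (\<lambda>x. u x / ?s x ^ Suc m) x)"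
    by (simp add: weighted_first_order_def first_order_def)
  also have "\<dots> = (?s x ^ 2 / d) * ((1 / d ^ Suc m) * ((1 + real (Suc m)) * (a * ?s x ^ Suc m) * ?L (Suc m) v x +
      ?s x ^ Suc (Suc m) * (deriv (?L (Suc m) v) x + f x * ?L (Suc m) v x)))"
    unfolding D ih[OF x] by (simp only: algebra_simps)
  also have "deriv (?L (Suc m) v) x + f x * ?L (Suc m) v x = ?L (Suc (Suc m)) v x"
    by (simp add: first_order_def)
  also have "(?s x ^ 2 / d) * ((1 / d ^ Suc m) * ((1 + real (Suc m)) * (a * ?s x ^ Suc m) * ?L (Suc m) v x +
      ?s x ^ Suc (Suc m) * ?L (Suc (Suc m)) v x)) =
      ?s x ^ (Suc m + 2) / d ^ Suc (Suc m) *
        (?s x * ?L (Suc (Suc m)) v x + real (Suc (Suc m)) * a * ?L (Suc m) v x)"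
  proof -
    have "(s\<^sup>2 / d) * ((1 / e) * (r * (a * p) * l + s * p * l2)) =
      (p * s\<^sup>2) / (d * e) * (s * l2 + r * a * l)" for s e r p l l2 :: real
      by (simp add: algebra_simps add_divide_distrib)
    from this[of "?s x" "d ^ Suc m" "1 + real (Suc m)" "?s x ^ Suc m"]
    show ?thesis
      unfolding power_add[of _ "Suc m" 2] power_Suc[of _ "Suc m"] of_nat_Suc[of "Suc m"] .
  qed
  also have "?s x * ?L (Suc (Suc m)) v x + real (Suc (Suc m)) * a * ?L (Suc m) v x =
      ?L (Suc (Suc m)) (\<lambda>x. ?s x * v x) x"
    by (rule first_order_iterate_affine_mult[OF assms(1,2) v x, symmetric])
  also have "\<dots> = ?L (Suc (Suc m)) u x"
    by (rule first_order_iterate_cong[OF assms(1) refl uv[symmetric] x])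
  finally show ?case .
qed

text \<open>Makes |s| a constant multiple of s, so that the half-integral power of \<rho>_z becomes a constant multiple of a
power of s.\<close>

lemma sign_constant:
  fixes f :: "'a::topological_space \<Rightarrow> real"
  assumes "connected S" "continuous_on S f" "\<And>x. x \<in> S \<Longrightarrow> f x \<noteq> 0"
  obtains \<epsilon> where "\<epsilon> \<noteq> 0" "\<And>x. x \<in> S \<Longrightarrow> \<bar>f x\<bar> = \<epsilon> * f x"
proof -
  have c: "connected (f ` S)" by (rule connected_continuous_image[OF assms(2,1)])
  show ?thesis
  proof (cases "\<exists>x\<in>S. f x > 0")
    case True
    then obtain x where x: "x \<in> S" "f x > 0" by auto
    have pos: "f y > 0" if "y \<in> S" for y
    proof (rule ccontr)
      assume "\<not> f y > 0"
      then have "0 \<in> f ` S"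
        using connectedD_interval[OF c, of "f y" "f x" 0] that x by auto
      then show False using assms(3) by auto
    qed
    show ?thesis by (rule that[of 1]) (use pos in \<open>auto simp: abs_of_pos\<close>)
  next
    case False
    then show ?thesis by (intro that[of "-1"]) force+
  qed
qed

lemma half_pow_divide_square:
  assumes "s \<noteq> 0"
  shows "half_pow (d / s ^ 2) m = half_pow d m / \<bar>s\<bar> ^ m"
proof (cases "even m")
  case True
  then obtain k where "m = 2 * k" by (auto elim: evenE)
  then show ?thesis by (simp add: half_pow_def power_divide power_mult)
next
  case False
  have "(\<bar>s\<bar> ^ 2) powr (real m / 2) = \<bar>s\<bar> ^ m"
  proof -
    have "(\<bar>s\<bar> ^ 2) powr (real m / 2) = (\<bar>s\<bar> powr 2) powr (real m / 2)"
      using assms by (simp add: powr_numeral)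
    also have "\<dots> = \<bar>s\<bar> powr real m" unfolding powr_powr by simp
    also have "\<dots> = \<bar>s\<bar> ^ m" using assms by (simp add: powr_realpow)
    finally show ?thesis .
  qed
  then show ?thesis using False assms
    by (simp add: half_pow_def abs_divide powr_divide power_abs[symmetric])
qed

lemma half_pow_nonzero: "d \<noteq> 0 \<Longrightarrow> half_pow d m \<noteq> 0"
  by (simp add: half_pow_def)

lemma DERIV_moebius:
  assumes "k4 * z + k3 \<noteq> (0::real)"
  shows "((\<lambda>z. (k2 * z + k1) / (k4 * z + k3)) has_real_derivative
    (k2 * k3 - k1 * k4) / (k4 * z + k3) ^ 2) (at z)"
proof -
  have "((\<lambda>z. (k2 * z + k1) / (k4 * z + k3)) has_real_derivative
      (k2 * (k4 * z + k3) - (k2 * z + k1) * k4) / ((k4 * z + k3) * (k4 * z + k3))) (at z)"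
    by (rule DERIV_divide) (use assms in \<open>auto intro!: derivative_eq_intros\<close>)
  moreover have "k2 * (k4 * z + k3) - (k2 * z + k1) * k4 = k2 * k3 - k1 * k4"
    by (simp add: algebra_simps)
  ultimately show ?thesis by (simp add: power2_eq_square)
qed

lemma eventually_slice:
  assumes "open D" "(z, w) \<in> D"
  shows "eventually (\<lambda>t. (t, w) \<in> D) (nhds z)" "eventually (\<lambda>t. (z, t) \<in> D) (nhds w)"
proof -
  have "open ((\<lambda>t. (t, w)) -` D)" "open ((\<lambda>t. (z, t)) -` D)"
    by (rule open_vimage[OF assms(1)]; intro continuous_intros)+
  then show "eventually (\<lambda>t. (t, w) \<in> D) (nhds z)" "eventually (\<lambda>t. (z, t) \<in> D) (nhds w)"
    using assms(2) eventually_nhds_in_open[of _ z] eventually_nhds_in_open[of _ w] by fastforce+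
qed

lemma pd1_moebius:
  assumes "open D" "(z, w) \<in> D"
    "\<And>z w. (z, w) \<in> D \<Longrightarrow> k4 * z + k3 \<noteq> 0 \<and> \<rho> (z, w) = (k2 * z + k1) / (k4 * z + k3)"
  shows "pd1 \<rho> (z, w) = (k2 * k3 - k1 * k4) / (k4 * z + k3) ^ 2"
proof -
  have "eventually (\<lambda>t. \<rho> (t, w) = (k2 * t + k1) / (k4 * t + k3)) (nhds z)"
    using eventually_slice(1)[OF assms(1,2)] by (rule eventually_mono) (use assms(3) in auto)
  then have "pd1 \<rho> (z, w) = deriv (\<lambda>t. (k2 * t + k1) / (k4 * t + k3)) z"
    unfolding pd1_def by (simp add: deriv_cong_ev)
  also have "\<dots> = (k2 * k3 - k1 * k4) / (k4 * z + k3) ^ 2"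
    by (intro DERIV_imp_deriv DERIV_moebius) (use assms in blast)
  finally show ?thesis .
qed

text \<open>The form used for computations: all powers of \<rho>_z are written in terms of the affine denominator, with
the branch of the fractional power absorbed in the constant H.\<close>

lemma projective_form_explicit:
  assumes "open D" "connected D" "projective_form n D k1 k2 k3 k4 r0 \<rho> \<psi>"
  obtains H where "H \<noteq> 0" "r0 \<noteq> 0" "k2 * k3 - k1 * k4 \<noteq> 0"
    "\<And>z w. (z, w) \<in> D \<Longrightarrow> k4 * z + k3 \<noteq> 0"
    "\<And>z w. (z, w) \<in> D \<Longrightarrow> \<rho> (z, w) = (k2 * z + k1) / (k4 * z + k3)"
    "\<And>z w. (z, w) \<in> D \<Longrightarrow> pd1 \<rho> (z, w) = (k2 * k3 - k1 * k4) / (k4 * z + k3) ^ 2"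
    "\<And>z w. (z, w) \<in> D \<Longrightarrow> half_pow (pd1 \<rho> (z, w)) (n - 1) = H / (k4 * z + k3) ^ (n - 1)"
    "\<And>z w. (z, w) \<in> D \<Longrightarrow> \<psi> (z, w) = r0 * H * w / (k4 * z + k3) ^ (n - 1)"
proof -
  have p: "k2 * k3 - k1 * k4 \<noteq> 0" "r0 \<noteq> 0" and
    q: "\<And>z w. (z, w) \<in> D \<Longrightarrow> k4 * z + k3 \<noteq> 0 \<and> \<rho> (z, w) = (k2 * z + k1) / (k4 * z + k3)"
    and \<psi>: "\<And>z w. (z, w) \<in> D \<Longrightarrow> \<psi> (z, w) = r0 * half_pow (pd1 \<rho> (z, w)) (n - 1) * w"
    using assms(3) unfolding projective_form_def by auto
  have c: "continuous_on D (\<lambda>p. k4 * fst p + k3)" by (intro continuous_intros)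
  obtain \<epsilon> where \<epsilon>: "\<epsilon> \<noteq> 0" "\<And>p. p \<in> D \<Longrightarrow> \<bar>k4 * fst p + k3\<bar> = \<epsilon> * (k4 * fst p + k3)"
    by (rule sign_constant[OF assms(2) c]) (use q in force)+
  define H where "H = half_pow (k2 * k3 - k1 * k4) (n - 1) / \<epsilon> ^ (n - 1)"
  have H: "H \<noteq> 0" using \<epsilon> p half_pow_nonzero by (simp add: H_def)
  have pd: "pd1 \<rho> (z, w) = (k2 * k3 - k1 * k4) / (k4 * z + k3) ^ 2" if "(z, w) \<in> D" for z w
    by (rule pd1_moebius[OF assms(1) that q])
  have hp: "half_pow (pd1 \<rho> (z, w)) (n - 1) = H / (k4 * z + k3) ^ (n - 1)" if zw: "(z, w) \<in> D" for z w
  proof -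
    have a: "\<bar>k4 * z + k3\<bar> = \<epsilon> * (k4 * z + k3)" using \<epsilon>(2)[OF zw] by simp
    show ?thesis
      unfolding pd[OF zw] half_pow_divide_square[OF conjunct1[OF q[OF zw]]] a
      by (simp add: H_def power_mult_distrib)
  qed
  show ?thesis
    by (rule that[OF H p(2,1) _ _ pd hp]) (use q \<psi> hp in \<open>auto\<close>)
qed

lemma moebius_inj:
  assumes "k2 * k3 - k1 * k4 \<noteq> (0::real)" "k4 * z + k3 \<noteq> 0" "k4 * z' + k3 \<noteq> 0"
    "(k2 * z + k1) / (k4 * z + k3) = (k2 * z' + k1) / (k4 * z' + k3)"
  shows "z = z'"
proof -
  have "(k2 * z + k1) * (k4 * z' + k3) = (k2 * z' + k1) * (k4 * z + k3)"
    using assms(2-4) by (simp add: frac_eq_eq)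
  then have "(k2 * k3 - k1 * k4) * (z - z') = 0" by (simp add: algebra_simps)
  then show ?thesis using assms(1) by simp
qed

lemma projective_point_transformation:
  assumes "open D" "connected D" "projective_form n D k1 k2 k3 k4 r0 \<rho> \<psi>"
  shows "point_transformation D \<rho> \<psi>"
proof -
  obtain H where H: "H \<noteq> 0" "r0 \<noteq> 0" "k2 * k3 - k1 * k4 \<noteq> 0"
    and nz: "\<And>z w. (z, w) \<in> D \<Longrightarrow> k4 * z + k3 \<noteq> 0"
    and \<rho>: "\<And>z w. (z, w) \<in> D \<Longrightarrow> \<rho> (z, w) = (k2 * z + k1) / (k4 * z + k3)"
    and pd: "\<And>z w. (z, w) \<in> D \<Longrightarrow> pd1 \<rho> (z, w) = (k2 * k3 - k1 * k4) / (k4 * z + k3) ^ 2"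
    and \<psi>: "\<And>z w. (z, w) \<in> D \<Longrightarrow> \<psi> (z, w) = r0 * H * w / (k4 * z + k3) ^ (n - 1)"
    by (rule projective_form_explicit[OF assms]) (rule that)
  note i = smooth_on_fst[OF assms(1)] smooth_on_snd[OF assms(1)]
  have "smooth_on D (\<lambda>p. (k2 * fst p + k1) / (k4 * fst p + k3))"
    by (intro smooth_on_divide smooth_intros assms(1) i) (use nz in force)
  then have s1: "smooth_on D \<rho>" by (rule smooth_on_cong[OF assms(1)]) (use \<rho> in force)
  have "smooth_on D (\<lambda>p. r0 * H * snd p / (k4 * fst p + k3) ^ (n - 1))"
    by (intro smooth_on_divide smooth_intros assms(1) i) (use nz in force)
  then have s2: "smooth_on D \<psi>" by (rule smooth_on_cong[OF assms(1)]) (use \<psi> in force)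
  have inj: "inj_on (\<lambda>p. (\<rho> p, \<psi> p)) D"
  proof (rule inj_onI)
    fix p q assume pq: "p \<in> D" "q \<in> D" "(\<rho> p, \<psi> p) = (\<rho> q, \<psi> q)"
    obtain z w z' w' where e: "p = (z, w)" "q = (z', w')" by (cases p, cases q) auto
    have zz: "z = z'"
      using moebius_inj[OF H(3) nz nz] pq \<rho> e by auto
    have "r0 * H * w / (k4 * z + k3) ^ (n - 1) = r0 * H * w' / (k4 * z + k3) ^ (n - 1)"
      using pq \<psi> e zz by auto
    then have "w = w'" using H nz[of z w] pq e by simp
    then show "p = q" using zz e by simp
  qed
  have "pd1 \<rho> p * pd2 \<psi> p - pd2 \<rho> p * pd1 \<psi> p \<noteq> 0" if pD: "p \<in> D" for p
  proof -
    obtain z w where e: "p = (z, w)" by (cases p)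
    have zw: "(z, w) \<in> D" using pD e by simp
    note ev = eventually_slice(2)[OF assms(1) zw]
    have "eventually (\<lambda>t. \<rho> (z, t) = (k2 * z + k1) / (k4 * z + k3)) (nhds w)"
      using ev by (rule eventually_mono) (use \<rho> in auto)
    then have "pd2 \<rho> p = deriv (\<lambda>t. (k2 * z + k1) / (k4 * z + k3)) w"
      unfolding pd2_def e by (simp add: deriv_cong_ev)
    then have 1: "pd2 \<rho> p = 0" by simp
    have "eventually (\<lambda>t. \<psi> (z, t) = r0 * H / (k4 * z + k3) ^ (n - 1) * t) (nhds w)"
      using ev by (rule eventually_mono) (use \<psi> in auto)
    then have "pd2 \<psi> p = deriv (\<lambda>t. r0 * H / (k4 * z + k3) ^ (n - 1) * t) w"
      unfolding pd2_def e by (simp add: deriv_cong_ev)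
    also have "\<dots> = r0 * H / (k4 * z + k3) ^ (n - 1)"
      by (rule DERIV_imp_deriv[OF DERIV_cmult_Id])
    finally show ?thesis using 1 pd[OF zw] H nz[OF zw] e by simp
  qed
  then show ?thesis unfolding point_transformation_def using s1 s2 inj by blast
qed

lemma open_image_point_transformation:
  assumes "open D" "point_transformation D \<rho> \<psi>"
  shows "open ((\<lambda>p. (\<rho> p, \<psi> p)) ` D)"
proof (rule invariance_of_domain[OF _ assms(1)])
  show "continuous_on D (\<lambda>p. (\<rho> p, \<psi> p))" "inj_on (\<lambda>p. (\<rho> p, \<psi> p)) D"
    using assms(2) smooth_on_continuous unfolding point_transformation_def
    by (auto intro!: continuous_on_Pair)
qed

text \<open>Pulling the equation back to z turns the operator into the weighted one with weight s^2/\<Delta>, and \<psi> into a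
constant times w/s^(n-1); Bol's lemma then moves all powers of s to the front, where they form the
nonvanishing factor.\<close>

lemma projective_transformed_parameter:
  assumes n: "n \<ge> 2" and D: "open D" "connected D"
    and P: "projective_form n D k1 k2 k3 k4 r0 \<rho> \<psi>"
    and F: "smooth_on ((\<lambda>p. (\<rho> p, \<psi> p)) ` D) F"
    and Q: "smooth_on D Q" "\<And>p. p \<in> D \<Longrightarrow> Q p = pd1 \<rho> p * F (\<rho> p, \<psi> p)"
  shows "transformed_parameter n D \<rho> \<psi> F Q"
proof -
  obtain H where H: "H \<noteq> 0" "r0 \<noteq> 0" "k2 * k3 - k1 * k4 \<noteq> 0"
    and nz: "\<And>z w. (z, w) \<in> D \<Longrightarrow> k4 * z + k3 \<noteq> 0"
    and \<rho>: "\<And>z w. (z, w) \<in> D \<Longrightarrow> \<rho> (z, w) = (k2 * z + k1) / (k4 * z + k3)"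
    and pd: "\<And>z w. (z, w) \<in> D \<Longrightarrow> pd1 \<rho> (z, w) = (k2 * k3 - k1 * k4) / (k4 * z + k3) ^ 2"
    and \<psi>: "\<And>z w. (z, w) \<in> D \<Longrightarrow> \<psi> (z, w) = r0 * H * w / (k4 * z + k3) ^ (n - 1)"
    by (rule projective_form_explicit[OF D P]) (rule that)
  obtain m where m: "n = Suc m" using n by (cases n) auto
  define d where "d = k2 * k3 - k1 * k4"
  define M where "M z = (k2 * z + k1) / (k4 * z + k3)" for z
  define \<mu> where "\<mu> z (j :: real list) = (if k4 * z + k3 = 0 then 1 else
     r0 * H * ((k4 * z + k3) ^ (m + 2) / d ^ Suc m))" for z j
  have \<mu>: "\<mu> z j \<noteq> 0" for z j using H by (simp add: \<mu>_def d_def)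
  have "(Omega F y ^^ n) y (\<rho> (z, w z)) = \<mu> z (jet n w z) * (Omega Q w ^^ n) w z"
    if cc: "corresponding_curves D \<rho> \<psi> I w y" and z: "z \<in> I" for I w y z
  proof -
    have I: "open I" "smooth_on I w" "smooth_on ((\<lambda>z. \<rho> (z, w z)) ` I) y"
      and inD: "\<And>z. z \<in> I \<Longrightarrow> (z, w z) \<in> D"
      and y: "\<And>z. z \<in> I \<Longrightarrow> y (\<rho> (z, w z)) = \<psi> (z, w z)"
      using cc unfolding corresponding_curves_def by auto
    have MI: "\<rho> (z, w z) = M z" if "z \<in> I" for z using \<rho>[OF inD[OF that]] by (simp add: M_def)
    have dM: "(M has_real_derivative d / (k4 * z + k3) ^ 2) (at z)" if "z \<in> I" for z
      unfolding M_def d_def by (rule DERIV_moebius) (use nz[OF inD[OF that]] in auto)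
    define X where "X = M ` I"
    have X: "open X"
      unfolding X_def
    proof (rule invariance_of_domain[OF _ I(1)])
      show "continuous_on I M"
        by (rule continuous_at_imp_continuous_on) (use dM DERIV_isCont in blast)
      show "inj_on M I"
      proof (rule inj_onI)
        fix z z' assume "z \<in> I" "z' \<in> I" "M z = M z'"
        then show "z = z'"
          using moebius_inj[OF H(3) nz[OF inD] nz[OF inD], of z z'] by (simp add: M_def)
      qed
    qed
    have sy: "smooth_on X y"
    proof -
      have "(\<lambda>z. \<rho> (z, w z)) ` I = X" unfolding X_def using MI by (intro image_cong) auto
      then show ?thesis using I(3) by simp
    qed
    define f where "f x = F (x, y x)" for x
    have sf: "smooth_on X f"
      unfolding f_def
    proof (rule smooth_on_along_curve[OF X F sy])
      fix x assume "x \<in> X"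
      then obtain z where "z \<in> I" "x = M z" by (auto simp: X_def)
      then have "(x, y x) = (\<rho> (z, w z), \<psi> (z, w z))" using MI y by auto
      then show "(x, y x) \<in> (\<lambda>p. (\<rho> p, \<psi> p)) ` D" using inD[OF \<open>z \<in> I\<close>] by auto
    qed
    let ?N = "weighted_first_order (\<lambda>x. (k4 * x + k3) ^ 2 / d) (\<lambda>z. Q (z, w z))"
    have pull: "(first_order f ^^ j) y (M z) = (?N ^^ j) (\<lambda>z. y (M z)) z" if "z \<in> I" for j z
      using that
    proof (induction j arbitrary: z)
      case (Suc j)
      let ?u = "(first_order f ^^ j) y"
      have MX: "M z \<in> X" using Suc.prems by (auto simp: X_def)
      have du: "(?u has_real_derivative deriv ?u (M z)) (at (M z))"
        by (rule smooth_on_real_derivative[OF smooth_on_first_order_iterate[OF X sf sy] MX])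
      have "deriv ((?N ^^ j) (\<lambda>z. y (M z))) z = deriv (\<lambda>z. ?u (M z)) z"
        using deriv_iterate_cong[OF I(1) Suc.IH Suc.prems, of _ 1] by simp
      also have "\<dots> = deriv ?u (M z) * (d / (k4 * z + k3) ^ 2)"
        by (rule DERIV_imp_deriv[OF DERIV_chain2[OF du dM[OF Suc.prems]]])
      finally have e: "deriv ((?N ^^ j) (\<lambda>z. y (M z))) z = deriv ?u (M z) * (d / (k4 * z + k3) ^ 2)" .
      have q: "Q (z, w z) = d / (k4 * z + k3) ^ 2 * f (M z)"
        using Q(2)[OF inD[OF Suc.prems]] pd[OF inD[OF Suc.prems]] MI[OF Suc.prems] y[OF Suc.prems]
        by (simp add: f_def d_def)
      have "(?N ^^ Suc j) (\<lambda>z. y (M z)) z = (k4 * z + k3) ^ 2 / d *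
          (deriv ((?N ^^ j) (\<lambda>z. y (M z))) z + Q (z, w z) * (?N ^^ j) (\<lambda>z. y (M z)) z)"
        by (simp add: weighted_first_order_def first_order_def)
      also have "\<dots> = deriv ?u (M z) + f (M z) * ?u (M z)"
        unfolding e q Suc.IH[OF Suc.prems, symmetric]
        using nz[OF inD[OF Suc.prems]] H(3) by (simp add: d_def field_simps)
      finally show ?case unfolding first_order_Suc by (rule sym)
    qed simp
    have yM: "y (M z) = r0 * H * w z / (k4 * z + k3) ^ m" if "z \<in> I" for z
      using y[OF that] MI[OF that] \<psi>[OF inD[OF that]] by (simp add: m)
    have sQ: "smooth_on I (\<lambda>z. Q (z, w z))"
      by (rule smooth_on_along_curve[OF I(1) Q(1) I(2) inD])
    have "(Omega F y ^^ n) y (\<rho> (z, w z)) = (?N ^^ n) (\<lambda>z. y (M z)) z"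
      using pull[OF z] MI[OF z] unfolding Omega_eq_first_order f_def[abs_def] by simp
    also have "\<dots> = (?N ^^ Suc m) (\<lambda>z. (r0 * H * w z) / (k4 * z + k3) ^ m) z"
      unfolding m by (rule weighted_first_order_iterate_cong[OF I(1) refl yM z])
    also have "\<dots> = (k4 * z + k3) ^ (m + 2) / d ^ Suc m *
        (first_order (\<lambda>z. Q (z, w z)) ^^ Suc m) (\<lambda>z. r0 * H * w z) z"
      by (rule weighted_first_order_iterate_affine[OF I(1) sQ _ _ z])
        (use nz inD in \<open>auto intro!: smooth_on_mult smooth_on_const I\<close>)
    also have "\<dots> = (k4 * z + k3) ^ (m + 2) / d ^ Suc m *
        (r0 * H * (first_order (\<lambda>z. Q (z, w z)) ^^ Suc m) w z)"
      unfolding first_order_iterate_cmult[OF I(1) sQ I(2) z] ..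
    finally show ?thesis
      using nz[OF inD[OF z]] unfolding Omega_eq_first_order \<mu>_def m by simp
  qed
  then show ?thesis unfolding transformed_parameter_def using Q(1) \<mu> by blast
qed

lemma projective_in_G:
  assumes n: "n \<ge> 2" and D: "open D" "connected D"
    and P: "projective_form n D k1 k2 k3 k4 r0 \<rho> \<psi>"
  shows "(\<rho>, \<psi>) \<in> G n D"
    and "smooth_on (\<rho> ` D) \<alpha> \<Longrightarrow>
      (\<And>z w. (z, w) \<in> D \<Longrightarrow> Q (z, w) =
           r0 * \<alpha> (\<rho> (z, w)) * (pd1 \<rho> (z, w) * half_pow (pd1 \<rho> (z, w)) (n - 1)) * w) \<Longrightarrow>
      transformed_parameter n D \<rho> \<psi> (\<lambda>(x, y). \<alpha> x * y) Q"
proof -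
  obtain H where H: "H \<noteq> 0" "r0 \<noteq> 0" "k2 * k3 - k1 * k4 \<noteq> 0"
    and nz: "\<And>z w. (z, w) \<in> D \<Longrightarrow> k4 * z + k3 \<noteq> 0"
    and \<rho>: "\<And>z w. (z, w) \<in> D \<Longrightarrow> \<rho> (z, w) = (k2 * z + k1) / (k4 * z + k3)"
    and pd: "\<And>z w. (z, w) \<in> D \<Longrightarrow> pd1 \<rho> (z, w) = (k2 * k3 - k1 * k4) / (k4 * z + k3) ^ 2"
    and hp: "\<And>z w. (z, w) \<in> D \<Longrightarrow> half_pow (pd1 \<rho> (z, w)) (n - 1) = H / (k4 * z + k3) ^ (n - 1)"
    and \<psi>: "\<And>z w. (z, w) \<in> D \<Longrightarrow> \<psi> (z, w) = r0 * H * w / (k4 * z + k3) ^ (n - 1)"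
    by (rule projective_form_explicit[OF D P]) (rule that)
  note pt = projective_point_transformation[OF D P]
  have sm: "smooth_on D \<rho>" "smooth_on D \<psi>" using pt by (auto simp: point_transformation_def)
  let ?E = "(\<lambda>p. (\<rho> p, \<psi> p)) ` D"
  have E: "open ?E" by (rule open_image_point_transformation[OF D(1) pt])
  have general: "transformed_parameter n D \<rho> \<psi> F (\<lambda>p. pd1 \<rho> p * F (\<rho> p, \<psi> p))"
    if F: "smooth_on ?E F" for F
    by (rule projective_transformed_parameter[OF n D P F])
      (auto intro!: smooth_on_mult D smooth_on_pd sm smooth_on_compose[OF D(1) smooth_on_Pair[OF D(1) sm] F])
  have dom: "open (fst ` D)" by (rule open_image_fst[OF D(1)])
  define \<delta> where "\<delta> \<alpha> z = r0 * H * (k2 * k3 - k1 * k4) * \<alpha> ((k2 * z + k1) / (k4 * z + k3)) /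
    (k4 * z + k3) ^ (n + 1)" for \<alpha> z
  have \<delta>: "r0 * \<alpha> (\<rho> (z, w)) * (pd1 \<rho> (z, w) * half_pow (pd1 \<rho> (z, w)) (n - 1)) * w = \<delta> \<alpha> z * w"
    if zw: "(z, w) \<in> D" for \<alpha> z w
  proof -
    have "(k4 * z + k3) ^ (n + 1) = (k4 * z + k3) ^ 2 * (k4 * z + k3) ^ (n - 1)"
      using n by (simp flip: power_add)
    then show ?thesis unfolding hp[OF zw] unfolding pd[OF zw] \<rho>[OF zw] \<delta>_def[of \<alpha> z] by simp
  qed
  have s\<delta>: "smooth_on (fst ` D) (\<delta> \<alpha>)" if \<alpha>: "smooth_on (\<rho> ` D) \<alpha>" for \<alpha>
  proof -
    have nz': "\<And>z. z \<in> fst ` D \<Longrightarrow> k4 * z + k3 \<noteq> 0" using nz by force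
    have "smooth_on (fst ` D) (\<lambda>z. (k2 * z + k1) / (k4 * z + k3))"
      by (intro smooth_on_divide smooth_intros dom nz')
    from smooth_on_compose[OF dom this \<alpha>]
    have "smooth_on (fst ` D) (\<lambda>z. \<alpha> ((k2 * z + k1) / (k4 * z + k3)))"
      using \<rho> by force
    then show ?thesis
      unfolding \<delta>_def by (intro smooth_on_divide smooth_intros dom) (use nz' in auto)
  qed
  have sF: "smooth_on ?E (\<lambda>(x, y). \<alpha> x * y)" if \<alpha>: "smooth_on (\<rho> ` D) \<alpha>" for \<alpha>
    unfolding split_beta
    by (intro smooth_on_mult E smooth_on_snd smooth_on_compose[OF E smooth_on_fst[OF E] \<alpha>]) auto
  have lin: "transformed_parameter n D \<rho> \<psi> (\<lambda>(x, y). \<alpha> x * y) Q"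
    if \<alpha>: "smooth_on (\<rho> ` D) \<alpha>" and Q: "\<And>z w. (z, w) \<in> D \<Longrightarrow> Q (z, w) = \<delta> \<alpha> z * w" for \<alpha> Q
  proof (rule projective_transformed_parameter[OF n D P sF[OF \<alpha>]])
    have "smooth_on D (\<lambda>p. \<delta> \<alpha> (fst p) * snd p)"
      by (intro smooth_on_mult D smooth_on_snd smooth_on_compose[OF D(1) smooth_on_fst[OF D(1)] s\<delta>[OF \<alpha>]]) auto
    then show "smooth_on D Q" by (rule smooth_on_cong[OF D(1)]) (use Q in auto)
    show "Q p = pd1 \<rho> p * (case (\<rho> p, \<psi> p) of (x, y) \<Rightarrow> \<alpha> x * y)" if "p \<in> D" for p
    proof -
      obtain z w where e: "p = (z, w)" by (cases p)
      then have zw: "(z, w) \<in> D" using that by simp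
      show ?thesis
        unfolding e Q[OF zw] \<delta>[OF zw, symmetric] using \<psi>[OF zw] hp[OF zw] by simp
    qed
  qed
  show "transformed_parameter n D \<rho> \<psi> (\<lambda>(x, y). \<alpha> x * y) Q"
    if "smooth_on (\<rho> ` D) \<alpha>" "\<And>z w. (z, w) \<in> D \<Longrightarrow> Q (z, w) =
           r0 * \<alpha> (\<rho> (z, w)) * (pd1 \<rho> (z, w) * half_pow (pd1 \<rho> (z, w)) (n - 1)) * w"
    by (rule lin[OF that(1)], rule trans[OF that(2)], assumption, rule \<delta>)
  show "(\<rho>, \<psi>) \<in> G n D"
    unfolding G_def equivalence_transformation_def mem_Collect_eq prod.case
  proof (intro conjI allI impI)
    fix \<alpha> :: "real \<Rightarrow> real" assume \<alpha>: "smooth_on (\<rho> ` D) \<alpha>"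
    have "transformed_parameter n D \<rho> \<psi> (\<lambda>(x, y). \<alpha> x * y) (\<lambda>(z, w). \<delta> \<alpha> z * w)"
      by (rule lin[OF \<alpha>]) simp
    then show "\<exists>\<delta>. smooth_on (fst ` D) \<delta> \<and>
        transformed_parameter n D \<rho> \<psi> (\<lambda>(x, y). \<alpha> x * y) (\<lambda>(z, w). \<delta> z * w)"
      using s\<delta>[OF \<alpha>] by blast
  qed (use pt general in blast)+
qed

section \<open>Polynomial identities\<close>

lemma poly_eq_on_infinite:
  fixes p q :: "real poly"
  assumes "infinite S" "\<And>x. x \<in> S \<Longrightarrow> poly p x = poly q x"
  shows "p = q"
proof (rule ccontr)
  assume "p \<noteq> q"
  then have "finite {x. poly (p - q) x = 0}" by (intro poly_roots_finite) simp
  moreover have "S \<subseteq> {x. poly (p - q) x = 0}" using assms(2) by auto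
  ultimately show False using assms(1) finite_subset by blast
qed

lemma infinite_ball_real: "r > 0 \<Longrightarrow> infinite (ball (c::real) r)"
  by (simp add: ball_eq_greaterThanLessThan infinite_Ioo)

lemma deriv_iterate_poly: "(deriv ^^ n) (poly p) = poly ((pderiv ^^ n) (p :: real poly))"
proof (induction n arbitrary: p)
  case (Suc n)
  have "deriv (poly p) = poly (pderiv p)"
    by (rule ext) (rule DERIV_imp_deriv[OF poly_DERIV])
  then show ?case using Suc[of "pderiv p"] by (simp add: funpow_swap1)
qed simp

lemma deriv_iterate_poly_zero:
  fixes p :: "real poly"
  assumes "degree p < n"
  shows "(deriv ^^ n) (poly p) x = 0"
proof -
  have "degree p < n \<Longrightarrow> (pderiv ^^ n) p = 0" for p :: "real poly"
  proof (induction n arbitrary: p)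
    case (Suc n)
    have z: "(pderiv ^^ k) 0 = (0 :: real poly)" for k by (induction k) auto
    show ?case
    proof (cases "degree p = 0")
      case True
      then have "pderiv p = 0" by (simp add: pderiv_eq_0_iff)
      then show ?thesis using z[of n] by (simp add: funpow_swap1)
    next
      case False
      then have "degree (pderiv p) < n" using Suc.prems by (simp add: degree_pderiv)
      then show ?thesis using Suc.IH by (simp add: funpow_swap1)
    qed
  qed simp
  then show ?thesis using assms by (simp add: deriv_iterate_poly)
qed

lemma poly_degree_le_1:
  fixes p :: "real poly"
  assumes "degree p \<le> 1"
  shows "p = [:coeff p 0, coeff p 1:]"
proof (rule poly_eqI)
  fix i
  consider "i = 0" | "i = 1" | j where "i = Suc (Suc j)"
    by (metis One_nat_def not0_implies_Suc)
  then show "coeff p i = coeff [:coeff p 0, coeff p 1:] i"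
  proof cases
    case 3
    then show ?thesis using assms coeff_eq_0[of p i] by simp
  qed auto
qed

text \<open>Counting degrees gives deg a (1 + deg b) = 1, so that a has degree one and b is constant; at the point 0
the identity then shows that a has no constant term.\<close>

lemma linear_of_composition_identity:
  fixes a b :: "real poly"
  assumes "C \<noteq> 0" "pderiv a \<noteq> 0"
    and eq: "smult C ([:0, 0, 1:] * pderiv a) = a ^ 2 * pcompose b a"
  obtains c where "c \<noteq> 0" "a = [:0, c:]"
proof -
  have d: "degree a > 0" using assms(2) by (metis neq0_conv pderiv_eq_0_iff)
  have nz: "a \<noteq> 0" "pcompose b a \<noteq> 0" using assms eq d by auto
  define X where "X = [:0, 0, 1:] * pderiv a"
  have "degree X = 2 + (degree a - 1)"
    unfolding X_def by (subst degree_mult_eq) (use assms(2) in \<open>auto simp: degree_pderiv\<close>)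
  then have "degree (smult C X) = 2 + (degree a - 1)" using assms(1) by simp
  moreover have "degree (a ^ 2 * pcompose b a) = 2 * degree a + degree b * degree a"
    using nz by (simp add: degree_mult_eq degree_power_eq degree_pcompose)
  moreover have "smult C X = a ^ 2 * pcompose b a" using eq unfolding X_def .
  ultimately have "2 + (degree a - 1) = 2 * degree a + degree b * degree a" by (simp only:)
  then have "degree a + 1 = 2 * degree a + degree b * degree a" using d by linarith
  moreover have "degree a * (1 + degree b) = degree a + degree b * degree a"
    by (simp add: algebra_simps)
  ultimately have e: "degree a * (1 + degree b) = 1" by linarith
  then have "degree a = 1 \<and> 1 + degree b = 1" by (rule nat_mult_eq_1_iff[THEN iffD1])
  then have deg: "degree a = 1" "degree b = 0" by linarith+
  obtain a0 a1 where a: "a = [:a0, a1:]" using poly_degree_le_1[of a] deg(1) by auto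
  obtain \<beta> where b: "b = [:\<beta>:]" using deg(2) by (auto elim: degree_eq_zeroE)
  have "\<beta> \<noteq> 0" using nz(2) b by auto
  moreover have "poly (smult C ([:0, 0, 1:] * pderiv a)) 0 = poly (a ^ 2 * pcompose b a) 0"
    unfolding eq ..
  ultimately have "a0 = 0" using a b by (simp add: poly_pcompose)
  moreover have "a1 \<noteq> 0" using d a \<open>a0 = 0\<close> by auto
  ultimately show ?thesis using a that by blast
qed

text \<open>For P0 = g and P1 = g R the hypotheses say that g R^(n-1) is a polynomial of degree less than n. With R in
lowest terms A/B, the denominator B^(n-1) has to divide P0, and both cofactor bounds
(n-1) deg B + deg h < n and (n-1) deg A + deg h < n leave only degree at most one for A and B.\<close>

lemma rational_function_with_power:
  fixes P0 P1 Pn :: "real poly"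
  assumes n: "n \<ge> 2" and nz: "P0 \<noteq> 0" and deg: "degree P0 < n" "degree Pn < n"
    and eq: "P0 ^ (n - 2) * Pn = P1 ^ (n - 1)"
    and nc: "\<And>c. P1 \<noteq> smult c P0"
  obtains A B h where "degree A \<le> 1" "degree B \<le> 1" "h \<noteq> 0" "P0 = smult h (B ^ (n - 1))"
    "P1 * B = P0 * A" "B \<noteq> 0"
proof -
  define g where "g = gcd P0 P1"
  have g: "g \<noteq> 0" using nz by (simp add: g_def)
  obtain B A where BA: "P0 = g * B" "P1 = g * A" "coprime B A"
    using gcd_coprime_exists[of P0 P1] g unfolding g_def by (metis mult.commute)
  obtain k where k: "n = Suc (Suc k)" using n by (metis add_2_eq_Suc le_Suc_ex)
  have B: "B \<noteq> 0" using nz BA by auto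
  have "g ^ k * (B ^ k * Pn) = g ^ k * (g * A ^ Suc k)"
    using eq unfolding BA k by (simp add: power_mult_distrib algebra_simps)
  then have e: "B ^ k * Pn = g * A ^ Suc k" using g by simp
  have "coprime (B ^ k) (A ^ Suc k)" using BA(3) by simp
  moreover have "B ^ k dvd g * A ^ Suc k" unfolding e[symmetric] by simp
  ultimately have "B ^ k dvd g" using coprime_dvd_mult_left_iff by blast
  then obtain h where h: "g = B ^ k * h" by (elim dvdE)
  have h0: "h \<noteq> 0" using g h by auto
  have P0: "P0 = h * B ^ Suc k" unfolding BA(1) h by (simp add: algebra_simps)
  have "B ^ k * Pn = B ^ k * (h * A ^ Suc k)" unfolding e h by (simp add: algebra_simps)
  then have Pn: "Pn = h * A ^ Suc k" using B by simp
  have P1: "P1 * B = P0 * A" unfolding BA by (simp add: algebra_simps)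
  have A0: "A \<noteq> 0"
  proof
    assume "A = 0"
    then have "P1 = smult 0 P0" using BA(2) by simp
    then show False using nc by blast
  qed
  have d1: "degree h + Suc k * degree B \<le> Suc k"
    using deg(1) h0 B unfolding P0 k by (simp add: degree_mult_eq degree_power_eq del: power_Suc)
  have d2: "degree h + Suc k * degree A \<le> Suc k"
    using deg(2) h0 A0 unfolding Pn k by (simp add: degree_mult_eq degree_power_eq del: power_Suc)
  have le: "degree B \<le> 1" "degree A \<le> 1"
  proof -
    have "Suc k * degree B \<le> Suc k * 1" "Suc k * degree A \<le> Suc k * 1"
      using order_trans[OF le_add2 d1] order_trans[OF le_add2 d2] by simp_all
    then show "degree B \<le> 1" "degree A \<le> 1" unfolding Suc_mult_le_cancel1 .
  qed
  have "degree h = 0"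
  proof (cases "degree B = 0 \<and> degree A = 0")
    case True
    then obtain \<beta> \<alpha> where "B = [:\<beta>:]" "A = [:\<alpha>:]" by (meson degree_eq_zeroE)
    then have "P1 = smult (\<alpha> / \<beta>) P0" using BA B by simp
    then show ?thesis using nc by blast
  next
    case False
    then have "degree B = 1 \<or> degree A = 1" using le by linarith
    then show ?thesis using d1 d2 by auto
  qed
  then obtain c where c: "h = [:c:]" by (auto elim: degree_eq_zeroE)
  show ?thesis
    by (rule that[OF le(2,1) _ _ P1 B, of c]) (use h0 c P0 k in auto)
qed

section \<open>Necessity of the projective form\<close>

lemma G_point_transformation: "(\<rho>, \<psi>) \<in> G n D \<Longrightarrow> point_transformation D \<rho> \<psi>"
  by (simp add: G_def equivalence_transformation_def)

lemma G_linear_parameter: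
  assumes "(\<rho>, \<psi>) \<in> G n D" "smooth_on (\<rho> ` D) \<alpha>"
  obtains \<delta> where "smooth_on (fst ` D) \<delta>"
    "transformed_parameter n D \<rho> \<psi> (\<lambda>(x, y). \<alpha> x * y) (\<lambda>(z, w). \<delta> z * w)"
  using assms unfolding G_def by blast

lemma G_pulse_parameters:
  assumes "(\<rho>, \<psi>) \<in> G n D"
  obtains \<delta>0 \<delta>1 where "smooth_on (fst ` D) \<delta>0" "smooth_on (fst ` D) \<delta>1"
    "transformed_parameter n D \<rho> \<psi> (\<lambda>(x, y). 0 * y) (\<lambda>(z, w). \<delta>0 z * w)"
    "transformed_parameter n D \<rho> \<psi> (\<lambda>(x, y). (x - x0) ^ (n - 1) * y) (\<lambda>(z, w). \<delta>1 z * w)"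
proof -
  have 1: "smooth_on (\<rho> ` D) (\<lambda>x. (x - x0) ^ (n - 1))"
    by (rule smooth_on_subset[of UNIV]) (auto intro!: smooth_intros)
  obtain \<delta>0 where d0: "smooth_on (fst ` D) \<delta>0"
    "transformed_parameter n D \<rho> \<psi> (\<lambda>(x, y). 0 * y) (\<lambda>(z, w). \<delta>0 z * w)"
    by (rule G_linear_parameter[OF assms smooth_on_const])
  obtain \<delta>1 where d1: "smooth_on (fst ` D) \<delta>1"
    "transformed_parameter n D \<rho> \<psi> (\<lambda>(x, y). (x - x0) ^ (n - 1) * y) (\<lambda>(z, w). \<delta>1 z * w)"
    by (rule G_linear_parameter[OF assms 1])
  show ?thesis by (rule that[OF d0(1) d1(1) d0(2) d1(2)])
qed

text \<open>The case of slope_expansion in which y = w and the curve is a straight line.\<close>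

lemma Omega_iterate_line_poly:
  assumes "open D" "smooth_on D Q" "(z0, w0) \<in> D"
  obtains p where "degree p \<le> n"
    "\<And>s. (Omega Q (\<lambda>z. w0 + s * (z - z0)) ^^ n) (\<lambda>z. w0 + s * (z - z0)) z0 = poly p s"
proof -
  obtain c where c: "\<forall>e s z. (z, e + s * z) \<in> D \<longrightarrow>
      (first_order (\<lambda>z. Q (z, snd (z, e + s * z))) ^^ n) (\<lambda>z. snd (z, e + s * z)) z =
      (\<Sum>i\<le>n. c i (z, e + s * z) * s ^ i)"
    using slope_expansion[OF open_UNIV assms(1) subset_UNIV smooth_on_id[OF open_UNIV]
        smooth_on_snd[OF assms(1)] assms(2), of n] by auto
  let ?p = "\<Sum>i\<le>n. monom (c i (z0, w0)) i"
  show ?thesis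
  proof (rule that[of ?p])
    show "degree ?p \<le> n"
      by (rule degree_sum_le) (auto intro: order_trans[OF degree_monom_le])
    fix s
    have l: "(\<lambda>z. w0 + s * (z - z0)) = (\<lambda>z. (w0 - s * z0) + s * z)" by (auto simp: algebra_simps)
    have z0: "(w0 - s * z0) + s * z0 = w0" by simp
    have "(Omega Q (\<lambda>z. w0 + s * (z - z0)) ^^ n) (\<lambda>z. w0 + s * (z - z0)) z0 =
       (\<Sum>i\<le>n. c i (z0, (w0 - s * z0) + s * z0) * s ^ i)"
      using c[rule_format, of z0 "w0 - s * z0" s] assms(3) unfolding Omega_eq_first_order l z0 by simp
    also have "\<dots> = poly ?p s" unfolding z0 by (simp add: poly_sum poly_monom)
    finally show "(Omega Q (\<lambda>z. w0 + s * (z - z0)) ^^ n) (\<lambda>z. w0 + s * (z - z0)) z0 = poly ?p s" .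
  qed
qed

text \<open>The pulse identity equates a polynomial in s of degree n + 1 with one of degree at most n, unless \<psi> or
\<rho>_w vanishes. Were \<rho>_w nonzero at a point, \<psi> would vanish in a neighbourhood, which contradicts the
Jacobian condition.\<close>

lemma G_rho_fibre_constant:
  assumes n: "n \<ge> 2" and D: "open D" and G: "(\<rho>, \<psi>) \<in> G n D" and p: "p \<in> D"
  shows "pd2 \<rho> p = 0"
proof (rule ccontr)
  assume p2: "pd2 \<rho> p \<noteq> 0"
  have pt: "smooth_on D \<rho>" "smooth_on D \<psi>"
    and J: "\<And>p. p \<in> D \<Longrightarrow> pd1 \<rho> p * pd2 \<psi> p - pd2 \<rho> p * pd1 \<psi> p \<noteq> 0"
    using G_point_transformation[OF G] by (auto simp: point_transformation_def)
  have main: "\<psi> q = 0" if q: "q \<in> D" "pd2 \<rho> q \<noteq> 0" for q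
  proof (rule ccontr)
    assume \<psi>q: "\<psi> q \<noteq> 0"
    obtain z0 w0 where e: "q = (z0, w0)" by (cases q)
    have zw: "(z0, w0) \<in> D" using q e by simp
    obtain \<delta>0 \<delta>1 where
      Q0: "transformed_parameter n D \<rho> \<psi> (\<lambda>(x, y). 0 * y) (\<lambda>(z, w). \<delta>0 z * w)" and
      Q1: "transformed_parameter n D \<rho> \<psi> (\<lambda>(x, y). (x - \<rho> q) ^ (n - 1) * y) (\<lambda>(z, w). \<delta>1 z * w)"
      by (rule G_pulse_parameters[OF G])
    obtain r0 where r0: "degree r0 \<le> n" "\<And>s. (Omega (\<lambda>(z, w). \<delta>0 z * w) (\<lambda>z. w0 + s * (z - z0)) ^^ n)
        (\<lambda>z. w0 + s * (z - z0)) z0 = poly r0 s"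
      using Omega_iterate_line_poly[OF D transformed_parameter_smooth[OF Q0] zw] by blast
    obtain r1 where r1: "degree r1 \<le> n" "\<And>s. (Omega (\<lambda>(z, w). \<delta>1 z * w) (\<lambda>z. w0 + s * (z - z0)) ^^ n)
        (\<lambda>z. w0 + s * (z - z0)) z0 = poly r1 s"
      using Omega_iterate_line_poly[OF D transformed_parameter_smooth[OF Q1] zw] by blast
    let ?l = "smult (fact (n - 1) * \<psi> q ^ 2) ([:pd1 \<rho> q, pd2 \<rho> q:] ^ Suc n)"
    let ?r = "smult (pd1 \<rho> q * pd2 \<psi> q - pd2 \<rho> q * pd1 \<psi> q) (r1 - r0)"
    have "?l = ?r"
    proof (rule poly_eq_on_infinite)
      show "infinite (UNIV - {- pd1 \<rho> q / pd2 \<rho> q})" by (simp add: infinite_UNIV_char_0)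
      fix s assume "s \<in> UNIV - {- pd1 \<rho> q / pd2 \<rho> q}"
      then have "pd1 \<rho> q + pd2 \<rho> q * s \<noteq> 0" using q(2) by (auto simp: field_simps)
      from parameter_pulse[OF n D pt q(1) e this Q0 Q1, unfolded r0(2) r1(2)]
      show "poly ?l s = poly ?r s" by (simp add: mult.commute del: power_Suc)
    qed
    moreover have "degree ?l = Suc n" using \<psi>q q(2) by (simp add: degree_power_eq del: power_Suc)
    moreover have "degree ?r \<le> n"
      using degree_diff_le[OF r1(1) r0(1)] degree_smult_le order_trans by blast
    ultimately show False by simp
  qed
  define N where "N = D \<inter> pd2 \<rho> -` (- {0})"
  have N: "open N"
    unfolding N_def
    by (rule continuous_open_preimage[OF smooth_on_continuous[OF smooth_on_pd(2)[OF D pt(1)]] D]) auto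
  obtain z w where e: "p = (z, w)" by (cases p)
  have zw: "(z, w) \<in> N" using p p2 e by (simp add: N_def)
  have "eventually (\<lambda>t. \<psi> (t, w) = 0) (nhds z)" "eventually (\<lambda>t. \<psi> (z, t) = 0) (nhds w)"
    using eventually_slice[OF N zw] main by (auto elim!: eventually_mono simp: N_def)
  then have "pd1 \<psi> p = 0" "pd2 \<psi> p = 0"
    unfolding pd1_def pd2_def e by (simp_all add: deriv_cong_ev)
  then show False using J[OF p] by simp
qed

text \<open>On a constant curve the part linear in w is a derivative of a constant, so the expansion starts with w^2.\<close>

lemma Omega_iterate_const_poly:
  assumes "open I" "smooth_on I \<delta>" "z \<in> I" "n \<ge> 1"
  obtains b where
    "\<And>w. (Omega (\<lambda>(z, w). \<delta> z * w) (\<lambda>_. w) ^^ n) (\<lambda>_. w) z = w ^ 2 * poly b w"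
proof -
  obtain e where e0: "\<forall>z\<in>I. e 0 z = (deriv ^^ n) (\<lambda>_. 1) z"
    and ex: "\<forall>z\<in>I. \<forall>l. (first_order (\<lambda>z. \<delta> z * (l * 1)) ^^ n) (\<lambda>z. l * 1) z = l * (\<Sum>i\<le>n. e i z * l ^ i)"
    using scale_expansion[OF assms(1,2) smooth_on_const[of I 1], of n] by blast
  obtain k where k: "n = Suc k" using assms(4) by (cases n) auto
  have "(deriv ^^ n) (poly 1) z = 0" by (rule deriv_iterate_poly_zero) (use assms(4) in simp)
  moreover have "poly 1 = (\<lambda>_::real. 1)" by (simp add: fun_eq_iff)
  ultimately have e0: "e 0 z = 0" using e0 assms(3) by simp
  let ?b = "\<Sum>i\<le>k. monom (e (Suc i) z) i"
  show ?thesis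
  proof (rule that[of ?b])
    fix w
    have "(Omega (\<lambda>(z, w). \<delta> z * w) (\<lambda>_. w) ^^ n) (\<lambda>_. w) z = w * (\<Sum>i\<le>n. e i z * w ^ i)"
      using ex assms(3) unfolding Omega_eq_first_order by simp
    also have "(\<Sum>i\<le>n. e i z * w ^ i) = w * (\<Sum>i\<le>k. e (Suc i) z * w ^ i)"
      unfolding k sum.atMost_Suc_shift e0 sum_distrib_left by (simp add: algebra_simps)
    also have "(\<Sum>i\<le>k. e (Suc i) z * w ^ i) = poly ?b w" by (simp add: poly_sum poly_monom)
    finally show "(Omega (\<lambda>(z, w). \<delta> z * w) (\<lambda>_. w) ^^ n) (\<lambda>_. w) z = w ^ 2 * poly ?b w"
      by (simp add: power2_eq_square)
  qed
qed

text \<open>Dividing by the leading coefficient of the denominator normalises k4 to 0 or 1; the constant r0 collects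
what this division, the sign of the denominator and the fractional power leave over.\<close>

lemma moebius_normal_form:
  assumes "open U" "connected U" "U \<noteq> {}" "q \<noteq> 0"
    and \<rho>: "\<And>z w. (z, w) \<in> U \<Longrightarrow> c * z + d \<noteq> 0 \<and> \<rho> (z, w) = (a * z + b) / (c * z + d)"
    and \<psi>: "\<And>z w. (z, w) \<in> U \<Longrightarrow> \<psi> (z, w) = q * w / (c * z + d) ^ (n - 1)"
    and nz: "\<And>p. p \<in> U \<Longrightarrow> pd1 \<rho> p \<noteq> 0"
  obtains k1 k2 k3 k4 r0 where "projective_form n U k1 k2 k3 k4 r0 \<rho> \<psi>"
proof -
  define t where "t = (if c = 0 then 1 else c)"
  define k1 where "k1 = b / t"
  define k2 where "k2 = a / t"
  define k3 where "k3 = d / t"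
  define k4 where "k4 = c / t"
  have t: "t \<noteq> 0" by (simp add: t_def)
  have k4: "k4 = 0 \<or> k4 = 1" by (simp add: k4_def t_def)
  have s: "k4 * z + k3 = (c * z + d) / t" "k2 * z + k1 = (a * z + b) / t" for z
    by (simp_all add: k1_def k2_def k3_def k4_def add_divide_distrib)
  have \<rho>': "k4 * z + k3 \<noteq> 0 \<and> \<rho> (z, w) = (k2 * z + k1) / (k4 * z + k3)" if "(z, w) \<in> U" for z w
    unfolding s using \<rho>[OF that] t by simp
  obtain z0 w0 where zw0: "(z0, w0) \<in> U" using assms(3) by auto
  have \<Delta>: "k2 * k3 - k1 * k4 \<noteq> 0"
    using nz[OF zw0] pd1_moebius[OF assms(1) zw0 \<rho>'] by auto
  have cont: "continuous_on U (\<lambda>p. k4 * fst p + k3)" by (intro continuous_intros)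
  obtain \<epsilon> where \<epsilon>: "\<epsilon> \<noteq> 0" "\<And>p. p \<in> U \<Longrightarrow> \<bar>k4 * fst p + k3\<bar> = \<epsilon> * (k4 * fst p + k3)"
    by (rule sign_constant[OF assms(2) cont]) (use \<rho>' in force)+
  define H where "H = half_pow (k2 * k3 - k1 * k4) (n - 1)"
  have H: "H \<noteq> 0" using half_pow_nonzero[OF \<Delta>] by (simp add: H_def)
  define r0 where "r0 = q * \<epsilon> ^ (n - 1) / (t ^ (n - 1) * H)"
  have r0: "r0 \<noteq> 0" using assms(4) \<epsilon> t H by (simp add: r0_def)
  have \<psi>': "\<psi> (z, w) = r0 * half_pow (pd1 \<rho> (z, w)) (n - 1) * w" if zw: "(z, w) \<in> U" for z w
  proof -
    have abs: "\<bar>k4 * z + k3\<bar> = \<epsilon> * (k4 * z + k3)" using \<epsilon>(2)[OF zw] by simp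
    have nz0: "(c * z + d) \<noteq> 0" using \<rho>[OF zw] by simp
    have pd: "pd1 \<rho> (z, w) = (k2 * k3 - k1 * k4) / (k4 * z + k3) ^ 2"
      by (rule pd1_moebius[OF assms(1) zw \<rho>'])
    have "half_pow (pd1 \<rho> (z, w)) (n - 1) = H / (\<epsilon> * ((c * z + d) / t)) ^ (n - 1)"
      unfolding pd half_pow_divide_square[OF conjunct1[OF \<rho>'[OF zw]]] abs H_def
      unfolding s ..
    then show ?thesis unfolding \<psi>[OF zw] r0_def using \<epsilon>(1) t H nz0
      by (simp add: power_mult_distrib power_divide)
  qed
  have "projective_form n U k1 k2 k3 k4 r0 \<rho> \<psi>"
    unfolding projective_form_def using k4 \<Delta> r0 \<rho>' \<psi>' by blast
  then show ?thesis by (rule that)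
qed

lemma open_real_prod_ball:
  assumes "open (S :: (real \<times> real) set)" "(a, b) \<in> S"
  obtains r where "r > 0" "ball a r \<times> ball b r \<subseteq> S"
proof -
  obtain A B where AB: "open A" "open B" "(a, b) \<in> A \<times> B" "A \<times> B \<subseteq> S"
    by (rule open_prod_elim[OF assms])
  obtain r1 where r1: "r1 > 0" "ball a r1 \<subseteq> A" using AB open_contains_ball by blast
  obtain r2 where r2: "r2 > 0" "ball b r2 \<subseteq> B" using AB open_contains_ball by blast
  have "ball a (min r1 r2) \<times> ball b (min r1 r2) \<subseteq> S"
    using r1 r2 AB(4) by fastforce
  then show ?thesis using that r1 r2 by (meson min_less_iff_conj)
qed

lemma Omega_zero_parameter: "(Omega (\<lambda>(x, y). 0 * y) Y ^^ n) Y = (deriv ^^ n) Y"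
proof -
  have "first_order (\<lambda>_. 0) = deriv" by (simp add: fun_eq_iff first_order_def)
  then show ?thesis unfolding Omega_eq_first_order by simp
qed

lemma infinite_open_real:
  assumes "open (S :: real set)" "S \<noteq> {}"
  shows "infinite S"
proof -
  obtain y where "y \<in> S" using assms by auto
  then obtain e where "e > 0" "ball y e \<subseteq> S" using assms(1) open_contains_ball by blast
  then show ?thesis using infinite_ball_real finite_subset by blast
qed

text \<open>The local situation once \<rho> is known to depend on z alone: on a product of intervals, \<rho> is a function r of z
and \<psi>(z, \<cdot>) has the inverse \<phi>(z, \<cdot>). The shift c keeps r + c away from zero, so that its powers can be
scaled freely.\<close>

locale fibred_chart =
  fixes n :: nat and D :: "(real \<times> real) set" and \<rho> \<psi> :: "real \<times> real \<Rightarrow> real"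
    and I K :: "real set" and r :: "real \<Rightarrow> real" and c :: real and \<phi> :: "real \<times> real \<Rightarrow> real"
  assumes n: "n \<ge> 2" and D: "open D" and G: "(\<rho>, \<psi>) \<in> G n D"
    and I: "open I" "is_interval I" "I \<noteq> {}" and K: "open K" "is_interval K" "K \<noteq> {}"
    and rc: "\<And>z. z \<in> I \<Longrightarrow> r z + c \<noteq> 0"
    and r: "smooth_on I r" and r': "\<And>z. z \<in> I \<Longrightarrow> deriv r z \<noteq> 0"
    and \<phi>: "smooth_on (I \<times> K) \<phi>"
    and chart: "\<And>z y. z \<in> I \<Longrightarrow> y \<in> K \<Longrightarrow> (z, \<phi> (z, y)) \<in> D \<and> \<psi> (z, \<phi> (z, y)) = y \<and>
      \<rho> (z, \<phi> (z, y)) = r z \<and> pd1 \<rho> (z, \<phi> (z, y)) = deriv r z \<and> pd2 \<rho> (z, \<phi> (z, y)) = 0 \<and>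
      pd2 \<psi> (z, \<phi> (z, y)) \<noteq> 0 \<and>
      ((\<lambda>t. \<phi> (z, t)) has_real_derivative 1 / pd2 \<psi> (z, \<phi> (z, y))) (at y)"
begin

lemma open_chart: "open (I \<times> K)" by (intro open_Times I K)

lemma infinite_I: "infinite I" and infinite_K: "infinite K"
  by (rule infinite_open_real[OF I(1,3)], rule infinite_open_real[OF K(1,3)])

lemma chart_base_subset: "I \<subseteq> fst ` D"
proof
  fix z assume "z \<in> I"
  moreover obtain y where "y \<in> K" using K by auto
  ultimately have "(z, \<phi> (z, y)) \<in> D" using chart by blast
  then show "z \<in> fst ` D" by force
qed

text \<open>Starting from a solution y = Y(x) of the equation with F = 0, the curve w = \<phi>(z, Y(r(z))) corresponds to it and
therefore solves the transformed equation. Working with prescribed y avoids any inversion of the change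
of the independent variable.\<close>

lemma lifted_solution:
  assumes Q0: "transformed_parameter n D \<rho> \<psi> (\<lambda>(x, y). 0 * y) Q0"
    and Y: "smooth_on UNIV Y" and z1: "z1 \<in> I" "Y (r z1) \<in> K" and 0: "(deriv ^^ n) Y (r z1) = 0"
  shows "(Omega Q0 (\<lambda>z. \<phi> (z, Y (r z))) ^^ n) (\<lambda>z. \<phi> (z, Y (r z))) z1 = 0"
proof -
  let ?w = "\<lambda>z. \<phi> (z, Y (r z))"
  have sY: "smooth_on I (\<lambda>z. Y (r z))" by (rule smooth_on_compose[OF I(1) r Y]) simp
  have "open (I \<inter> (\<lambda>z. Y (r z)) -` K)"
    by (rule continuous_open_preimage[OF smooth_on_continuous[OF sY] I(1) K(1)])
  moreover have "z1 \<in> I \<inter> (\<lambda>z. Y (r z)) -` K" using z1 by simp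
  ultimately obtain e where e: "e > 0" "ball z1 e \<subseteq> I \<inter> (\<lambda>z. Y (r z)) -` K"
    using open_contains_ball by blast
  have in_I: "z \<in> I" "Y (r z) \<in> K" if "z \<in> ball z1 e" for z using e that by auto
  have sw: "smooth_on (ball z1 e) ?w"
    by (rule smooth_on_along_curve[OF open_ball \<phi> smooth_on_subset[OF sY]]) (use in_I in auto)
  have "corresponding_curves D \<rho> \<psi> (ball z1 e) ?w Y"
    unfolding corresponding_curves_def
  proof (intro conjI ballI open_ball is_interval_ball_real sw)
    show "smooth_on ((\<lambda>z. \<rho> (z, ?w z)) ` ball z1 e) Y" by (rule smooth_on_subset[OF Y]) simp
    fix z assume z: "z \<in> ball z1 e"
    note ch = chart[OF in_I[OF z]]
    show "(z, ?w z) \<in> D" "Y (\<rho> (z, ?w z)) = \<psi> (z, ?w z)" using ch by auto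
    have "deriv (\<lambda>t. \<rho> (t, ?w t)) z = deriv r z"
      using deriv_iterate_cong[OF open_ball _ z, of "\<lambda>t. \<rho> (t, ?w t)" r 1] chart in_I by simp
    then show "deriv (\<lambda>t. \<rho> (t, ?w t)) z \<noteq> 0" using r' in_I z by simp
  qed
  from transformed_parameter_zero_iff[OF Q0 this, of z1] show ?thesis
    using chart[OF z1] 0 e(1) unfolding Omega_zero_parameter by simp
qed

text \<open>The affine functions Y(x) = e + s x are solutions for every s. By slope_expansion the transformed equation
is a polynomial identity in s, whose top coefficient is a nonzero multiple of the n-th derivative of \<phi> in y.\<close>

lemma inverse_polynomial_in_fibre:
  assumes z: "z \<in> I" and y: "y \<in> K"
  shows "(deriv ^^ n) (\<lambda>t. \<phi> (z, t)) y = 0"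
proof -
  obtain \<delta>0 where Q0: "transformed_parameter n D \<rho> \<psi> (\<lambda>(x, y). 0 * y) (\<lambda>(z, w). \<delta>0 z * w)"
    by (rule G_linear_parameter[OF G smooth_on_const])
  let ?Q = "\<lambda>(z, w). \<delta>0 z * w"
  have "\<exists>c. (\<forall>i. smooth_on (I \<times> K) (c i)) \<and>
    (\<forall>p\<in>I \<times> K. c n p = deriv r (fst p) ^ n * (pd2 ^^ n) \<phi> p) \<and>
    (\<forall>e s z. (z, e + s * r z) \<in> I \<times> K \<longrightarrow>
      (first_order (\<lambda>z. ?Q (z, \<phi> (z, e + s * r z))) ^^ n) (\<lambda>z. \<phi> (z, e + s * r z)) z =
      (\<Sum>i\<le>n. c i (z, e + s * r z) * s ^ i))"
    by (rule slope_expansion[OF I(1) open_chart _ r \<phi> transformed_parameter_smooth[OF Q0]])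
      (use chart in auto)
  then obtain c where c_all: "(\<forall>i. smooth_on (I \<times> K) (c i)) \<and>
    (\<forall>p\<in>I \<times> K. c n p = deriv r (fst p) ^ n * (pd2 ^^ n) \<phi> p) \<and>
    (\<forall>e s z. (z, e + s * r z) \<in> I \<times> K \<longrightarrow>
      (first_order (\<lambda>z. ?Q (z, \<phi> (z, e + s * r z))) ^^ n) (\<lambda>z. \<phi> (z, e + s * r z)) z =
      (\<Sum>i\<le>n. c i (z, e + s * r z) * s ^ i))" by (rule exE)
  note top = c_all[THEN conjunct2, THEN conjunct1, rule_format]
    and ex = c_all[THEN conjunct2, THEN conjunct2, rule_format]
  let ?p = "\<Sum>i\<le>n. monom (c i (z, y)) i"
  have "poly ?p s = 0" for s
  proof -
    define e where "e = y - s * r z"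
    have ez: "e + s * r z = y" by (simp add: e_def)
    have Yp: "(\<lambda>x. e + s * x) = poly [:e, s:]" by (auto simp: mult.commute)
    have sY: "smooth_on UNIV (\<lambda>x. e + s * x)" by (intro smooth_intros open_UNIV)
    have "(deriv ^^ n) (\<lambda>x. e + s * x) (r z) = 0"
      unfolding Yp by (rule deriv_iterate_poly_zero) (use n in auto)
    from lifted_solution[OF Q0 sY z _ this]
    have "(Omega ?Q (\<lambda>z. \<phi> (z, e + s * r z)) ^^ n) (\<lambda>z. \<phi> (z, e + s * r z)) z = 0"
      using y ez by simp
    then have "(\<Sum>i\<le>n. c i (z, e + s * r z) * s ^ i) = 0"
      using ex[of z e s] z y ez unfolding Omega_eq_first_order by simp
    then show ?thesis unfolding ez by (simp add: poly_sum poly_monom)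
  qed
  then have "?p = 0" using poly_eq_on_infinite[of UNIV ?p 0] by (simp add: infinite_UNIV_char_0)
  then have "coeff ?p n = 0" by simp
  then have "c n (z, y) = 0" by (simp add: coeff_sum coeff_monom)
  then show ?thesis using top[of "(z, y)"] z y r'[OF z] by (simp add: pd2_iterate_slice)
qed

text \<open>The pulse identity on constant curves w, written in terms of the polynomial a = \<phi>(z, \<cdot>), is the hypothesis
of linear_of_composition_identity, because \<psi>_w is the reciprocal of a'(y).\<close>

lemma inverse_linear_in_fibre:
  assumes z: "z \<in> I"
  obtains k where "k \<noteq> 0" "\<And>y. y \<in> K \<Longrightarrow> \<phi> (z, y) = k * y"
proof -
  have sB: "smooth_on K (\<lambda>t. \<phi> (z, t))"
    by (rule smooth_on_compose[OF K(1) smooth_on_Pair[OF K(1) smooth_on_const smooth_on_id[OF K(1)]] \<phi>])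
      (use z in auto)
  obtain a where a: "\<And>y. y \<in> K \<Longrightarrow> \<phi> (z, y) = poly a y"
    by (rule deriv_iterate_zero_imp_poly[OF K(1,2) sB inverse_polynomial_in_fibre[OF z]], assumption, rule that)
  obtain \<delta>0 \<delta>1 where d: "smooth_on (fst ` D) \<delta>0" "smooth_on (fst ` D) \<delta>1"
    and Q0: "transformed_parameter n D \<rho> \<psi> (\<lambda>(x, y). 0 * y) (\<lambda>(z, w). \<delta>0 z * w)"
    and Q1: "transformed_parameter n D \<rho> \<psi> (\<lambda>(x, y). (x - r z) ^ (n - 1) * y) (\<lambda>(z, w). \<delta>1 z * w)"
    by (rule G_pulse_parameters[OF G])
  have zD: "z \<in> fst ` D" using z chart_base_subset by auto
  have n1: "n \<ge> 1" using n by simp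
  obtain b0 where b0: "\<And>w. (Omega (\<lambda>(z, w). \<delta>0 z * w) (\<lambda>_. w) ^^ n) (\<lambda>_. w) z = w ^ 2 * poly b0 w"
    by (rule Omega_iterate_const_poly[OF open_image_fst[OF D] d(1) zD n1]) (rule that)
  obtain b1 where b1: "\<And>w. (Omega (\<lambda>(z, w). \<delta>1 z * w) (\<lambda>_. w) ^^ n) (\<lambda>_. w) z = w ^ 2 * poly b1 w"
    by (rule Omega_iterate_const_poly[OF open_image_fst[OF D] d(2) zD n1]) (rule that)
  have pt: "smooth_on D \<rho>" "smooth_on D \<psi>"
    using G_point_transformation[OF G] by (auto simp: point_transformation_def)
  have da: "poly (pderiv a) y = 1 / pd2 \<psi> (z, \<phi> (z, y))" if y: "y \<in> K" for y
  proof (rule DERIV_unique)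
    show "((\<lambda>t. \<phi> (z, t)) has_real_derivative 1 / pd2 \<psi> (z, \<phi> (z, y))) (at y)"
      using chart[OF z] y by blast
    show "((\<lambda>t. \<phi> (z, t)) has_real_derivative poly (pderiv a) y) (at y)"
      by (rule has_field_derivative_transform_within_open[OF poly_DERIV K(1) y]) (use a in auto)
  qed
  define C where "C = fact (n - 1) * deriv r z ^ n"
  have C: "C \<noteq> 0" using r'[OF z] by (simp add: C_def)
  have "smult C ([:0, 0, 1:] * pderiv a) = a ^ 2 * pcompose (b1 - b0) a"
  proof (rule poly_eq_on_infinite[OF infinite_K])
    fix y assume y: "y \<in> K"
    note ch = chart[OF z y]
    let ?p = "(z, \<phi> (z, y))"
    have l: "(\<lambda>t. \<phi> (z, y) + 0 * (t - z)) = (\<lambda>_. \<phi> (z, y))" by simp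
    have nz: "pd1 \<rho> ?p + pd2 \<rho> ?p * 0 \<noteq> 0" using ch r'[OF z] by simp
    have Q1': "transformed_parameter n D \<rho> \<psi> (\<lambda>(x, y). (x - \<rho> ?p) ^ (n - 1) * y) (\<lambda>(z, w). \<delta>1 z * w)"
      using Q1 ch by simp
    have "fact (n - 1) * \<psi> ?p ^ 2 * (pd1 \<rho> ?p + pd2 \<rho> ?p * 0) ^ Suc n =
      (pd1 \<rho> ?p * pd2 \<psi> ?p - pd2 \<rho> ?p * pd1 \<psi> ?p) *
        (\<phi> (z, y) ^ 2 * poly b1 (\<phi> (z, y)) - \<phi> (z, y) ^ 2 * poly b0 (\<phi> (z, y)))"
      using parameter_pulse[OF n D pt _ refl nz Q0 Q1'] ch unfolding l b0 b1 by simp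
    then have "fact (n - 1) * y ^ 2 * deriv r z ^ Suc n =
      deriv r z * pd2 \<psi> ?p * (\<phi> (z, y) ^ 2 * poly (b1 - b0) (\<phi> (z, y)))"
      using ch by (simp add: right_diff_distrib)
    then have "deriv r z * (C * y ^ 2) =
        deriv r z * (pd2 \<psi> ?p * (\<phi> (z, y) ^ 2 * poly (b1 - b0) (\<phi> (z, y))))"
      unfolding C_def by (simp only: power_Suc mult_ac)
    then have *: "C * y ^ 2 = pd2 \<psi> ?p * (\<phi> (z, y) ^ 2 * poly (b1 - b0) (\<phi> (z, y)))"
      using mult_left_cancel[OF r'[OF z]] by blast
    have "poly (smult C ([:0, 0, 1:] * pderiv a)) y = C * y ^ 2 * (1 / pd2 \<psi> ?p)"
      unfolding da[OF y, symmetric] by (simp add: power2_eq_square)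
    also have "\<dots> = \<phi> (z, y) ^ 2 * poly (b1 - b0) (\<phi> (z, y))" unfolding * using ch by simp
    also have "\<dots> = poly (a ^ 2 * pcompose (b1 - b0) a) y"
      unfolding a[OF y] by (simp add: poly_pcompose)
    finally show "poly (smult C ([:0, 0, 1:] * pderiv a)) y = poly (a ^ 2 * pcompose (b1 - b0) a) y" .
  qed
  moreover have "pderiv a \<noteq> 0"
  proof -
    obtain y where "y \<in> K" using K by auto
    then show ?thesis using da[of y] chart[OF z, of y] by auto
  qed
  ultimately obtain c where c: "c \<noteq> 0" "a = [:0, c:]"
    using linear_of_composition_identity[OF C] by metis
  show ?thesis by (rule that[OF c(1)]) (use a c(2) in \<open>simp add: mult.commute\<close>)
qed

lemma fibre_factor:
  obtains g where "smooth_on I g" "\<And>z. z \<in> I \<Longrightarrow> g z \<noteq> 0"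
    "\<And>z y. z \<in> I \<Longrightarrow> y \<in> K \<Longrightarrow> \<phi> (z, y) = g z * y"
proof -
  obtain y where y: "y \<in> K" "y \<noteq> 0"
    using infinite_K by (metis finite.emptyI finite_insert finite_subset insertI1 subsetI singletonD)
  define g where "g z = \<phi> (z, y) / y" for z
  have "smooth_on I (\<lambda>z. \<phi> (z, y))"
    by (rule smooth_on_compose[OF I(1) smooth_on_Pair[OF I(1) smooth_on_id[OF I(1)] smooth_on_const] \<phi>])
      (use y in auto)
  then have sg: "smooth_on I g"
    unfolding g_def by (intro smooth_on_divide I smooth_on_const) (use y in auto)
  have g: "g z \<noteq> 0 \<and> (\<forall>y'\<in>K. \<phi> (z, y') = g z * y')" if z: "z \<in> I" for z
  proof -
    obtain k where k: "k \<noteq> 0" "\<And>y. y \<in> K \<Longrightarrow> \<phi> (z, y) = k * y"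
      using inverse_linear_in_fibre[OF z] by blast
    have "g z = k" using k(2)[OF y(1)] y(2) by (simp add: g_def)
    then show ?thesis using k by simp
  qed
  show ?thesis by (rule that[OF sg]) (use g in auto)
qed

text \<open>Scaling the solutions (x + c)^i of the equation with F = 0 by l gives the curves w = l g (r + c)^i. Since the
transformed equation holds for infinitely many l, its part linear in l vanishes, and by scale_expansion this
part is the n-th derivative.\<close>

lemma factor_power_polynomial:
  assumes g: "smooth_on I g" "\<And>z y. z \<in> I \<Longrightarrow> y \<in> K \<Longrightarrow> \<phi> (z, y) = g z * y"
    and i: "i < n"
  obtains P where "degree P < n" "\<And>z. z \<in> I \<Longrightarrow> g z * (r z + c) ^ i = poly P z"
proof -
  obtain \<delta>0 where d: "smooth_on (fst ` D) \<delta>0"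
    and Q0: "transformed_parameter n D \<rho> \<psi> (\<lambda>(x, y). 0 * y) (\<lambda>(z, w). \<delta>0 z * w)"
    by (rule G_linear_parameter[OF G smooth_on_const])
  let ?Q = "\<lambda>(z, w). \<delta>0 z * w"
  define v where "v z = g z * (r z + c) ^ i" for z
  have sv: "smooth_on I v" unfolding v_def by (intro smooth_intros I g r)
  have "(deriv ^^ n) v z1 = 0" if z1: "z1 \<in> I" for z1
  proof -
    obtain e where e0: "\<forall>z\<in>I. e 0 z = (deriv ^^ n) v z"
      and ex: "\<forall>z\<in>I. \<forall>l. (first_order (\<lambda>z. \<delta>0 z * (l * v z)) ^^ n) (\<lambda>z. l * v z) z =
        l * (\<Sum>i\<le>n. e i z * l ^ i)"
      using scale_expansion[OF I(1) smooth_on_subset[OF d chart_base_subset] sv, of n] by blast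
    let ?p = "\<Sum>i\<le>n. monom (e i z1) i"
    \<comment> \<open>The admissible scalings: those for which the solution passes through the chart at z1.\<close>
    define L where "L = (\<lambda>y. y / (r z1 + c) ^ i) ` (K - {0})"
    have L: "infinite L"
      unfolding L_def
    proof
      assume "finite ((\<lambda>y. y / (r z1 + c) ^ i) ` (K - {0}))"
      moreover have "inj_on (\<lambda>y. y / (r z1 + c) ^ i) (K - {0})"
        using rc[OF z1] by (auto intro: inj_onI)
      ultimately have "finite (K - {0})" by (rule finite_imageD)
      then show False using infinite_K by simp
    qed
    have "poly ?p l = poly 0 l" if l: "l \<in> L" for l
    proof -
      obtain y where y: "y \<in> K" "y \<noteq> 0" "l = y / (r z1 + c) ^ i" using l by (auto simp: L_def)
      then have l0: "l \<noteq> 0" "l * (r z1 + c) ^ i = y" using rc[OF z1] by auto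
      define Y where "Y x = l * (x + c) ^ i" for x
      have Yp: "Y = poly (smult l ([:c, 1:] ^ i))" by (auto simp: Y_def add.commute)
      have sY: "smooth_on UNIV Y" unfolding Y_def by (intro smooth_intros open_UNIV)
      have "(deriv ^^ n) Y (r z1) = 0"
        unfolding Yp
        by (rule deriv_iterate_poly_zero)
          (use i in \<open>auto intro!: le_less_trans[OF degree_smult_le] simp: degree_power_eq\<close>)
      then have z: "(Omega ?Q (\<lambda>z. \<phi> (z, Y (r z))) ^^ n) (\<lambda>z. \<phi> (z, Y (r z))) z1 = 0"
        by (intro lifted_solution[OF Q0 sY z1]) (use y l0 in \<open>auto simp: Y_def\<close>)
      have sYr: "smooth_on I (\<lambda>z. Y (r z))" by (rule smooth_on_compose[OF I(1) r sY]) simp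
      define N where "N = I \<inter> (\<lambda>z. Y (r z)) -` K"
      have N: "open N" unfolding N_def
        by (rule continuous_open_preimage[OF smooth_on_continuous[OF sYr] I(1) K(1)])
      have z1N: "z1 \<in> N" using z1 y l0 by (auto simp: N_def Y_def)
      have eq: "\<phi> (z, Y (r z)) = l * v z" if "z \<in> N" for z
        using that g(2)[of z "Y (r z)"] by (simp add: N_def Y_def v_def)
      have "(first_order (\<lambda>z. \<delta>0 z * \<phi> (z, Y (r z))) ^^ n) (\<lambda>z. \<phi> (z, Y (r z))) z1 =
          (first_order (\<lambda>z. \<delta>0 z * (l * v z)) ^^ n) (\<lambda>z. l * v z) z1"
        by (rule first_order_iterate_cong[OF N _ _ z1N]) (simp_all add: eq)
      then have "l * (\<Sum>i\<le>n. e i z1 * l ^ i) = 0"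
        using z ex z1 unfolding Omega_eq_first_order by simp
      then show ?thesis using l0(1) by (simp add: poly_sum poly_monom)
    qed
    then have "?p = 0" by (rule poly_eq_on_infinite[OF L])
    then have "coeff ?p 0 = 0" by simp
    then have "e 0 z1 = 0" by (simp add: coeff_sum coeff_monom)
    then show ?thesis using e0 z1 by simp
  qed
  then obtain P where P: "\<And>i. i \<ge> n \<Longrightarrow> coeff P i = 0" "\<And>z. z \<in> I \<Longrightarrow> v z = poly P z"
    using deriv_iterate_zero_imp_poly[OF I(1,2) sv] by blast
  have "degree P < n"
  proof (rule ccontr)
    assume "\<not> degree P < n"
    then have "lead_coeff P = 0" using P(1) by simp
    then have "degree P = 0" by simp
    then show False using \<open>\<not> degree P < n\<close> n by simp
  qed
  then show ?thesis using P(2) that unfolding v_def by blast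
qed

text \<open>With g, g (r + c) and g (r + c)^(n-1) polynomial, r + c is a quotient A/B of affine functions and g is a
constant multiple of B^(n-1).\<close>

lemma chart_projective:
  assumes U: "open U" "connected U" "U \<noteq> {}"
    and in_chart: "\<And>z w. (z, w) \<in> U \<Longrightarrow> z \<in> I \<and> \<psi> (z, w) \<in> K \<and> \<phi> (z, \<psi> (z, w)) = w"
  obtains k1 k2 k3 k4 r0 where "projective_form n U k1 k2 k3 k4 r0 \<rho> \<psi>"
proof -
  obtain g where g: "smooth_on I g" "\<And>z. z \<in> I \<Longrightarrow> g z \<noteq> 0"
    "\<And>z y. z \<in> I \<Longrightarrow> y \<in> K \<Longrightarrow> \<phi> (z, y) = g z * y"
    by (rule fibre_factor) (rule that)
  note pw = factor_power_polynomial[OF g(1,3)]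
  obtain P0 where P0: "degree P0 < n" "\<And>z. z \<in> I \<Longrightarrow> g z * (r z + c) ^ 0 = poly P0 z"
    by (rule pw[of 0]) (use n in auto)
  obtain P1 where P1: "degree P1 < n" "\<And>z. z \<in> I \<Longrightarrow> g z * (r z + c) ^ 1 = poly P1 z"
    by (rule pw[of 1]) (use n in auto)
  obtain Pn where Pn: "degree Pn < n" "\<And>z. z \<in> I \<Longrightarrow> g z * (r z + c) ^ (n - 1) = poly Pn z"
    by (rule pw[of "n - 1"]) (use n in auto)
  obtain z0 where z0: "z0 \<in> I" using I by auto
  have nz: "P0 \<noteq> 0" using P0(2)[OF z0] g(2)[OF z0] by auto
  have eq: "P0 ^ (n - 2) * Pn = P1 ^ (n - 1)"
  proof (rule poly_eq_on_infinite[OF infinite_I])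
    fix z assume z: "z \<in> I"
    obtain k where k: "n = Suc (Suc k)" using n by (metis add_2_eq_Suc le_Suc_ex)
    have "poly P0 z = g z" "poly P1 z = g z * (r z + c)" "poly Pn z = g z * (r z + c) ^ Suc k"
      using P0(2)[OF z] P1(2)[OF z] Pn(2)[OF z] by (simp_all add: k)
    then show "poly (P0 ^ (n - 2) * Pn) z = poly (P1 ^ (n - 1)) z"
      by (simp add: k power_mult_distrib mult_ac)
  qed
  have nc: "P1 \<noteq> smult k P0" for k
  proof
    assume "P1 = smult k P0"
    have "r z + c = k" if z: "z \<in> I" for z
    proof -
      have "g z * (r z + c) = g z * k"
        using P0(2)[OF z] P1(2)[OF z] \<open>P1 = smult k P0\<close> by (simp add: mult.commute)
      then show ?thesis using g(2)[OF z] by simp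
    qed
    then have "r z = k - c" if "z \<in> I" for z using that by (simp add: eq_diff_eq)
    then have "deriv r z0 = deriv (\<lambda>_. k - c) z0"
      using deriv_iterate_cong[OF I(1) _ z0, of r "\<lambda>_. k - c" 1] by simp
    then show False using r'[OF z0] by simp
  qed
  obtain A B h where AB: "degree A \<le> 1" "degree B \<le> 1" "h \<noteq> 0" "P0 = smult h (B ^ (n - 1))"
    "P1 * B = P0 * A" "B \<noteq> 0"
    by (rule rational_function_with_power[OF n nz P0(1) Pn(1) eq nc])
  have lin: "\<exists>a b. \<forall>z. poly p z = a * z + b" if "degree p \<le> 1" for p :: "real poly"
  proof -
    have "poly p z = poly [:coeff p 0, coeff p 1:] z" for z
      using poly_degree_le_1[OF that] by simp
    then have "poly p z = coeff p 1 * z + coeff p 0" for z by (simp add: mult.commute)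
    then show ?thesis by blast
  qed
  obtain \<alpha>1 \<alpha>0 where A: "\<And>z. poly A z = \<alpha>1 * z + \<alpha>0" using lin[OF AB(1)] by blast
  obtain \<beta>1 \<beta>0 where B: "\<And>z. poly B z = \<beta>1 * z + \<beta>0" using lin[OF AB(2)] by blast
  have gB: "g z = h * (\<beta>1 * z + \<beta>0) ^ (n - 1)" if z: "z \<in> I" for z
    using P0(2)[OF z] unfolding AB(4) by (simp add: B)
  have Bz: "\<beta>1 * z + \<beta>0 \<noteq> 0" if z: "z \<in> I" for z
    using gB[OF z] g(2)[OF z] n by auto
  have rz: "r z = ((\<alpha>1 - c * \<beta>1) * z + (\<alpha>0 - c * \<beta>0)) / (\<beta>1 * z + \<beta>0)" if z: "z \<in> I" for z
  proof -
    have "poly P1 z * poly B z = poly P0 z * poly A z" using AB(5) by (metis poly_mult)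
    then have "g z * (r z + c) * (\<beta>1 * z + \<beta>0) = g z * (\<alpha>1 * z + \<alpha>0)"
      using P0(2)[OF z] P1(2)[OF z] by (simp add: A B)
    then have "(r z + c) * (\<beta>1 * z + \<beta>0) = \<alpha>1 * z + \<alpha>0" using g(2)[OF z] by simp
    then show ?thesis using Bz[OF z] by (simp add: eq_divide_eq algebra_simps)
  qed
  show ?thesis
  proof (rule moebius_normal_form[OF U, of "1 / h"])
    show "1 / h \<noteq> 0" using AB(3) by simp
    show "\<beta>1 * z + \<beta>0 \<noteq> 0 \<and> \<rho> (z, w) =
        ((\<alpha>1 - c * \<beta>1) * z + (\<alpha>0 - c * \<beta>0)) / (\<beta>1 * z + \<beta>0)" if "(z, w) \<in> U" for z w
      using in_chart[OF that] chart[of z "\<psi> (z, w)"] rz Bz by auto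
    show "\<psi> (z, w) = 1 / h * w / (\<beta>1 * z + \<beta>0) ^ (n - 1)" if zw: "(z, w) \<in> U" for z w
    proof -
      have z: "z \<in> I" using in_chart[OF zw] by simp
      have "w = h * (\<beta>1 * z + \<beta>0) ^ (n - 1) * \<psi> (z, w)"
        using in_chart[OF zw] g(3)[OF z, of "\<psi> (z, w)"] gB[OF z] by simp
      then show ?thesis using Bz[OF z] AB(3) by (simp add: field_simps)
    qed
    show "pd1 \<rho> p \<noteq> 0" if "p \<in> U" for p
    proof -
      obtain z w where e: "p = (z, w)" by (cases p)
      show ?thesis
        using in_chart[of z w] chart[of z "\<psi> (z, w)"] r'[of z] that unfolding e by auto
    qed
  qed (rule that)
qed

end

text \<open>A fibred chart exists around every point: \<rho> has vanishing w-derivative, so it depends on z alone on a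
rectangle, and the Jacobian condition makes \<psi> invertible in w.\<close>

lemma G_locally_projective:
  assumes n: "n \<ge> 2" and D: "open D" and G: "(\<rho>, \<psi>) \<in> G n D" and p0: "p0 \<in> D"
  obtains U k1 k2 k3 k4 r0 where "open U" "connected U" "p0 \<in> U" "U \<subseteq> D"
    "projective_form n U k1 k2 k3 k4 r0 \<rho> \<psi>"
proof -
  have pt: "smooth_on D \<rho>" "smooth_on D \<psi>"
    and J: "\<And>p. p \<in> D \<Longrightarrow> pd1 \<rho> p * pd2 \<psi> p - pd2 \<rho> p * pd1 \<psi> p \<noteq> 0"
    using G_point_transformation[OF G] by (auto simp: point_transformation_def)
  note fc = G_rho_fibre_constant[OF n D G]
  have nz: "pd1 \<rho> p \<noteq> 0" "pd2 \<psi> p \<noteq> 0" if "p \<in> D" for p using J[OF that] fc[OF that] by auto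
  obtain z0 w0 where e: "p0 = (z0, w0)" by (cases p0)
  have zw: "(z0, w0) \<in> D" using p0 e by simp
  obtain \<epsilon> where \<epsilon>: "\<epsilon> > 0" "ball z0 \<epsilon> \<times> ball w0 \<epsilon> \<subseteq> D" by (rule open_real_prod_ball[OF D zw])
  let ?Z = "ball z0 \<epsilon>" and ?W = "ball w0 \<epsilon>"
  define B where "B = ?Z \<times> ?W"
  have B: "open B" "B \<subseteq> D" "(z0, w0) \<in> B" using \<epsilon> by (auto simp: B_def intro: open_Times)
  define r where "r z = \<rho> (z, w0)" for z
  have Br: "\<rho> (z, w) = r z" if "(z, w) \<in> B" for z w
  proof -
    have "((\<lambda>t. \<rho> (z, t)) has_derivative (\<lambda>h. 0)) (at t within ?W)" if "t \<in> ?W" for t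
    proof -
      have zt: "(z, t) \<in> D" using \<open>(z, w) \<in> B\<close> that B by (auto simp: B_def)
      have "((\<lambda>t. \<rho> (z, t)) has_real_derivative 0) (at t)"
        using has_derivative_slices(2)[OF pt(1) zt] fc[OF zt] by simp
      then show ?thesis by (simp add: has_field_derivative_def has_derivative_at_withinI lambda_zero)
    qed
    then obtain k where "\<forall>t\<in>?W. \<rho> (z, t) = k"
      using has_derivative_zero_constant[of ?W "\<lambda>t. \<rho> (z, t)"] convex_ball by blast
    then show ?thesis using that \<epsilon>(1) by (simp add: B_def r_def)
  qed
  have sr: "smooth_on ?Z r"
    unfolding r_def
    by (rule smooth_on_compose[OF open_ball smooth_on_Pair[OF open_ball smooth_on_id[OF open_ball] smooth_on_const] pt(1)])
      (use \<epsilon> in auto)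
  have pdr: "pd1 \<rho> (z, w) = deriv r z" if zw: "(z, w) \<in> B" for z w
    using deriv_iterate_cong[OF open_ball, of z0 \<epsilon> "\<lambda>t. \<rho> (t, w)" r z 1] Br zw
    by (auto simp: B_def pd1_def)
  obtain \<phi> U V where U: "open U" "(z0, w0) \<in> U" "U \<subseteq> B" and V: "open V" "smooth_on V \<phi>"
    and UV: "\<And>z w. (z, w) \<in> U \<Longrightarrow> (z, \<psi> (z, w)) \<in> V \<and> \<phi> (z, \<psi> (z, w)) = w"
    and VU: "\<And>z y. (z, y) \<in> V \<Longrightarrow> (z, \<phi> (z, y)) \<in> U \<and> \<psi> (z, \<phi> (z, y)) = y"
    and d\<phi>: "\<And>z y. (z, y) \<in> V \<Longrightarrow> pd2 \<psi> (z, \<phi> (z, y)) \<noteq> 0 \<and>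
      ((\<lambda>t. \<phi> (z, t)) has_real_derivative 1 / pd2 \<psi> (z, \<phi> (z, y))) (at y)"
    by (rule fibrewise_inverse[OF B(1) smooth_on_subset[OF pt(2) B(2)] B(3) nz(2)[OF zw]]) (rule that)
  define y0 where "y0 = \<psi> (z0, w0)"
  have y0: "(z0, y0) \<in> V" using UV[OF U(2)] by (simp add: y0_def)
  obtain e1 where e1: "e1 > 0" "ball z0 e1 \<times> ball y0 e1 \<subseteq> V" by (rule open_real_prod_ball[OF V(1) y0])
  \<comment> \<open>On this set r + (1 - r z0) is positive, which provides the shift of the chart.\<close>
  have "open (?Z \<inter> r -` {r z0 - 1<..})"
    by (rule continuous_open_preimage[OF smooth_on_continuous[OF sr]]) auto
  moreover have "z0 \<in> ?Z \<inter> r -` {r z0 - 1<..}" using \<epsilon>(1) by simp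
  ultimately obtain e2 where e2: "e2 > 0" "ball z0 e2 \<subseteq> ?Z \<inter> r -` {r z0 - 1<..}"
    using open_contains_ball by blast
  define I where "I = ball z0 (min e1 e2)"
  define K where "K = ball y0 e1"
  have IV: "(z, y) \<in> V" if "z \<in> I" "y \<in> K" for z y
    using that e1 unfolding I_def K_def by (auto simp: subset_iff)
  have Ie2: "I \<subseteq> ball z0 e2" unfolding I_def by (rule subset_ball) simp
  interpret fibred_chart n D \<rho> \<psi> I K r "1 - r z0" \<phi>
  proof
    show "open I" "is_interval I" "I \<noteq> {}" "open K" "is_interval K" "K \<noteq> {}"
      using e1(1) e2(1) by (auto simp: I_def K_def is_interval_ball_real)
    show "smooth_on I r" by (rule smooth_on_subset[OF sr]) (use Ie2 e2(2) in blast)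
    fix z assume z: "z \<in> I"
    then have zZ: "z \<in> ?Z" "r z > r z0 - 1" using Ie2 e2(2) by auto
    show "r z + (1 - r z0) \<noteq> 0" using zZ(2) by simp
    have "(z, w0) \<in> B" using zZ(1) \<epsilon>(1) by (simp add: B_def)
    then show "deriv r z \<noteq> 0" using pdr nz(1) B(2) by (metis subsetD)
    fix y assume y: "y \<in> K"
    note v = IV[OF z y]
    have b: "(z, \<phi> (z, y)) \<in> B" using VU[OF v] U by auto
    show "(z, \<phi> (z, y)) \<in> D \<and> \<psi> (z, \<phi> (z, y)) = y \<and>
      \<rho> (z, \<phi> (z, y)) = r z \<and> pd1 \<rho> (z, \<phi> (z, y)) = deriv r z \<and> pd2 \<rho> (z, \<phi> (z, y)) = 0 \<and>
      pd2 \<psi> (z, \<phi> (z, y)) \<noteq> 0 \<and>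
      ((\<lambda>t. \<phi> (z, t)) has_real_derivative 1 / pd2 \<psi> (z, \<phi> (z, y))) (at y)"
      using VU[OF v] b B(2) Br[OF b] pdr[OF b] fc d\<phi>[OF v] by auto
  next
    show "smooth_on (I \<times> K) \<phi>" by (rule smooth_on_subset[OF V(2)]) (use IV in auto)
  qed (use n D G in auto)
  define W where "W = (U \<inter> \<psi> -` K) \<inter> fst -` I"
  have "open (U \<inter> \<psi> -` K)"
    by (rule continuous_open_preimage[OF smooth_on_continuous[OF smooth_on_subset[OF pt(2)]] U(1)])
      (use U B in \<open>auto simp: K_def\<close>)
  moreover have "open (fst -` I :: (real \<times> real) set)" by (rule open_vimage_fst) (simp add: I_def)
  ultimately have W: "open W" unfolding W_def by auto
  have "(z0, w0) \<in> W" using U(2) e1(1) e2(1) by (auto simp: W_def I_def K_def y0_def)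
  then obtain e3 where e3: "e3 > 0" "ball z0 e3 \<times> ball w0 e3 \<subseteq> W" using open_real_prod_ball[OF W] by blast
  define N where "N = ball z0 e3 \<times> ball w0 e3"
  have N: "open N" "connected N" "p0 \<in> N" "N \<subseteq> W"
    using e3 e by (auto simp: N_def intro!: open_Times connected_Times)
  have "z \<in> I \<and> \<psi> (z, w) \<in> K \<and> \<phi> (z, \<psi> (z, w)) = w" if "(z, w) \<in> N" for z w
    using that N(4) UV[of z w] by (auto simp: W_def)
  then obtain k1 k2 k3 k4 r0 where "projective_form n N k1 k2 k3 k4 r0 \<rho> \<psi>"
    using chart_projective[OF N(1,2)] N(3) by (metis empty_iff)
  moreover have "N \<subseteq> D" using N(4) U(3) B(2) by (auto simp: W_def)
  ultimately show ?thesis using that N by blast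
qed

section \<open>Gluing local projective forms\<close>

text \<open>Two quotients of affine functions that agree on an interval agree wherever one of them is defined, and
their denominators have the same zeros because the determinants do not vanish.\<close>

lemma projective_form_transfer:
  assumes U: "open U" "projective_form n U k1 k2 k3 k4 r0 \<rho> \<psi>"
    and W: "open W" "projective_form n W l1 l2 l3 l4 t0 \<rho> \<psi>"
    and q: "q \<in> U" "q \<in> W"
  shows "projective_form n U l1 l2 l3 l4 t0 \<rho> \<psi>"
proof -
  have k: "k2 * k3 - k1 * k4 \<noteq> 0" "r0 \<noteq> 0"
    and kU: "\<And>z w. (z, w) \<in> U \<Longrightarrow> k4 * z + k3 \<noteq> 0 \<and> \<rho> (z, w) = (k2 * z + k1) / (k4 * z + k3)"
    and k\<psi>: "\<And>z w. (z, w) \<in> U \<Longrightarrow> \<psi> (z, w) = r0 * half_pow (pd1 \<rho> (z, w)) (n - 1) * w"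
    using U(2) unfolding projective_form_def by auto
  have l: "l4 = 0 \<or> l4 = 1" "l2 * l3 - l1 * l4 \<noteq> 0" "t0 \<noteq> 0"
    and lW: "\<And>z w. (z, w) \<in> W \<Longrightarrow> l4 * z + l3 \<noteq> 0 \<and> \<rho> (z, w) = (l2 * z + l1) / (l4 * z + l3)"
    and l\<psi>: "\<And>z w. (z, w) \<in> W \<Longrightarrow> \<psi> (z, w) = t0 * half_pow (pd1 \<rho> (z, w)) (n - 1) * w"
    using W(2) unfolding projective_form_def by auto
  obtain a b where ab: "q = (a, b)" by (cases q)
  obtain r where r: "r > 0" "ball a r \<times> ball b r \<subseteq> U \<inter> W"
    by (rule open_real_prod_ball[OF open_Int[OF U(1) W(1)], of a b]) (use q ab in auto)
  have "[:k1, k2:] * [:l3, l4:] = [:l1, l2:] * [:k3, k4:]"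
  proof (rule poly_eq_on_infinite[OF infinite_ball_real[OF r(1), of a]])
    fix z assume "z \<in> ball a r"
    then have zb: "(z, b) \<in> U" "(z, b) \<in> W" using r by auto
    have "(k2 * z + k1) / (k4 * z + k3) = (l2 * z + l1) / (l4 * z + l3)"
      using kU[OF zb(1)] lW[OF zb(2)] by simp
    then have "(k2 * z + k1) * (l4 * z + l3) = (l2 * z + l1) * (k4 * z + k3)"
      using kU[OF zb(1)] lW[OF zb(2)] by (simp add: frac_eq_eq)
    then show "poly ([:k1, k2:] * [:l3, l4:]) z = poly ([:l1, l2:] * [:k3, k4:]) z"
      unfolding poly_mult by (simp add: algebra_simps)
  qed
  then have eq: "poly ([:k1, k2:] * [:l3, l4:]) z = poly ([:l1, l2:] * [:k3, k4:]) z" for z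
    by (rule arg_cong)
  then have cross: "(k2 * z + k1) * (l4 * z + l3) = (l2 * z + l1) * (k4 * z + k3)" for z
    using eq[of z] unfolding poly_mult by (simp add: algebra_simps)
  have l\<rho>: "l4 * z + l3 \<noteq> 0 \<and> \<rho> (z, w) = (l2 * z + l1) / (l4 * z + l3)" if zw: "(z, w) \<in> U" for z w
  proof -
    have nz: "l4 * z + l3 \<noteq> 0"
    proof
      assume 0: "l4 * z + l3 = 0"
      then have "l2 * z + l1 = 0" using cross[of z] kU[OF zw] by simp
      then have "l2 * (l4 * z + l3) - l4 * (l2 * z + l1) = 0" using 0 by simp
      moreover have "l2 * (l4 * z + l3) - l4 * (l2 * z + l1) = l2 * l3 - l1 * l4"
        by (simp add: algebra_simps)
      ultimately show False using l(2) by simp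
    qed
    then show ?thesis using cross[of z] kU[OF zw] by (simp add: frac_eq_eq)
  qed
  obtain w where w: "w \<in> ball b r" "w \<noteq> 0"
    using infinite_ball_real[OF r(1), of b]
    by (metis finite.emptyI finite_insert finite_subset insertI1 subsetI singletonD)
  have aw: "(a, w) \<in> U" "(a, w) \<in> W" using w r by auto
  have "pd1 \<rho> (a, w) \<noteq> 0" using pd1_moebius[OF U(1) aw(1) kU] k(1) kU[OF aw(1)] by simp
  then have "t0 = r0"
    using k\<psi>[OF aw(1)] l\<psi>[OF aw(2)] w(2) half_pow_nonzero[of "pd1 \<rho> (a, w)" "n - 1"] by simp
  then show ?thesis
    unfolding projective_form_def using l l\<rho> k\<psi> by blast
qed

text \<open>The points near which a fixed projective form holds make up an open set S. By projective_form_transfer a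
connected neighbourhood of any other point either lies in S or does not meet it. The vertical sections of D
may be disconnected, so that connectedness of D itself has to be used.\<close>

lemma G_projective:
  assumes n: "n \<ge> 2" and D: "open D" "connected D" "D \<noteq> {}" and G: "(\<rho>, \<psi>) \<in> G n D"
  shows "\<exists>k1 k2 k3 k4 r0. projective_form n D k1 k2 k3 k4 r0 \<rho> \<psi>"
proof -
  obtain p0 where p0: "p0 \<in> D" using D by auto
  obtain U0 k1 k2 k3 k4 r0 where U0: "open U0" "p0 \<in> U0" "U0 \<subseteq> D"
    "projective_form n U0 k1 k2 k3 k4 r0 \<rho> \<psi>"
    by (rule G_locally_projective[OF n D(1) G p0]) (rule that)
  let ?P = "\<lambda>U. projective_form n U k1 k2 k3 k4 r0 \<rho> \<psi>"
  define S where "S = \<Union>{U. open U \<and> U \<subseteq> D \<and> ?P U}"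
  define T where "T = \<Union>{U. open U \<and> U \<subseteq> D \<and> U \<inter> S = {}}"
  have "open S" "open T" unfolding S_def T_def by (auto intro: open_Union)
  moreover have "S \<inter> T \<inter> D = {}" unfolding T_def by blast
  moreover have "D \<subseteq> S \<union> T"
  proof
    fix p assume p: "p \<in> D"
    obtain U l1 l2 l3 l4 t0 where U: "open U" "p \<in> U" "U \<subseteq> D"
      "projective_form n U l1 l2 l3 l4 t0 \<rho> \<psi>"
      by (rule G_locally_projective[OF n D(1) G p]) (rule that)
    show "p \<in> S \<union> T"
    proof (cases "U \<inter> S = {}")
      case True
      then show ?thesis using U unfolding T_def by blast
    next
      case False
      then obtain q W where "q \<in> U" "q \<in> W" "open W" "?P W" unfolding S_def by blast
      then have "?P U" using projective_form_transfer[OF U(1,4)] by blast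
      then show ?thesis using U unfolding S_def by blast
    qed
  qed
  ultimately have "S \<inter> D = {} \<or> T \<inter> D = {}" using connectedD[OF D(2), of S T] by blast
  moreover have "p0 \<in> S" using U0 unfolding S_def by blast
  ultimately have "D \<subseteq> S" using p0 \<open>D \<subseteq> S \<union> T\<close> by blast
  then have "?P D"
    using U0(4) unfolding S_def projective_form_def by blast
  then show ?thesis by blast
qed

section \<open>Uniqueness of the transformed parameter\<close>

text \<open>Two transformed equations have the same solution jets; as both are solved for the top derivative with
coefficient one, the iterated operators agree on every jet.\<close>

lemma transformed_parameters_agree:
  assumes n: "n \<ge> 2" and D: "open D" "smooth_on D \<rho>" "smooth_on D \<psi>"
    and \<rho>: "\<And>p. p \<in> D \<Longrightarrow> pd1 \<rho> p \<noteq> 0" "\<And>p. p \<in> D \<Longrightarrow> pd2 \<rho> p = 0"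
    and Q: "transformed_parameter n D \<rho> \<psi> F Q" "transformed_parameter n D \<rho> \<psi> F Q'"
    and l: "smooth_on UNIV l" "(z0, l z0) \<in> D"
  shows "(Omega Q l ^^ n) l z0 = (Omega Q' l ^^ n) l z0"
proof -
  define v where "v = - (Omega Q l ^^ n) l z0 / fact n"
  define w where "w = (\<lambda>z. l z + v * (z - z0) ^ n)"
  have sw: "smooth_on UNIV w"
    unfolding w_def by (intro smooth_on_add smooth_on_mult smooth_on_const smooth_on_power
        smooth_on_diff smooth_on_id open_UNIV l)
  have wz: "w z0 = l z0" using n by (simp add: w_def)
  have *: "(Omega Q w ^^ n) w z0 = (Omega Q l ^^ n) l z0 + fact n * v"
    "(Omega Q' w ^^ n) w z0 = (Omega Q' l ^^ n) l z0 + fact n * v"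
    unfolding w_def
    using Omega_iterate_add_power[OF n D(1) transformed_parameter_smooth[OF Q(1)] l]
      Omega_iterate_add_power[OF n D(1) transformed_parameter_smooth[OF Q(2)] l] by blast+
  have wD: "(z0, w z0) \<in> D" using l wz by simp
  have nz: "pd1 \<rho> (z0, w z0) + pd2 \<rho> (z0, w z0) * deriv w z0 \<noteq> 0" using \<rho>[OF wD] by simp
  obtain I y where "corresponding_curves D \<rho> \<psi> I w y" "z0 \<in> I"
    by (rule exists_corresponding_curve[OF D open_UNIV UNIV_I sw wD nz]) (rule that)
  then have "(Omega Q w ^^ n) w z0 = 0 \<longleftrightarrow> (Omega Q' w ^^ n) w z0 = 0"
    using transformed_parameter_zero_iff[OF Q(1)] transformed_parameter_zero_iff[OF Q(2)] by metis
  then show ?thesis unfolding * by (simp add: v_def)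
qed

text \<open>Perturbing a constant curve in the (n-1)-st derivative isolates the coefficient of that derivative in the
equation, which is n Q + w Q_w.\<close>

lemma Omega_iterate_const_bump:
  assumes n: "n \<ge> 2" and D: "open D" "smooth_on D Q" "(z0, w0) \<in> D"
  defines "b \<equiv> \<lambda>z. w0 + (z - z0) ^ (n - 1)"
  shows "(Omega Q b ^^ n) b z0 = (Omega Q (\<lambda>_. w0) ^^ n) (\<lambda>_. w0) z0 +
    (deriv ^^ n) (\<lambda>z. (z - z0) ^ (n - 1)) z0 +
    fact (n - 1) * (real n * Q (z0, w0) + w0 * pd2 Q (z0, w0))"
proof -
  let ?a = "\<lambda>_::real. w0"
  have sb: "smooth_on UNIV b" unfolding b_def by (intro smooth_intros open_UNIV)
  have b0: "b z0 = w0" using n by (simp add: b_def)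
  define S where "S = (\<lambda>z. (z, w0)) -` D \<inter> (\<lambda>z. (z, b z)) -` D"
  have S: "open S" unfolding S_def
    by (intro open_Int open_vimage D continuous_on_Pair continuous_on_id continuous_on_const
        smooth_on_continuous[OF sb])
  have z0: "z0 \<in> S" using D(3) b0 by (simp add: S_def)
  have ba: "(\<lambda>z. b z - w0) = (\<lambda>z. (z - z0) ^ (n - 1))" by (simp add: b_def)
  have fl: "flat (n - 1) (\<lambda>z. b z - w0) z0" "(deriv ^^ (n - 1)) (\<lambda>z. b z - w0) z0 = fact (n - 1)"
    unfolding ba using deriv_iterate_power[of "n - 1" z0] by auto
  have c: "\<And>z. z \<in> S \<Longrightarrow> (z, w0) \<in> D" "\<And>z. z \<in> S \<Longrightarrow> (z, b z) \<in> D" by (auto simp: S_def)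
  note sbS = smooth_on_subset[OF sb, of S, simplified]
  have n1: "n - 1 \<ge> 1" using n by simp
  have fQ: "flat (n - 1) (\<lambda>z. Q (z, b z) - Q (z, w0)) z0"
    "(deriv ^^ (n - 1)) (\<lambda>z. Q (z, b z) - Q (z, w0)) z0 = pd2 Q (z0, w0) * fact (n - 1)"
    using flat_along_curve_diff[OF S D(1) z0 D(2) smooth_on_const sbS c fl(1)] n1 fl(2) by auto
  have sQ: "smooth_on S (\<lambda>z. Q (z, w0))" "smooth_on S (\<lambda>z. Q (z, b z))"
    using smooth_on_along_curve[OF S D(2) smooth_on_const c(1)]
      smooth_on_along_curve[OF S D(2) sbS c(2)] by auto
  show ?thesis
    using first_order_iterate_perturb[OF n S z0 smooth_on_const[of S w0] sbS sQ fl(1) fQ(1)]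
    unfolding Omega_eq_first_order fQ(2) fl(2) unfolding ba by (simp add: algebra_simps)
qed

lemma sum_shift:
  "(\<Sum>i\<le>N + k. (if k \<le> i then a (i - k) else 0) * (x::real) ^ i) = x ^ k * (\<Sum>i\<le>N. a i * x ^ i)"
proof -
  have "(\<Sum>i\<le>N + k. (if k \<le> i then a (i - k) else 0) * x ^ i) = (\<Sum>i\<in>{0 + k..N + k}. a (i - k) * x ^ i)"
    by (rule sum.mono_neutral_cong_right) auto
  also have "\<dots> = (\<Sum>i\<in>{0..N}. a i * x ^ (i + k))"
    unfolding sum.shift_bounds_cl_nat_ivl by simp
  also have "\<dots> = x ^ k * (\<Sum>i\<le>N. a i * x ^ i)"
    by (simp add: sum_distrib_left power_add atMost_atLeast0 mult_ac)
  finally show ?thesis .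
qed

text \<open>On constant curves, for a parameter of the form \<beta> w + c/w^(n+1). The most singular term can only arise by
picking c/w^(n+1) at each of the m steps; after clearing denominators it is the constant coefficient c^m.\<close>

lemma singular_expansion:
  assumes "open I" "smooth_on I \<beta>" "smooth_on I c"
  shows "\<exists>d N. (\<forall>i. smooth_on I (d i)) \<and> (\<forall>z\<in>I. d 0 z = c z ^ m) \<and>
    (\<forall>z\<in>I. \<forall>w. w \<noteq> 0 \<longrightarrow>
      (first_order (\<lambda>z. \<beta> z * w + c z / w ^ Suc n) ^^ m) (\<lambda>_. w) z * w ^ (Suc n * m) =
      w * (\<Sum>i\<le>N. d i z * w ^ i))"
proof (induction m)
  case 0
  show ?case
    by (rule exI[of _ "\<lambda>i _. if i = 0 then 1 else 0"], rule exI[of _ 0]) (auto intro: smooth_on_const)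
next
  case (Suc m)
  then obtain d N where dN: "(\<forall>i. smooth_on I (d i)) \<and> (\<forall>z\<in>I. d 0 z = c z ^ m) \<and>
    (\<forall>z\<in>I. \<forall>w. w \<noteq> 0 \<longrightarrow>
      (first_order (\<lambda>z. \<beta> z * w + c z / w ^ Suc n) ^^ m) (\<lambda>_. w) z * w ^ (Suc n * m) =
      w * (\<Sum>i\<le>N. d i z * w ^ i))" by (elim exE)
  note d = dN[THEN conjunct1, rule_format]
    and d0 = dN[THEN conjunct2, THEN conjunct1, rule_format]
    and ex = dN[THEN conjunct2, THEN conjunct2, rule_format]
  define e where "e i z = ((if i \<le> N then c z * d i z else 0) +
    (if Suc n \<le> i then (if i - Suc n \<le> N then deriv (d (i - Suc n)) z else 0) else 0)) +
    (if Suc (Suc n) \<le> i then \<beta> z * d (i - Suc (Suc n)) z else 0)" for i z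
  have se: "smooth_on I (e i)" for i
  proof -
    have "smooth_on I (\<lambda>z. if i \<le> N then c z * d i z else 0)"
      by (cases "i \<le> N"; simp; intro smooth_on_const smooth_on_mult d assms)
    moreover have "smooth_on I (\<lambda>z. if Suc n \<le> i then (if i - Suc n \<le> N then deriv (d (i - Suc n)) z else 0) else 0)"
      by (cases "Suc n \<le> i"; cases "i - Suc n \<le> N"; simp; intro smooth_on_const smooth_on_deriv d assms)
    moreover have "smooth_on I (\<lambda>z. if Suc (Suc n) \<le> i then \<beta> z * d (i - Suc (Suc n)) z else 0)"
      by (cases "Suc (Suc n) \<le> i"; simp; intro smooth_on_const smooth_on_mult d assms)
    ultimately show ?thesis unfolding e_def by (intro smooth_on_add assms)
  qed
  have e0: "e 0 z = c z ^ Suc m" if "z \<in> I" for z using d0[OF that] by (simp add: e_def)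
  have ee: "(first_order (\<lambda>z. \<beta> z * w + c z / w ^ Suc n) ^^ Suc m) (\<lambda>_. w) z * w ^ (Suc n * Suc m) =
      w * (\<Sum>i\<le>N + Suc (Suc n). e i z * w ^ i)" if z: "z \<in> I" and w: "w \<noteq> 0" for z w
  proof -
    let ?u = "(first_order (\<lambda>z. \<beta> z * w + c z / w ^ Suc n) ^^ m) (\<lambda>_. w)"
    let ?s = "\<lambda>z. \<Sum>i\<le>N. d i z * w ^ i"
    have u: "?u z = (w / w ^ (Suc n * m)) * ?s z" if "z \<in> I" for z
    proof -
      have "?u z = w * ?s z / w ^ (Suc n * m)"
        by (rule eq_divide_imp[OF _ ex[OF that w]]) (use w in simp)
      then show ?thesis by (simp only: times_divide_eq_left)
    qed
    have "deriv ?u z = deriv (\<lambda>z. (w / w ^ (Suc n * m)) * ?s z) z"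
      using deriv_iterate_cong[OF assms(1) u z, of _ 1] by simp
    also have "\<dots> = (w / w ^ (Suc n * m)) * (\<Sum>i\<le>N. deriv (d i) z * w ^ i)"
      by (intro DERIV_imp_deriv DERIV_cmult DERIV_sum DERIV_cmult_right smooth_on_real_derivative[OF d z])
    finally have du: "deriv ?u z = (w / w ^ (Suc n * m)) * (\<Sum>i\<le>N. deriv (d i) z * w ^ i)" .
    have "(first_order (\<lambda>z. \<beta> z * w + c z / w ^ Suc n) ^^ Suc m) (\<lambda>_. w) z * w ^ (Suc n * Suc m) =
      ((w / w ^ (Suc n * m)) * (\<Sum>i\<le>N. deriv (d i) z * w ^ i) +
       (\<beta> z * w + c z / w ^ Suc n) * ((w / w ^ (Suc n * m)) * ?s z)) * (w ^ Suc n * w ^ (Suc n * m))"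
      unfolding first_order_Suc du u[OF z] by (simp only: mult_Suc_right power_add)
    also have "\<dots> = w * (c z * ?s z + w ^ Suc n * (\<Sum>i\<le>N. deriv (d i) z * w ^ i) +
       w ^ Suc (Suc n) * (\<beta> z * ?s z))"
    proof -
      have ring: "(t * S' + (b * (t * A) + q) * (t * S)) * (B * A) =
          (t * A) * ((q * B) * S + B * S' + ((t * A) * B) * (b * S))" for t q A B S S' b :: real
        by (simp add: algebra_simps)
      have "((w / A) * S' + (b * w + C / B) * ((w / A) * S)) * (B * A) =
          w * (C * S + B * S' + (w * B) * (b * S))" if "A \<noteq> 0" "B \<noteq> 0" for A B S S' b C :: real
      proof -
        have "w / A * A = w" "C / B * B = C" using that by simp_all
        then show ?thesis using ring[of "w / A" S' b A "C / B" S B] by (simp only:)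
      qed
      then show ?thesis unfolding power_Suc[of w "Suc n"] by (rule) (use w in simp_all)
    qed
    also have "c z * ?s z = (\<Sum>i\<le>N + Suc (Suc n). (if i \<le> N then c z * d i z else 0) * w ^ i)"
      unfolding sum_distrib_left by (rule sum.mono_neutral_cong_left) (auto simp: mult.assoc)
    also have "w ^ Suc n * (\<Sum>i\<le>N. deriv (d i) z * w ^ i) =
       (\<Sum>i\<le>N + Suc (Suc n). (if Suc n \<le> i then (if i - Suc n \<le> N then deriv (d (i - Suc n)) z else 0) else 0) * w ^ i)"
    proof -
      have "(\<Sum>i\<le>N. deriv (d i) z * w ^ i) = (\<Sum>i\<le>Suc N. (if i \<le> N then deriv (d i) z else 0) * w ^ i)"
        by (rule sum.mono_neutral_cong_left) auto
      then show ?thesis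
        using sum_shift[where N = "Suc N" and k = "Suc n" and a = "\<lambda>i. if i \<le> N then deriv (d i) z else 0" and x = w] by simp
    qed
    also have "w ^ Suc (Suc n) * (\<beta> z * ?s z) =
       (\<Sum>i\<le>N + Suc (Suc n). (if Suc (Suc n) \<le> i then \<beta> z * d (i - Suc (Suc n)) z else 0) * w ^ i)"
      unfolding sum_shift[where N = N and k = "Suc (Suc n)" and a = "\<lambda>i. \<beta> z * d i z" and x = w] by (simp add: sum_distrib_left mult.assoc)
    finally show ?thesis unfolding e_def distrib_right sum.distrib .
  qed
  show ?case
    by (rule exI[of _ e], rule exI[of _ "N + Suc (Suc n)"], intro conjI allI ballI impI)
      (rule se, erule e0, erule (1) ee)
qed

text \<open>The difference P of the two parameters satisfies the Euler equation n P + w P_w = 0, hence is c(z)/w^n away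
from w = 0. A nonzero c would leave the term c^n of singular_expansion on one side only. Points with w = 0
follow by continuity.\<close>

lemma transformed_parameter_unique:
  assumes n: "n \<ge> 2" and D: "open D" "smooth_on D \<rho>" "smooth_on D \<psi>"
    and \<rho>: "\<And>p. p \<in> D \<Longrightarrow> pd1 \<rho> p \<noteq> 0" "\<And>p. p \<in> D \<Longrightarrow> pd2 \<rho> p = 0"
    and Q: "transformed_parameter n D \<rho> \<psi> F Q"
    and \<beta>: "smooth_on (fst ` D) \<beta>" "transformed_parameter n D \<rho> \<psi> F (\<lambda>(z, w). \<beta> z * w)"
    and zw: "(z0, w0) \<in> D"
  shows "Q (z0, w0) = \<beta> z0 * w0"
proof -
  let ?Q' = "\<lambda>(z, w). \<beta> z * w"
  define P where "P p = Q p - ?Q' p" for p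
  have agree: "(Omega Q l ^^ n) l z = (Omega ?Q' l ^^ n) l z"
    if "smooth_on UNIV l" "(z, l z) \<in> D" for l z
    by (rule transformed_parameters_agree[OF n D _ _ Q \<beta>(2) that]) (use \<rho> in auto)
  note sQ = transformed_parameter_smooth[OF Q] transformed_parameter_smooth[OF \<beta>(2)]
  have sP: "smooth_on D P" unfolding P_def by (intro smooth_on_diff D sQ)
  have euler: "real n * P (z, w) + w * pd2 P (z, w) = 0" if zw: "(z, w) \<in> D" for z w
  proof -
    have s: "smooth_on UNIV (\<lambda>t. w + (t - z) ^ (n - 1))" by (intro smooth_intros open_UNIV)
    have e1: "(Omega Q (\<lambda>t. w + (t - z) ^ (n - 1)) ^^ n) (\<lambda>t. w + (t - z) ^ (n - 1)) z =
        (Omega ?Q' (\<lambda>t. w + (t - z) ^ (n - 1)) ^^ n) (\<lambda>t. w + (t - z) ^ (n - 1)) z"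
      by (rule agree[OF s]) (use zw n in \<open>simp add: power_0_left\<close>)
    have e2: "(Omega Q (\<lambda>_. w) ^^ n) (\<lambda>_. w) z = (Omega ?Q' (\<lambda>_. w) ^^ n) (\<lambda>_. w) z"
      by (rule agree[OF smooth_on_const]) (use zw in simp)
    have "real n * Q (z, w) + w * pd2 Q (z, w) = real n * ?Q' (z, w) + w * pd2 ?Q' (z, w)"
      using e1 unfolding Omega_iterate_const_bump[OF n D(1) sQ(1) zw]
        Omega_iterate_const_bump[OF n D(1) sQ(2) zw] e2 by simp
    moreover have "pd2 P (z, w) = pd2 Q (z, w) - pd2 ?Q' (z, w)"
      using DERIV_imp_deriv[OF DERIV_diff[OF has_derivative_slices(2)[OF sQ(1) zw] has_derivative_slices(2)[OF sQ(2) zw]]]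
      by (simp add: pd2_def P_def)
    moreover have "P (z, w) = Q (z, w) - ?Q' (z, w)" by (rule P_def)
    ultimately show ?thesis by (simp only: right_diff_distrib)
  qed
  have nonzero: "P (z0, w0) = 0" if zw: "(z0, w0) \<in> D" and w0: "w0 \<noteq> 0" for z0 w0
  proof -
    have "open (D \<inter> snd -` (- {0}))" by (intro open_Int D open_vimage_snd) auto
    then obtain r where r: "r > 0" "ball z0 r \<times> ball w0 r \<subseteq> D \<inter> snd -` (- {0})"
      by (rule open_real_prod_ball[of _ z0 w0]) (use zw w0 in auto)
    let ?Z = "ball z0 r" and ?W = "ball w0 r"
    have in_D: "(z, w) \<in> D" "w \<noteq> 0" if "z \<in> ?Z" "w \<in> ?W" for z w
    proof -
      have "(z, w) \<in> D \<inter> snd -` (- {0})" using r(2) that by blast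
      then show "(z, w) \<in> D" "w \<noteq> 0" by auto
    qed
    have z0: "z0 \<in> ?Z" "w0 \<in> ?W" using r by auto
    obtain k where k: "n = Suc k" using n by (cases n) auto
    \<comment> \<open>By the Euler equation P w^n is constant in w on the rectangle.\<close>
    define c where "c z = P (z, w0) * w0 ^ n" for z
    have Pc: "P (z, w) * w ^ n = c z" if z: "z \<in> ?Z" and w: "w \<in> ?W" for z w
    proof -
      have "((\<lambda>t. P (z, t) * t ^ n) has_derivative (\<lambda>h. 0)) (at t within ?W)" if t: "t \<in> ?W" for t
      proof -
        note zt = in_D(1)[OF z t]
        have "((\<lambda>t. P (z, t) * t ^ n) has_real_derivative
            pd2 P (z, t) * t ^ n + (1 + real k) * (1 * t ^ k) * P (z, t)) (at t)"
          unfolding k by (intro DERIV_mult has_derivative_slices(2)[OF sP zt] DERIV_power_Suc DERIV_ident)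
        moreover have "pd2 P (z, t) * t ^ n + (1 + real k) * (1 * t ^ k) * P (z, t) =
            t ^ k * (real n * P (z, t) + t * pd2 P (z, t))"
          by (simp add: k algebra_simps)
        ultimately have "((\<lambda>t. P (z, t) * t ^ n) has_real_derivative 0) (at t)"
          using euler[OF zt] by simp
        then show ?thesis by (simp add: has_field_derivative_def has_derivative_at_withinI lambda_zero)
      qed
      then obtain C where "\<forall>t\<in>?W. P (z, t) * t ^ n = C"
        using has_derivative_zero_constant[of ?W "\<lambda>t. P (z, t) * t ^ n"] convex_ball by blast
      then show ?thesis using z0(2) w by (simp add: c_def)
    qed
    have s1: "smooth_on ?Z (\<lambda>z. P (z, w0))"
      by (rule smooth_on_along_curve[OF open_ball sP smooth_on_const]) (use in_D z0 in auto)
    have sc: "smooth_on ?Z c"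
      unfolding c_def by (intro smooth_on_mult smooth_on_const open_ball s1)
    have ZD: "?Z \<subseteq> fst ` D" using in_D(1)[OF _ z0(2)] by force
    have s\<beta>: "smooth_on ?Z \<beta>" by (rule smooth_on_subset[OF \<beta>(1) ZD])
    obtain d N where dN: "(\<forall>i. smooth_on ?Z (d i)) \<and> (\<forall>z\<in>?Z. d 0 z = c z ^ n) \<and>
      (\<forall>z\<in>?Z. \<forall>w. w \<noteq> 0 \<longrightarrow>
        (first_order (\<lambda>z. \<beta> z * w + c z / w ^ Suc k) ^^ n) (\<lambda>_. w) z * w ^ (Suc k * n) =
        w * (\<Sum>i\<le>N. d i z * w ^ i))"
      using singular_expansion[OF open_ball s\<beta> sc, of n k] by (elim exE)
    note d0 = dN[THEN conjunct2, THEN conjunct1, rule_format]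
      and ex = dN[THEN conjunct2, THEN conjunct2, rule_format]
    have z0D: "z0 \<in> fst ` D" using ZD z0 by auto
    have n1: "n \<ge> 1" using n by simp
    obtain b where b: "\<And>w. (Omega ?Q' (\<lambda>_. w) ^^ n) (\<lambda>_. w) z0 = w ^ 2 * poly b w"
      by (rule Omega_iterate_const_poly[OF open_image_fst[OF D(1)] \<beta>(1) z0D n1]) (rule that)
    let ?p = "\<Sum>i\<le>N. monom (d i z0) i"
    \<comment> \<open>Both sides are w^(n^2 - 1) times the iterated operator, and the right-hand one has no constant term.\<close>
    have "?p = monom 1 (Suc (Suc k * n)) * b"
    proof (rule poly_eq_on_infinite[OF infinite_ball_real[OF r(1), of w0]])
      fix w assume w: "w \<in> ?W"
      have wz: "w \<noteq> 0" using in_D(2)[OF z0(1) w] .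
      have Qw: "Q (z, w) = \<beta> z * w + c z / w ^ Suc k" if z: "z \<in> ?Z" for z
        using Pc[OF z w] wz unfolding k P_def by (simp add: field_simps)
      have "(Omega Q (\<lambda>_. w) ^^ n) (\<lambda>_. w) z0 =
          (first_order (\<lambda>z. \<beta> z * w + c z / w ^ Suc k) ^^ n) (\<lambda>_. w) z0"
        unfolding Omega_eq_first_order
        by (rule first_order_iterate_cong[OF open_ball _ _ z0(1)]) (simp_all only: Qw)
      moreover have "(Omega Q (\<lambda>_. w) ^^ n) (\<lambda>_. w) z0 = w ^ 2 * poly b w"
        unfolding b[symmetric] by (rule agree[OF smooth_on_const]) (use in_D(1)[OF z0(1) w] in simp)
      ultimately have "w ^ 2 * poly b w * w ^ (Suc k * n) = w * (\<Sum>i\<le>N. d i z0 * w ^ i)"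
        using ex[OF z0(1) wz] by simp
      then have "w * (w * poly b w * w ^ (Suc k * n)) = w * (\<Sum>i\<le>N. d i z0 * w ^ i)"
        by (simp only: power2_eq_square mult.assoc)
      then have "w * poly b w * w ^ (Suc k * n) = (\<Sum>i\<le>N. d i z0 * w ^ i)"
        using mult_left_cancel[OF wz] by blast
      moreover have "(\<Sum>i\<le>N. d i z0 * w ^ i) = poly ?p w" by (simp add: poly_sum poly_monom)
      moreover have "w * poly b w * w ^ (Suc k * n) = poly (monom 1 (Suc (Suc k * n)) * b) w"
        by (simp only: poly_mult poly_monom power_Suc mult_ac mult_1_left)
      ultimately show "poly ?p w = poly (monom 1 (Suc (Suc k * n)) * b) w" by simp
    qed
    then have "coeff ?p 0 = coeff (monom 1 (Suc (Suc k * n)) * b) 0" by simp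
    then have "d 0 z0 = 0" by (simp add: coeff_sum coeff_monom coeff_mult_0 del: mult_Suc)
    then have "c z0 = 0" using d0[OF z0(1)] n by simp
    then show ?thesis using w0 by (simp add: c_def)
  qed
  have "P (z0, w0) = 0"
  proof (cases "w0 = 0")
    case True
    have "isCont (\<lambda>t. P (z0, t)) 0"
      using has_derivative_slices(2)[OF sP zw] True DERIV_isCont by blast
    then have 1: "((\<lambda>t. P (z0, t)) \<longlongrightarrow> P (z0, 0)) (at 0)" by (simp add: isCont_def)
    have "\<forall>\<^sub>F t in at 0. (z0, t) \<in> D \<and> t \<noteq> 0"
      using eventually_slice(2)[OF D(1) zw] True
      unfolding eventually_at_filter by (auto elim: eventually_mono)
    then have "\<forall>\<^sub>F t in at 0. 0 = P (z0, t)" by (rule eventually_mono) (use nonzero in auto)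
    then have "((\<lambda>t. P (z0, t)) \<longlongrightarrow> 0) (at 0)"
      by (rule Lim_transform_eventually[OF tendsto_const])
    from tendsto_unique[OF trivial_limit_at 1 this] show ?thesis using True by simp
  qed (rule nonzero[OF zw])
  then show ?thesis by (simp add: P_def)
qed

theorem proposition1:
  fixes n :: nat and D :: "(real \<times> real) set"
  assumes "n \<ge> 2" and "open D" and "connected D" and "D \<noteq> {}"
  shows "G n D = {(\<rho>, \<psi>). \<exists>k1 k2 k3 k4 r0. projective_form n D k1 k2 k3 k4 r0 \<rho> \<psi>} \<and>
    (\<forall>k1 k2 k3 k4 r0 \<rho> \<psi> \<alpha> Q.
       projective_form n D k1 k2 k3 k4 r0 \<rho> \<psi> \<longrightarrow> smooth_on (\<rho> ` D) \<alpha> \<longrightarrow>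
       (transformed_parameter n D \<rho> \<psi> (\<lambda>(x, y). \<alpha> x * y) Q \<longleftrightarrow>
        (\<forall>(z, w)\<in>D. Q (z, w) =
           r0 * \<alpha> (\<rho> (z, w)) * (pd1 \<rho> (z, w) * half_pow (pd1 \<rho> (z, w)) (n - 1)) * w)))"
proof (intro conjI allI impI)
  show "G n D = {(\<rho>, \<psi>). \<exists>k1 k2 k3 k4 r0. projective_form n D k1 k2 k3 k4 r0 \<rho> \<psi>}"
  proof (rule set_eqI)
    fix x :: "(real \<times> real \<Rightarrow> real) \<times> (real \<times> real \<Rightarrow> real)"
    obtain \<rho> \<psi> where x: "x = (\<rho>, \<psi>)" by (cases x)
    show "x \<in> G n D \<longleftrightarrow> x \<in> {(\<rho>, \<psi>). \<exists>k1 k2 k3 k4 r0. projective_form n D k1 k2 k3 k4 r0 \<rho> \<psi>}"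
      unfolding x mem_Collect_eq prod.case
      using G_projective[OF assms] projective_in_G(1)[OF assms(1-3)] by blast
  qed
next
  fix k1 k2 k3 k4 r0 :: real and \<rho> \<psi> Q :: "real \<times> real \<Rightarrow> real" and \<alpha> :: "real \<Rightarrow> real"
  assume P: "projective_form n D k1 k2 k3 k4 r0 \<rho> \<psi>" and \<alpha>: "smooth_on (\<rho> ` D) \<alpha>"
  let ?Q = "\<lambda>(z, w). r0 * \<alpha> (\<rho> (z, w)) * (pd1 \<rho> (z, w) * half_pow (pd1 \<rho> (z, w)) (n - 1)) * w"
  note G = projective_in_G(1)[OF assms(1-3) P]
  have pt: "smooth_on D \<rho>" "smooth_on D \<psi>"
    and J: "\<And>p. p \<in> D \<Longrightarrow> pd1 \<rho> p * pd2 \<psi> p - pd2 \<rho> p * pd1 \<psi> p \<noteq> 0"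
    using G_point_transformation[OF G] by (auto simp: point_transformation_def)
  note pd2 = G_rho_fibre_constant[OF assms(1,2) G]
  have pd1: "pd1 \<rho> p \<noteq> 0" if "p \<in> D" for p using J[OF that] pd2[OF that] by auto
  obtain \<delta> where \<delta>: "smooth_on (fst ` D) \<delta>"
    "transformed_parameter n D \<rho> \<psi> (\<lambda>(x, y). \<alpha> x * y) (\<lambda>(z, w). \<delta> z * w)"
    by (rule G_linear_parameter[OF G \<alpha>])
  have unique: "Q (z, w) = \<delta> z * w"
    if "transformed_parameter n D \<rho> \<psi> (\<lambda>(x, y). \<alpha> x * y) Q" "(z, w) \<in> D" for Q z w
    by (rule transformed_parameter_unique[OF assms(1,2) pt _ _ that(1) \<delta> that(2)]) (use pd1 pd2 in auto)
  have "transformed_parameter n D \<rho> \<psi> (\<lambda>(x, y). \<alpha> x * y) ?Q"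
    by (rule projective_in_G(2)[OF assms(1-3) P \<alpha>]) simp
  from unique[OF this] have \<delta>Q:
    "r0 * \<alpha> (\<rho> (z, w)) * (pd1 \<rho> (z, w) * half_pow (pd1 \<rho> (z, w)) (n - 1)) * w = \<delta> z * w"
    if "(z, w) \<in> D" for z w using that by simp
  show "transformed_parameter n D \<rho> \<psi> (\<lambda>(x, y). \<alpha> x * y) Q \<longleftrightarrow>
        (\<forall>(z, w)\<in>D. Q (z, w) =
           r0 * \<alpha> (\<rho> (z, w)) * (pd1 \<rho> (z, w) * half_pow (pd1 \<rho> (z, w)) (n - 1)) * w)"
  proof
    assume Q: "transformed_parameter n D \<rho> \<psi> (\<lambda>(x, y). \<alpha> x * y) Q"
    show "\<forall>(z, w)\<in>D. Q (z, w) =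
           r0 * \<alpha> (\<rho> (z, w)) * (pd1 \<rho> (z, w) * half_pow (pd1 \<rho> (z, w)) (n - 1)) * w"
      by clarify (rule trans[OF unique[OF Q] \<delta>Q[symmetric]])
  next
    assume "\<forall>(z, w)\<in>D. Q (z, w) =
           r0 * \<alpha> (\<rho> (z, w)) * (pd1 \<rho> (z, w) * half_pow (pd1 \<rho> (z, w)) (n - 1)) * w"
    then show "transformed_parameter n D \<rho> \<psi> (\<lambda>(x, y). \<alpha> x * y) Q"
      by (intro projective_in_G(2)[OF assms(1-3) P \<alpha>]) auto
  qed
qed

end
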